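(* Let $C_i$ and $G_i(V_i,E_i,\mathcal{F}_i)$, $i=1,\ldots,4$, be a system of cuboids and a system of labeled cuboid graphs corresponding to the common edge $e=\overline{P_1P_2}$, with common iso-level $c\in(0,1)$, $C_i$ being the cuboid of $G_i$. Assume that the nodes of $G_1$ corresponding to the end points of $e$ are iso-nodes ($\mathcal{F}_1(P_1)=\mathcal{F}_1(P_2)=c$). Let $N(e)$ be the total number of iso-paths (of $G_1,\ldots,G_4$) that pass through $e$. Then $N(e)\in\{0,2m\}$ with $m\le 4$. If $m\ge1$, denote these iso-paths by $\omega_1,\ldots,\omega_{2m}$ and let $G_{\omega_i}\in\{G_1,\ldots,G_4\}$ be the labeled cuboid graph corresponding to $\omega_i$. Then to any $\omega\in\{\omega_1,\ldots,\omega_{2m}\}$ there exists $\omega'\in\{\omega_1,\ldots,\omega_{2m}\}$, $\omega'\ne\omega$, such that one of the following holds: (i) $G_\omega$ and $G_{\omega'}$ are face-neighbored and have two common disperse nodes; (ii) if (i) does not hold, then $m\le 3$ and there exists a unique $l\in\{1,\ldots,4-m\}$, depending on $\omega$ and $\omega'$, and graphs $G_{r_1},\ldots,G_{r_l}\in\{G_1,\ldots,G_4\}$ such that $G_\omega$ is face-neighbored to $G_{r_1}$, $G_{r_l}$ is face-neighbored to $G_{\omega'}$, and, if $l>1$, $G_{r_i}$ is face-neighbored to $G_{r_{i+1}}$ for $i=1,\ldots,l-1$; moreover each $G_{r_i}$, $i=1,\ldots,l$, has at least seven disperse nodes and hence no iso-path that passes through $e$. In this situation the pair $\omega,\omega'$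 is said to be disperse connected with respect to the common iso-line $e$. Furthermore, this property is unique: no other iso-path is disperse connected to $\omega$ or to $\omega'$ with respect to $e$.
   Context: **Labeled cuboid graphs.** A cuboid is $C=[a_1,b_1]\times[a_2,b_2]\times[a_3,b_3]\subset\mathbb{R}^3$. A labeled cuboid graph $G(V,E,\mathcal{F})$ consists of the 8 vertices $V$ and 12 edges $E$ of a cuboid (the cuboid of $G$) and $\mathcal{F}:V\to[0,1]$. Two nodes are incident if they are the end points of an edge. Fix an iso-level $c\in(0,1)$. A node $P$ is disperse if $\mathcal{F}(P)>c$ and continuous if $\mathcal{F}(P)\le c$; $D(G)$ is the number of disperse nodes. $G$ (or a face, or an edge) is disperse (continuous) if all its nodes are. On an edge with end points $x_0,x_1$ such that $\mathcal{F}(x_0)\le c<\mathcal{F}(x_1)$, the iso-point is the point $x_0+(x_1-x_0)\frac{c-\mathcal{F}(x_0)}{\mathcal{F}(x_1)-\mathcal{F}(x_0)}$; these are all iso-points of $G$. An iso-node is a node that is an iso-point (label $c$ and incident to a disperse node). An L-face is a face with exactly two disperse and two continuous nodes, the disperse ones not incident; it is trivial if both its continuous nodes are iso-nodes, otherwise non-trivial. $L(G)$ is the set of L-faces. A singular face has three disperse nodes and one iso-node. A regular face is one that is not an L-face, disperse, continuous or singular. Two faces of a cuboid are parallel if they have no common node. Two graphs are face-neighbors if the intersection of their cuboids is a face of both. **Singular / isolated iso-paths; regular graphs.** A $T_1$-subgraph of $G$: a node with label $c$ together with its three incident nodes, all disperse. A $T_2$-subgraph: a subgraph with seven nodes, two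 of which are incident and have label $c$ while the other five are disperse. $G$ is an $F_1$-graph if there is $\tilde V\subset V$, $|\tilde V|=4$, with each $P\in\tilde V$ incident to exactly two nodes of $V\setminus\tilde V$, $\mathcal{F}=c$ on $\tilde V$ and $\mathcal{F}>c$ on $V\setminus\tilde V$. $G_1$ is an $F_2$-graph if it has a face-neighbor $G_2$ such that all four common nodes have label $c$ (in both) and all other nodes of $G_1$ and of $G_2$ are disperse. $G$ is singular iso-path free if it has no $T_1$- or $T_2$-subgraph, and isolated iso-path free if it is not an $F_1$- or $F_2$-graph. $G$ is regular if it is neither disperse nor continuous, is singular iso-path free and isolated iso-path free. **Systems at an edge.** A system of cuboids with common edge $e$ consists of four distinct cuboids $C_1,\ldots,C_4$ having the edge $e$ in common and such that $C_i\cap C_j\nsubseteq e$ ($i\ne j$) implies that $C_i$ and $C_j$ have a common face (i.e. the four cuboids surrounding $e$ in a cuboid mesh). A system of labeled cuboid graphs with common edge $e$ consists of labeled cuboid graphs $G_1,\ldots,G_4$ with cuboids $C_1,\ldots,C_4$ and a common iso-level $c$, all singular iso-path free and isolated iso-path free. They arise from one labeling of the cuboid vertices by the following removal step, performed separately in each cuboid: if the graph is not an $F_1$- or $F_2$-graph, the label-$c$ node of every $T_1$-subgraph, and then both label-$c$ nodes of a $T_2$-subgraph (if any), are relabeled $1$; if the graph is an $F_1$- or $F_2$-graph, its four label-$c$ nodes are relabeled $1$. (So labels of different $G_i$ at a common vertex may differ.) **$S$-subgraphs.** $S_1$-subgraph: a disperse node and its three incident nodes, all continuous. $S_2$-subgraph: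 two incident disperse nodes and the four further nodes incident to them, all continuous. $S_3$-subgraph: a node with label $<c$ and its three incident nodes, all disperse. An $S_i$-rule at an $S_i$-subgraph $H$ records the closed polygon through the iso-points on the edges of $H$ (a triangle for $i=1,3$; for $i=2$ the quadrilateral through the four iso-points, consecutive ones on a common face), and then relabels: for $i=1,2$ the disperse nodes of $H$ get label $0$; for $i=3$ the continuous node of $H$ gets label $1$. The $S_i^n$-rule is the successive application of the $S_i$-rule at $n$ distinct $S_i$-subgraphs. Table of $S^n$-rules for regular $G$ with $L(G)\ne\emptyset$: $D=2$: $S_1$. $D=3$: $S_1$ if $|L(G)|=1$, $S_1^2$ if $|L(G)|=3$. $D=4$: if $|L(G)|=2$, $S_1$ for non-parallel and $S_2$ for parallel L-faces; $S_1^3$ if $|L(G)|=6$. $D=5$: $S_3$ if $|L(G)|=1$, $S_1$ if $|L(G)|=3$. $D=6$: $S_3$. **Iso-paths.** $C$-rules: on each regular face join the two iso-points lying on the edges of the face that have one disperse and one continuous end point. Inner iso-paths of a regular $G$: (1) if $L(G)\neq\emptyset$, apply the $S^n$-rule from the table, recording $n$ polygons; the resulting graph has a further iso-path, formed by the segments given by the $C$-rules; (2) if $L(G)=\emptyset$, $D(G)=2$ and $G$ has an $S_1$-subgraph (resp. $D(G)=6$ and $G$ has an $S_3$-subgraph), apply the $S_1$-rule (resp. $S_3$-rule) once and then the $C$-rules to the resulting graph; (3) otherwise the $C$-rules applied to $G$ give the iso-path. Non-regular graphs have no iso-path. Outer iso-paths are certain closed polygons lying on non-trivial L-faces; they never have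 a cuboid edge as an edge. An iso-path passes through $e$ if $e$ is one of its edges; the graph corresponding to an iso-path is the graph $G_i$ of which it is an iso-path.
   Formalization: A T_2-subgraph must also contain all nodes incident to its two label-c nodes (else N(e) can be odd), and disperse connection also requires ω, ω′ to pass through e along the faces by which one leaves their graphs (else uniqueness of ω′ and of l fails). *)

theory Defs
  imports "HOL-Analysis.Analysis"
begin

section \<open>Cuboids\<close>

type_synonym point = "real ^ 3"

text \<open>A cuboid is given by its two extreme corners.  Edges and faces are represented by their sets
  of nodes (two resp. four points); the geometric object is the convex hull.\<close>

datatype cuboid = Cuboid (lo: point) (hi: point)

definition is_cuboid :: "cuboid \<Rightarrow> bool" where
  "is_cuboid C \<longleftrightarrow> (\<forall>i. lo C $ i < hi C $ i)"

definition cuboid_set :: "cuboid \<Rightarrow> point set" where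
  "cuboid_set C = cbox (lo C) (hi C)"

definition nodes :: "cuboid \<Rightarrow> point set" where
  "nodes C = {v. \<forall>i. v $ i = lo C $ i \<or> v $ i = hi C $ i}"

definition edges :: "cuboid \<Rightarrow> point set set" where
  "edges C = {{u, v} | u v. u \<in> nodes C \<and> v \<in> nodes C \<and> (\<exists>!i. u $ i \<noteq> v $ i)}"

definition faces :: "cuboid \<Rightarrow> point set set" where
  "faces C = {{v \<in> nodes C. v $ i = t} | i t. t = lo C $ i \<or> t = hi C $ i}"

definition incident_nodes :: "cuboid \<Rightarrow> point \<Rightarrow> point set" where
  "incident_nodes C v = {u. {v, u} \<in> edges C}"

definition face_neighbors :: "cuboid \<Rightarrow> cuboid \<Rightarrow> bool" where
  "face_neighbors C C' \<longleftrightarrow>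
     (\<exists>f \<in> faces C \<inter> faces C'. cuboid_set C \<inter> cuboid_set C' = convex hull f)"

section \<open>Labeled cuboid graphs\<close>

text \<open>Only the values of \<open>lab\<close> on the nodes of the cuboid are meaningful.\<close>

record lcgraph =
  cub :: cuboid
  lab :: "point \<Rightarrow> real"

abbreviation gnodes :: "lcgraph \<Rightarrow> point set" where "gnodes G \<equiv> nodes (cub G)"
abbreviation gedges :: "lcgraph \<Rightarrow> point set set" where "gedges G \<equiv> edges (cub G)"
abbreviation gfaces :: "lcgraph \<Rightarrow> point set set" where "gfaces G \<equiv> faces (cub G)"
abbreviation nbrs :: "lcgraph \<Rightarrow> point \<Rightarrow> point set" where "nbrs G \<equiv> incident_nodes (cub G)"
abbreviation face_nbrs :: "lcgraph \<Rightarrow> lcgraph \<Rightarrow> bool" where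
  "face_nbrs G G' \<equiv> face_neighbors (cub G) (cub G')"

definition labeled_cuboid_graph :: "lcgraph \<Rightarrow> bool" where
  "labeled_cuboid_graph G \<longleftrightarrow> is_cuboid (cub G) \<and> (\<forall>v \<in> gnodes G. lab G v \<in> {0..1})"

definition disperse_nodes :: "real \<Rightarrow> lcgraph \<Rightarrow> point set" where
  "disperse_nodes c G = {v \<in> gnodes G. lab G v > c}"

definition continuous_nodes :: "real \<Rightarrow> lcgraph \<Rightarrow> point set" where
  "continuous_nodes c G = {v \<in> gnodes G. lab G v \<le> c}"

abbreviation D :: "real \<Rightarrow> lcgraph \<Rightarrow> nat" where
  "D c G \<equiv> card (disperse_nodes c G)"

text \<open>Edges with one continuous and one disperse end point, directed towards the disperse one.\<close>

definition mixed_edges :: "real \<Rightarrow> lcgraph \<Rightarrow> (point \<times> point) set" where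
  "mixed_edges c G = {(x0, x1). {x0, x1} \<in> gedges G \<and> lab G x0 \<le> c \<and> c < lab G x1}"

definition iso_point :: "real \<Rightarrow> lcgraph \<Rightarrow> point \<Rightarrow> point \<Rightarrow> point" where
  "iso_point c G x0 x1 = x0 + ((c - lab G x0) / (lab G x1 - lab G x0)) *\<^sub>R (x1 - x0)"

definition iso_points :: "real \<Rightarrow> lcgraph \<Rightarrow> point set" where
  "iso_points c G = {iso_point c G x0 x1 | x0 x1. (x0, x1) \<in> mixed_edges c G}"

definition iso_node :: "real \<Rightarrow> lcgraph \<Rightarrow> point \<Rightarrow> bool" where
  "iso_node c G v \<longleftrightarrow> v \<in> gnodes G \<and> v \<in> iso_points c G"

definition L_faces :: "real \<Rightarrow> lcgraph \<Rightarrow> point set set" where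
  "L_faces c G = {f \<in> gfaces G. card (f \<inter> disperse_nodes c G) = 2 \<and>
     card (f \<inter> continuous_nodes c G) = 2 \<and> f \<inter> disperse_nodes c G \<notin> gedges G}"

definition trivial_L_face :: "real \<Rightarrow> lcgraph \<Rightarrow> point set \<Rightarrow> bool" where
  "trivial_L_face c G f \<longleftrightarrow>
     f \<in> L_faces c G \<and> (\<forall>v \<in> f \<inter> continuous_nodes c G. iso_node c G v)"

definition singular_face :: "real \<Rightarrow> lcgraph \<Rightarrow> point set \<Rightarrow> bool" where
  "singular_face c G f \<longleftrightarrow>
     f \<in> gfaces G \<and> card (f \<inter> disperse_nodes c G) = 3 \<and> (\<exists>v \<in> f. iso_node c G v)"

definition regular_face :: "real \<Rightarrow> lcgraph \<Rightarrow> point set \<Rightarrow> bool" where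
  "regular_face c G f \<longleftrightarrow> f \<in> gfaces G \<and> f \<notin> L_faces c G \<and>
     \<not> f \<subseteq> disperse_nodes c G \<and> \<not> f \<subseteq> continuous_nodes c G \<and> \<not> singular_face c G f"

section \<open>Singular and isolated iso-paths; regular graphs\<close>

text \<open>The \<open>T\<^sub>1\<close>-subgraph is determined by its node \<open>P\<close> with label \<open>c\<close>.\<close>

definition T1_subgraph :: "real \<Rightarrow> lcgraph \<Rightarrow> point \<Rightarrow> bool" where
  "T1_subgraph c G P \<longleftrightarrow> P \<in> gnodes G \<and> lab G P = c \<and> nbrs G P \<subseteq> disperse_nodes c G"

text \<open>As for \<open>T\<^sub>1\<close>, the \<open>T\<^sub>2\<close>-subgraph \<open>H\<close> contains, with its two label-\<open>c\<close> nodes \<open>P\<close> and \<open>Q\<close>, all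
  nodes incident to them; thus the possible eighth node is incident to neither \<open>P\<close> nor \<open>Q\<close>.
  This is exactly the situation in which the iso-path near \<open>P\<close> and \<open>Q\<close> degenerates to the segment
  \<open>PQ\<close>: if a node with label \<open>< c\<close> incident to \<open>P\<close> were admitted as eighth node, \<open>PQ\<close> would be an
  edge of a proper iso-path, and the number of iso-paths through \<open>PQ\<close> could become odd.\<close>

definition T2_subgraph :: "real \<Rightarrow> lcgraph \<Rightarrow> point set \<Rightarrow> point \<Rightarrow> point \<Rightarrow> bool" where
  "T2_subgraph c G H P Q \<longleftrightarrow> H \<subseteq> gnodes G \<and> card H = 7 \<and> P \<in> H \<and> Q \<in> H \<and>
     {P, Q} \<in> gedges G \<and> nbrs G P \<union> nbrs G Q \<subseteq> H \<and>
     lab G P = c \<and> lab G Q = c \<and> H - {P, Q} \<subseteq> disperse_nodes c G"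

definition F1_graph :: "real \<Rightarrow> lcgraph \<Rightarrow> bool" where
  "F1_graph c G \<longleftrightarrow> (\<exists>W \<subseteq> gnodes G. card W = 4 \<and>
     (\<forall>P \<in> W. card (nbrs G P \<inter> (gnodes G - W)) = 2) \<and>
     (\<forall>P \<in> W. lab G P = c) \<and> (\<forall>P \<in> gnodes G - W. lab G P > c))"

text \<open>The set \<open>M\<close> is the collection of graphs among which face-neighbors are sought.\<close>

definition F2_graph :: "real \<Rightarrow> lcgraph set \<Rightarrow> lcgraph \<Rightarrow> bool" where
  "F2_graph c M G \<longleftrightarrow> (\<exists>G' \<in> M. face_nbrs G G' \<and>
     (\<forall>P \<in> gnodes G \<inter> gnodes G'. lab G P = c \<and> lab G' P = c) \<and>
     (\<forall>P \<in> gnodes G - gnodes G'. lab G P > c) \<and>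
     (\<forall>P \<in> gnodes G' - gnodes G. lab G' P > c))"

definition singular_free :: "real \<Rightarrow> lcgraph \<Rightarrow> bool" where
  "singular_free c G \<longleftrightarrow> \<not> (\<exists>P. T1_subgraph c G P) \<and> \<not> (\<exists>H P Q. T2_subgraph c G H P Q)"

definition isolated_free :: "real \<Rightarrow> lcgraph set \<Rightarrow> lcgraph \<Rightarrow> bool" where
  "isolated_free c M G \<longleftrightarrow> \<not> F1_graph c G \<and> \<not> F2_graph c M G"

definition regular_graph :: "real \<Rightarrow> lcgraph set \<Rightarrow> lcgraph \<Rightarrow> bool" where
  "regular_graph c M G \<longleftrightarrow> \<not> gnodes G \<subseteq> disperse_nodes c G \<and> \<not> gnodes G \<subseteq> continuous_nodes c G \<and>
     singular_free c G \<and> isolated_free c M G"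

section \<open>Systems with a common edge\<close>

text \<open>The common edge is the segment from \<open>P1\<close> to \<open>P2\<close>.  "Have a common face" is understood as in
  a mesh: the intersection of the two cuboids is a face of both.\<close>

definition system_of_cuboids :: "(nat \<Rightarrow> cuboid) \<Rightarrow> point \<Rightarrow> point \<Rightarrow> bool" where
  "system_of_cuboids C P1 P2 \<longleftrightarrow>
     (\<forall>i \<in> {1..4}. is_cuboid (C i) \<and> {P1, P2} \<in> edges (C i)) \<and> inj_on C {1..4} \<and>
     (\<forall>i \<in> {1..4}. \<forall>j \<in> {1..4}. i \<noteq> j \<longrightarrow>
        \<not> cuboid_set (C i) \<inter> cuboid_set (C j) \<subseteq> closed_segment P1 P2 \<longrightarrow>
        face_neighbors (C i) (C j))"

definition relabel :: "point set \<Rightarrow> real \<Rightarrow> lcgraph \<Rightarrow> lcgraph" where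
  "relabel A t G = G\<lparr>lab := (\<lambda>v. if v \<in> A then t else lab G v)\<rparr>"

text \<open>\<open>removal c M G G'\<close>: the removal step, applied to \<open>G\<close> within the unmodified collection \<open>M\<close>,
  can lead to \<open>G'\<close>.\<close>

definition removal :: "real \<Rightarrow> lcgraph set \<Rightarrow> lcgraph \<Rightarrow> lcgraph \<Rightarrow> bool" where
  "removal c M G G' \<longleftrightarrow>
     (if F1_graph c G \<or> F2_graph c M G
      then G' = relabel {P \<in> gnodes G. lab G P = c} 1 G
      else let G1 = relabel {P. T1_subgraph c G P} 1 G in
        if \<exists>H P Q. T2_subgraph c G1 H P Q
        then \<exists>H P Q. T2_subgraph c G1 H P Q \<and> G' = relabel {P, Q} 1 G1
        else G' = G1)"

definition system_of_graphs ::
    "real \<Rightarrow> (nat \<Rightarrow> cuboid) \<Rightarrow> (nat \<Rightarrow> lcgraph) \<Rightarrow> point \<Rightarrow> point \<Rightarrow> bool" where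
  "system_of_graphs c C G P1 P2 \<longleftrightarrow> system_of_cuboids C P1 P2 \<and>
     (\<forall>i \<in> {1..4}. cub (G i) = C i \<and> labeled_cuboid_graph (G i) \<and>
        singular_free c (G i) \<and> isolated_free c (G ` {1..4}) (G i)) \<and>
     (\<exists>F. (\<forall>v. F v \<in> {0..1}) \<and>
        (\<forall>i \<in> {1..4}. \<exists>G'. removal c ((\<lambda>j. \<lparr>cub = C j, lab = F\<rparr>) ` {1..4}) \<lparr>cub = C i, lab = F\<rparr> G' \<and>
           (\<forall>v \<in> nodes (C i). lab (G i) v = lab G' v)))"

section \<open>Iso-paths\<close>

text \<open>Every edge of an iso-path joins two points on a face of the cuboid.  An iso-path is
  represented by the set of its edges, each edge \<open>{p, q}\<close> being paired with the face
  along which it is drawn.  The face is needed because a cuboid edge lies on two faces: a single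
  graph may have two iso-paths through the same cuboid edge, drawn along different faces.\<close>

type_synonym iso_path = "(point set \<times> point set) set"

text \<open>The iso-points on those edges of the subgraph with node set \<open>H\<close> that lie on the face \<open>f\<close>.\<close>

definition face_iso_points :: "real \<Rightarrow> lcgraph \<Rightarrow> point set \<Rightarrow> point set \<Rightarrow> point set" where
  "face_iso_points c G H f =
     {iso_point c G x0 x1 | x0 x1. (x0, x1) \<in> mixed_edges c G \<and> {x0, x1} \<subseteq> H \<inter> f}"

text \<open>On a regular face there are exactly two such iso-points, so that \<open>face_iso_points\<close> is the
  segment joining them.\<close>

definition C_path :: "real \<Rightarrow> lcgraph \<Rightarrow> iso_path" where
  "C_path c G = {(f, face_iso_points c G (gnodes G) f) | f. regular_face c G f}"

datatype S_kind = S1 | S2 | S3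

fun S_subgraph :: "real \<Rightarrow> S_kind \<Rightarrow> lcgraph \<Rightarrow> point set \<Rightarrow> bool" where
  "S_subgraph c S1 G H \<longleftrightarrow> (\<exists>P \<in> disperse_nodes c G.
     nbrs G P \<subseteq> continuous_nodes c G \<and> H = insert P (nbrs G P))"
| "S_subgraph c S2 G H \<longleftrightarrow> (\<exists>P \<in> disperse_nodes c G. \<exists>Q \<in> disperse_nodes c G.
     {P, Q} \<in> gedges G \<and> (nbrs G P \<union> nbrs G Q) - {P, Q} \<subseteq> continuous_nodes c G \<and>
     H = {P, Q} \<union> nbrs G P \<union> nbrs G Q)"
| "S_subgraph c S3 G H \<longleftrightarrow> (\<exists>P \<in> gnodes G. lab G P < c \<and>
     nbrs G P \<subseteq> disperse_nodes c G \<and> H = insert P (nbrs G P))"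

text \<open>A face contains either no or exactly two iso-points on edges of an S-subgraph; in
  the latter case these are consecutive vertices of the recorded polygon.\<close>

definition S_polygon :: "real \<Rightarrow> lcgraph \<Rightarrow> point set \<Rightarrow> iso_path" where
  "S_polygon c G H =
     {(f, face_iso_points c G H f) | f. f \<in> gfaces G \<and> face_iso_points c G H f \<noteq> {}}"

fun S_relabel :: "real \<Rightarrow> S_kind \<Rightarrow> lcgraph \<Rightarrow> point set \<Rightarrow> lcgraph" where
  "S_relabel c S1 G H = relabel (H \<inter> disperse_nodes c G) 0 G"
| "S_relabel c S2 G H = relabel (H \<inter> disperse_nodes c G) 0 G"
| "S_relabel c S3 G H = relabel (H \<inter> continuous_nodes c G) 1 G"

text \<open>\<open>S_rule c k n G Ps G'\<close>: applying the \<open>S\<^sub>k\<close>-rule successively \<open>n\<close> times to \<open>G\<close> can record the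
  polygons \<open>Ps\<close> and result in \<open>G'\<close>.  The subgraphs used are distinct, as an application destroys
  its subgraph.\<close>

inductive S_rule ::
    "real \<Rightarrow> S_kind \<Rightarrow> nat \<Rightarrow> lcgraph \<Rightarrow> iso_path set \<Rightarrow> lcgraph \<Rightarrow> bool" for c k where
  zero: "S_rule c k 0 G {} G"
| step: "S_subgraph c k G H \<Longrightarrow> S_rule c k n (S_relabel c k G H) Ps G' \<Longrightarrow>
    S_rule c k (Suc n) G (insert (S_polygon c G H) Ps) G'"

definition parallel_L_faces :: "real \<Rightarrow> lcgraph \<Rightarrow> bool" where
  "parallel_L_faces c G \<longleftrightarrow> (\<exists>f \<in> L_faces c G. \<exists>f' \<in> L_faces c G. f \<inter> f' = {})"

definition S_table :: "real \<Rightarrow> lcgraph \<Rightarrow> S_kind \<Rightarrow> nat \<Rightarrow> bool" where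
  "S_table c G k n \<longleftrightarrow> (let d = D c G; l = card (L_faces c G) in
       (d = 2 \<and> k = S1 \<and> n = 1)
     \<or> (d = 3 \<and> l = 1 \<and> k = S1 \<and> n = 1)
     \<or> (d = 3 \<and> l = 3 \<and> k = S1 \<and> n = 2)
     \<or> (d = 4 \<and> l = 2 \<and> \<not> parallel_L_faces c G \<and> k = S1 \<and> n = 1)
     \<or> (d = 4 \<and> l = 2 \<and> parallel_L_faces c G \<and> k = S2 \<and> n = 1)
     \<or> (d = 4 \<and> l = 6 \<and> k = S1 \<and> n = 3)
     \<or> (d = 5 \<and> l = 1 \<and> k = S3 \<and> n = 1)
     \<or> (d = 5 \<and> l = 3 \<and> k = S1 \<and> n = 1)
     \<or> (d = 6 \<and> k = S3 \<and> n = 1))"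

text \<open>\<open>S_then_C c k n G Q\<close>: \<open>Q\<close> consists of the polygons recorded by \<open>n\<close> applications of the
  \<open>S\<^sub>k\<close>-rule and the iso-path that the C-rules yield for the resulting graph.\<close>

definition S_then_C :: "real \<Rightarrow> S_kind \<Rightarrow> nat \<Rightarrow> lcgraph \<Rightarrow> iso_path set \<Rightarrow> bool" where
  "S_then_C c k n G Q \<longleftrightarrow> (\<exists>Ps G'. S_rule c k n G Ps G' \<and> Q = insert (C_path c G') Ps)"

text \<open>\<open>Q\<close> is a possible set of inner iso-paths of \<open>G\<close> (the S-rules leave open at which
  S-subgraphs they are applied).\<close>

definition inner_iso_paths :: "real \<Rightarrow> lcgraph set \<Rightarrow> lcgraph \<Rightarrow> iso_path set \<Rightarrow> bool" where
  "inner_iso_paths c M G Q \<longleftrightarrow>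
     (if \<not> regular_graph c M G then Q = {}
      else if L_faces c G \<noteq> {} then \<exists>k n. S_table c G k n \<and> S_then_C c k n G Q
      else if D c G = 2 \<and> (\<exists>H. S_subgraph c S1 G H) then S_then_C c S1 1 G Q
      else if D c G = 6 \<and> (\<exists>H. S_subgraph c S3 G H) then S_then_C c S3 1 G Q
      else Q = {C_path c G})"

definition polygon_edges :: "point list \<Rightarrow> point set set" where
  "polygon_edges vs = {{vs ! i, vs ! (Suc i mod length vs)} | i. i < length vs}"

text \<open>Of the outer iso-paths of a regular graph only these properties are relevant:
  they are closed polygons on non-trivial L-faces, none of whose edges is an edge of the cuboid.
  Every family of polygons with these properties is admitted.\<close>

definition outer_iso_paths :: "real \<Rightarrow> lcgraph set \<Rightarrow> lcgraph \<Rightarrow> iso_path set \<Rightarrow> bool" where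
  "outer_iso_paths c M G Q \<longleftrightarrow> (\<forall>\<omega> \<in> Q. regular_graph c M G \<and>
     (\<exists>vs. 3 \<le> length vs \<and> distinct vs \<and> snd ` \<omega> = polygon_edges vs) \<and>
     (\<forall>(f, s) \<in> \<omega>. f \<in> L_faces c G \<and> \<not> trivial_L_face c G f \<and> s \<subseteq> convex hull f \<and> s \<notin> gedges G))"

definition passes_along :: "point \<Rightarrow> point \<Rightarrow> iso_path \<Rightarrow> point set \<Rightarrow> bool" where
  "passes_along P1 P2 \<omega> f \<longleftrightarrow> (f, {P1, P2}) \<in> \<omega>"

definition passes_through :: "point \<Rightarrow> point \<Rightarrow> iso_path \<Rightarrow> bool" where
  "passes_through P1 P2 \<omega> \<longleftrightarrow> (\<exists>f. passes_along P1 P2 \<omega> f)"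

text \<open>The iso-paths of the four graphs that pass through the common edge, each together
  with the index of its corresponding graph.\<close>

definition paths_through ::
    "point \<Rightarrow> point \<Rightarrow> (nat \<Rightarrow> iso_path set) \<Rightarrow> (nat \<times> iso_path) set" where
  "paths_through P1 P2 Q = {(i, \<omega>). i \<in> {1..4} \<and> \<omega> \<in> Q i \<and> passes_through P1 P2 \<omega>}"

section \<open>Disperse connection\<close>

text \<open>The elements of \<open>\<Omega>\<close> are pairs \<open>w = (i, \<omega>)\<close>, where \<open>G i\<close> is the graph corresponding to \<open>\<omega>\<close>.

  When a graph has two iso-paths through the common edge, conditions on the graphs alone cannot
  tell these two apart, and disperse connection would not be unique.  It is therefore made explicit
  on which side of each iso-path the other one lies: the face crossed when leaving \<open>G i\<close> is the one
  along which \<open>\<omega>\<close> passes through the common edge.\<close>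

definition crosses ::
    "(nat \<Rightarrow> lcgraph) \<Rightarrow> point \<Rightarrow> point \<Rightarrow> nat \<times> iso_path \<Rightarrow> nat \<Rightarrow> bool" where
  "crosses G P1 P2 w j \<longleftrightarrow> face_nbrs (G (fst w)) (G j) \<and>
     passes_along P1 P2 (snd w) (gnodes (G (fst w)) \<inter> gnodes (G j))"

definition directly_connected ::
    "real \<Rightarrow> (nat \<Rightarrow> lcgraph) \<Rightarrow> point \<Rightarrow> point \<Rightarrow> nat \<times> iso_path \<Rightarrow> nat \<times> iso_path \<Rightarrow> bool" where
  "directly_connected c G P1 P2 w w' \<longleftrightarrow>
     face_nbrs (G (fst w)) (G (fst w')) \<and>
     card (disperse_nodes c (G (fst w)) \<inter> disperse_nodes c (G (fst w'))) = 2 \<and>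
     crosses G P1 P2 w (fst w') \<and> crosses G P1 P2 w' (fst w)"

definition chain_connected ::
    "real \<Rightarrow> (nat \<Rightarrow> lcgraph) \<Rightarrow> point \<Rightarrow> point \<Rightarrow> (nat \<times> iso_path) set \<Rightarrow>
     nat \<times> iso_path \<Rightarrow> nat \<times> iso_path \<Rightarrow> nat \<Rightarrow> bool" where
  "chain_connected c G P1 P2 \<Omega> w w' l \<longleftrightarrow> (\<exists>r :: nat \<Rightarrow> nat.
     (\<forall>k \<in> {1..l}. r k \<in> {1..4}) \<and>
     face_nbrs (G (fst w)) (G (r 1)) \<and> face_nbrs (G (r l)) (G (fst w')) \<and>
     (\<forall>k \<in> {1..<l}. face_nbrs (G (r k)) (G (r (k + 1)))) \<and>
     crosses G P1 P2 w (r 1) \<and> crosses G P1 P2 w' (r l) \<and>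
     (\<forall>k \<in> {1..l}. D c (G (r k)) \<ge> 7 \<and> (\<forall>\<omega>. (r k, \<omega>) \<notin> \<Omega>)))"

definition disperse_connected ::
    "real \<Rightarrow> (nat \<Rightarrow> lcgraph) \<Rightarrow> point \<Rightarrow> point \<Rightarrow> (nat \<times> iso_path) set \<Rightarrow> nat \<Rightarrow>
     nat \<times> iso_path \<Rightarrow> nat \<times> iso_path \<Rightarrow> bool" where
  "disperse_connected c G P1 P2 \<Omega> m w w' \<longleftrightarrow>
     directly_connected c G P1 P2 w w' \<or>
     (\<not> directly_connected c G P1 P2 w w' \<and> m \<le> 3 \<and>
      (\<exists>!l. l \<in> {1..4 - m} \<and> chain_connected c G P1 P2 \<Omega> w w' l))"

end

theory Submission
  imports Defs
begin

text \<open>On a graph with label \<open>c\<close> at both end points of \<open>e\<close>, an iso-path runs through \<open>e\<close> along a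
  face exactly if the two other nodes of that face are disperse; each such face is used by exactly
  one iso-path.  Both such nodes are then disperse already before the removal step, so the condition
  on the face is the same on its two sides, and the iso-path continues directly in the neighboring
  graph unless the removal step has relabeled \<open>e\<close> there.  A relabeled graph entered through such a
  face has at least seven disperse nodes and lets one pass on: either its other face at \<open>e\<close> is again
  of this kind or, for an \<open>F\<^sub>2\<close>-graph, the next graph is relabeled too and the face behind
  it is of this kind.  Going around \<open>e\<close> in this way ends at a graph that still has label \<open>c\<close> on \<open>e\<close>,
  which yields a fixed-point-free involution on the iso-paths through \<open>e\<close>.\<close>

section \<open>Cuboids seen from an edge\<close>

text \<open>The obstacle is that the removal acts on each cuboid separately, so the four graphs may
  disagree about the labels at \<open>P1\<close>, \<open>P2\<close> and on common faces. Everything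
  is therefore expressed by eight truth values: for each of the four faces at the edge, whether its
  two further nodes are disperse under the common labeling \<open>F\<close> before the removal
  (\<open>disperse_pair\<close>), and for each graph, whether both ends of the edge still have label
  \<open>c\<close> (\<open>keeps\<close>). Geometry only serves to arrange the cuboids in a cycle,
  whose rotations and reflections reduce all claims to one graph and one of its faces. The bound
  \<open>4 - m\<close> on chain lengths arises as follows: a graph that keeps the edge labels has at
  most two iso-paths through the edge, so \<open>m\<close> is at most the number of such graphs, and
  the graphs between partners are among the others. The threshold seven fits: label \<open>c\<close>
  at both ends leaves at most six disperse nodes. A chain is an arbitrary walk that may turn back,
  so uniqueness needs care: since \<open>m\<close> is positive the length is at most three, and
  within that length a walk that turns back can only end at the iso-path it started from.\<close>

definition box_at_edge ::
    "cuboid \<Rightarrow> point \<Rightarrow> point \<Rightarrow> point \<Rightarrow> point \<Rightarrow> point \<Rightarrow> point \<Rightarrow> point \<Rightarrow> point \<Rightarrow> bool" where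
  "box_at_edge C P1 P2 A1 A2 B1 B2 E1 E2 \<longleftrightarrow>
     distinct [P1, P2, A1, A2, B1, B2, E1, E2] \<and>
     nodes C = {P1, P2, A1, A2, B1, B2, E1, E2} \<and>
     edges C = {{P1, P2}, {A1, A2}, {B1, B2}, {E1, E2}, {P1, A1}, {P2, A2}, {B1, E1}, {B2, E2},
       {P1, B1}, {P2, B2}, {A1, E1}, {A2, E2}} \<and>
     faces C = {{P1, P2, A1, A2}, {P1, P2, B1, B2}, {E1, E2, A1, A2}, {E1, E2, B1, B2},
       {P1, A1, B1, E1}, {P2, A2, B2, E2}}"

lemma boxD:
  assumes "box_at_edge C P1 P2 A1 A2 B1 B2 E1 E2"
  shows "distinct [P1, P2, A1, A2, B1, B2, E1, E2]"
    and "nodes C = {P1, P2, A1, A2, B1, B2, E1, E2}"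
    and "edges C = {{P1, P2}, {A1, A2}, {B1, B2}, {E1, E2}, {P1, A1}, {P2, A2}, {B1, E1}, {B2, E2},
       {P1, B1}, {P2, B2}, {A1, E1}, {A2, E2}}"
    and "faces C = {{P1, P2, A1, A2}, {P1, P2, B1, B2}, {E1, E2, A1, A2}, {E1, E2, B1, B2},
       {P1, A1, B1, E1}, {P2, A2, B2, E2}}"
  by (rule assms[unfolded box_at_edge_def, THEN conjunct1]
    assms[unfolded box_at_edge_def, THEN conjunct2, THEN conjunct1]
    assms[unfolded box_at_edge_def, THEN conjunct2, THEN conjunct2, THEN conjunct1]
    assms[unfolded box_at_edge_def, THEN conjunct2, THEN conjunct2, THEN conjunct2])+

lemma box_neq:
  assumes "box_at_edge C P1 P2 A1 A2 B1 B2 E1 E2"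
  shows "P1 \<noteq> P2" "P1 \<noteq> A1" "P1 \<noteq> A2" "P1 \<noteq> B1" "P1 \<noteq> B2" "P1 \<noteq> E1" "P1 \<noteq> E2"
    "P2 \<noteq> A1" "P2 \<noteq> A2" "P2 \<noteq> B1" "P2 \<noteq> B2" "P2 \<noteq> E1" "P2 \<noteq> E2"
    "A1 \<noteq> A2" "A1 \<noteq> B1" "A1 \<noteq> B2" "A1 \<noteq> E1" "A1 \<noteq> E2"
    "A2 \<noteq> B1" "A2 \<noteq> B2" "A2 \<noteq> E1" "A2 \<noteq> E2"
    "B1 \<noteq> B2" "B1 \<noteq> E1" "B1 \<noteq> E2"
    "B2 \<noteq> E1" "B2 \<noteq> E2"
    "E1 \<noteq> E2"
  using boxD(1)[OF assms] by simp_all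

text \<open>The letters \<open>A\<close> and \<open>B\<close> name the further nodes of the two
  faces at the edge and \<open>E\<close> the opposite edge; the index tells the end. This symmetry
  together with \<open>box_swap_ends\<close> and \<open>box_turn\<close> carries every node to the
  position of \<open>P1\<close>, so a fact proved at \<open>P1\<close> transfers to all eight
  nodes.\<close>

lemma box_swap_sides:
  assumes "box_at_edge C P1 P2 A1 A2 B1 B2 E1 E2"
  shows "box_at_edge C P1 P2 B1 B2 A1 A2 E1 E2"
proof -
  note b = assms[unfolded box_at_edge_def]
  have "distinct [P1, P2, B1, B2, A1, A2, E1, E2]"
    using b[THEN conjunct1] by auto
  moreover note b[THEN conjunct2]
  ultimately show ?thesis
    unfolding box_at_edge_def by (simp only: insert_commute simp_thms)
qed

lemma box_swap_ends:
  assumes "box_at_edge C P1 P2 A1 A2 B1 B2 E1 E2"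
  shows "box_at_edge C P2 P1 A2 A1 B2 B1 E2 E1"
proof -
  note b = assms[unfolded box_at_edge_def]
  have "distinct [P2, P1, A2, A1, B2, B1, E2, E1]"
    using b[THEN conjunct1] by auto
  moreover note b[THEN conjunct2]
  ultimately show ?thesis
    unfolding box_at_edge_def by (simp only: insert_commute simp_thms)
qed

lemma box_turn:
  assumes "box_at_edge C P1 P2 A1 A2 B1 B2 E1 E2"
  shows "box_at_edge C A1 A2 P1 P2 E1 E2 B1 B2"
proof -
  note b = assms[unfolded box_at_edge_def]
  have "distinct [A1, A2, P1, P2, E1, E2, B1, B2]"
    using b[THEN conjunct1] by auto
  moreover note b[THEN conjunct2]
  ultimately show ?thesis
    unfolding box_at_edge_def by (simp only: insert_commute simp_thms)
qed

lemma box_incident_nodes_edge: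
  assumes "box_at_edge C P1 P2 A1 A2 B1 B2 E1 E2"
  shows "incident_nodes C P1 = {P2, A1, B1}"
proof -
  have ne: "P1 \<notin> {A1, A2, B1, B2, E1, E2, P2}"
    using boxD(1)[OF assms] by simp
  from ne have "P1 \<noteq> P2" "P1 \<noteq> A1" "P1 \<noteq> A2" "P1 \<noteq> B1" "P1 \<noteq> B2" "P1 \<noteq> E1" "P1 \<noteq> E2"
    by blast+
  then show ?thesis
    unfolding incident_nodes_def boxD(3)[OF assms] by (simp only: doubleton_eq_iff insert_iff empty_iff simp_thms, blast)
qed

lemma box_incident_nodes:
  assumes b: "box_at_edge C P1 P2 A1 A2 B1 B2 E1 E2"
  shows "incident_nodes C P1 = {P2, A1, B1}" "incident_nodes C P2 = {P1, A2, B2}"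
    "incident_nodes C A1 = {A2, P1, E1}" "incident_nodes C A2 = {A1, P2, E2}"
    "incident_nodes C B1 = {B2, E1, P1}" "incident_nodes C B2 = {B1, E2, P2}"
    "incident_nodes C E1 = {E2, B1, A1}" "incident_nodes C E2 = {E1, B2, A2}"
proof -
  note inc = box_incident_nodes_edge
  note turn = box_turn[OF b] and swap = box_swap_sides[OF b]
  note turn' = box_turn[OF swap]
  show "incident_nodes C P1 = {P2, A1, B1}" by (rule inc[OF b])
  show "incident_nodes C P2 = {P1, A2, B2}" by (rule inc[OF box_swap_ends[OF b]])
  show "incident_nodes C A1 = {A2, P1, E1}" by (rule inc[OF turn])
  show "incident_nodes C A2 = {A1, P2, E2}" by (rule inc[OF box_swap_ends[OF turn]])
  show "incident_nodes C B1 = {B2, E1, P1}" by (rule inc[OF box_swap_sides[OF turn']])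
  show "incident_nodes C B2 = {B1, E2, P2}" by (rule inc[OF box_swap_ends[OF box_swap_sides[OF turn']]])
  note turn'' = box_swap_sides[OF box_turn[OF box_swap_sides[OF turn]]]
  show "incident_nodes C E1 = {E2, B1, A1}" by (rule inc[OF turn''])
  show "incident_nodes C E2 = {E1, B2, A2}" by (rule inc[OF box_swap_ends[OF turn'']])
qed

section \<open>Coordinates along three freely named axes\<close>

definition axis_point :: "3 \<Rightarrow> 3 \<Rightarrow> real \<Rightarrow> real \<Rightarrow> real \<Rightarrow> point" where
  "axis_point i j a b d = (\<chi> x. if x = i then a else if x = j then b else d)"

lemma axes_exhaust:
  fixes i j k :: 3
  assumes "distinct [i, j, k]"
  shows "x = i \<or> x = j \<or> x = k"
proof -
  have "card {i, j, k} = card (UNIV :: 3 set)"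
    using assms by simp
  then have "{i, j, k} = UNIV"
    by (intro card_subset_eq) auto
  then show ?thesis
    by blast
qed

lemma all_axes_iff:
  fixes i j k :: 3
  assumes "distinct [i, j, k]"
  shows "(\<forall>x. P x) \<longleftrightarrow> P i \<and> P j \<and> P k"
  using axes_exhaust[OF assms] by metis

lemma ex_axes_iff:
  fixes i j k :: 3
  assumes "distinct [i, j, k]"
  shows "(\<exists>x. P x) \<longleftrightarrow> P i \<or> P j \<or> P k"
  using axes_exhaust[OF assms] by metis

lemma ex1_axes_iff:
  fixes i j k :: 3
  assumes "distinct [i, j, k]"
  shows "(\<exists>!x. P x) \<longleftrightarrow> P i \<and> \<not> P j \<and> \<not> P k \<or> \<not> P i \<and> P j \<and> \<not> P k \<or> \<not> P i \<and> \<not> P j \<and> P k"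
  unfolding Ex1_def ex_axes_iff[OF assms] all_axes_iff[OF assms] using assms by auto

lemma axis_point_nth [simp]:
  "axis_point i j a b d $ i = a" "i \<noteq> j \<Longrightarrow> axis_point i j a b d $ j = b"
  "i \<noteq> k \<Longrightarrow> j \<noteq> k \<Longrightarrow> axis_point i j a b d $ k = d"
  by (auto simp: axis_point_def)

lemma axis_point_eq_iff:
  assumes "distinct [i, j, k]"
  shows "axis_point i j a b d = axis_point i j a' b' d' \<longleftrightarrow> a = a' \<and> b = b' \<and> d = d'"
  unfolding vec_eq_iff all_axes_iff[OF assms] using assms by simp

lemma axis_point_eqI:
  assumes "distinct [i, j, k]" "v $ i = a" "v $ j = b" "v $ k = d"
  shows "v = axis_point i j a b d"
  using assms(2-) unfolding vec_eq_iff all_axes_iff[OF assms(1)] using assms(1) by simp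

text \<open>The coordinate ranges are given as equations of two-element sets, which leave open which
  value is the lower end. Hence both directions of the edge and all four quadrants around it are
  covered at once.\<close>

lemma nodes_axis_points:
  assumes ax: "distinct [i, j, k]"
    and "{lo C $ i, hi C $ i} = {a1, a2}" "{lo C $ j, hi C $ j} = {x, u}"
      "{lo C $ k, hi C $ k} = {y, v}"
  shows "nodes C = {axis_point i j a b d | a b d. a \<in> {a1, a2} \<and> b \<in> {x, u} \<and> d \<in> {y, v}}"
proof -
  have "w \<in> nodes C \<longleftrightarrow> w $ i \<in> {a1, a2} \<and> w $ j \<in> {x, u} \<and> w $ k \<in> {y, v}" for w
    unfolding nodes_def mem_Collect_eq all_axes_iff[OF ax] assms(2-4)[symmetric] by auto
  then show ?thesis
    using ax axis_point_eqI[OF ax] by fastforce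
qed

text \<open>The passage from coordinates to combinatorics: a face fixes one of the three
  coordinates, and an edge joins nodes that differ in exactly one.\<close>

lemma box_axis_points:
  assumes ax: "distinct [i, j, k]" and C: "is_cuboid C"
    and "{lo C $ i, hi C $ i} = {a1, a2}" "{lo C $ j, hi C $ j} = {x, u}"
      "{lo C $ k, hi C $ k} = {y, v}"
  defines "p \<equiv> axis_point i j"
  shows "box_at_edge C (p a1 x y) (p a2 x y) (p a1 u y) (p a2 u y) (p a1 x v) (p a2 x v)
    (p a1 u v) (p a2 u v)"
proof -
  have ne: "a1 \<noteq> a2" "x \<noteq> u" "y \<noteq> v"
    using C[unfolded is_cuboid_def, rule_format, of i] C[unfolded is_cuboid_def, rule_format, of j]
      C[unfolded is_cuboid_def, rule_format, of k] assms(3-5) by (auto simp: doubleton_eq_iff)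
  have eq: "p a b d = p a' b' d' \<longleftrightarrow> a = a' \<and> b = b' \<and> d = d'" for a b d a' b' d'
    unfolding p_def by (rule axis_point_eq_iff[OF ax])
  have nodes: "nodes C = {p a1 x y, p a2 x y, p a1 u y, p a2 u y, p a1 x v, p a2 x v,
    p a1 u v, p a2 u v}" (is "_ = ?N")
    unfolding nodes_axis_points[OF ax assms(3-5)] p_def by blast
  have nth: "p a b d $ i = a" "p a b d $ j = b" "p a b d $ k = d" for a b d
    using ax by (auto simp: p_def)
  have faces: "faces C = {{w \<in> ?N. w $ i = a1}, {w \<in> ?N. w $ i = a2}, {w \<in> ?N. w $ j = x},
     {w \<in> ?N. w $ j = u}, {w \<in> ?N. w $ k = y}, {w \<in> ?N. w $ k = v}}"
  proof -
    have "faces C = (\<lambda>t. {w \<in> nodes C. w $ i = t}) ` {lo C $ i, hi C $ i} \<union>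
        (\<lambda>t. {w \<in> nodes C. w $ j = t}) ` {lo C $ j, hi C $ j} \<union>
        (\<lambda>t. {w \<in> nodes C. w $ k = t}) ` {lo C $ k, hi C $ k}"
      unfolding faces_def mem_Collect_eq ex_axes_iff[OF ax] by blast
    then show ?thesis
      unfolding assms(3-5) nodes
      by (simp only: image_insert image_empty Un_insert_left Un_empty_left)
  qed
  have filt: "{w \<in> insert z Z. Q w} = (if Q z then insert z {w \<in> Z. Q w} else {w \<in> Z. Q w})"
    for z :: point and Z Q by auto
  have "faces C = {{p a1 x y, p a1 u y, p a1 x v, p a1 u v}, {p a2 x y, p a2 u y, p a2 x v, p a2 u v},
      {p a1 x y, p a2 x y, p a1 x v, p a2 x v}, {p a1 u y, p a2 u y, p a1 u v, p a2 u v},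
      {p a1 x y, p a2 x y, p a1 u y, p a2 u y}, {p a1 x v, p a2 x v, p a1 u v, p a2 u v}}"
    unfolding faces using ne ne[symmetric] by (simp only: filt nth if_True if_False simp_thms, simp)
  then have "faces C = {{p a1 x y, p a2 x y, p a1 u y, p a2 u y}, {p a1 x y, p a2 x y, p a1 x v, p a2 x v},
      {p a1 u v, p a2 u v, p a1 u y, p a2 u y}, {p a1 u v, p a2 u v, p a1 x v, p a2 x v},
      {p a1 x y, p a1 u y, p a1 x v, p a1 u v}, {p a2 x y, p a2 u y, p a2 x v, p a2 u v}}"
    by (simp only: insert_commute)
  moreover have "edges C = {{p a1 x y, p a2 x y}, {p a1 u y, p a2 u y}, {p a1 x v, p a2 x v},
      {p a1 u v, p a2 u v}, {p a1 x y, p a1 u y}, {p a2 x y, p a2 u y}, {p a1 x v, p a1 u v},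
      {p a2 x v, p a2 u v}, {p a1 x y, p a1 x v}, {p a2 x y, p a2 x v}, {p a1 u y, p a1 u v},
      {p a2 u y, p a2 u v}}" (is "_ = ?E")
  proof
    show "edges C \<subseteq> ?E"
    proof
      fix e assume "e \<in> edges C"
      then obtain w w' where e: "e = {w, w'}" and "w \<in> nodes C" "w' \<in> nodes C"
        and diff: "\<exists>!z. w $ z \<noteq> w' $ z"
        unfolding edges_def by blast
      then obtain a b d a' b' d' where w: "w = p a b d" "w' = p a' b' d'"
        and mem: "a \<in> {a1, a2}" "b \<in> {x, u}" "d \<in> {y, v}" "a' \<in> {a1, a2}" "b' \<in> {x, u}" "d' \<in> {y, v}"
        unfolding nodes_axis_points[OF ax assms(3-5)] p_def by blast
      from diff consider "a \<noteq> a'" "b = b'" "d = d'" | "a = a'" "b \<noteq> b'" "d = d'"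
        | "a = a'" "b = b'" "d \<noteq> d'"
        unfolding ex1_axes_iff[OF ax] w nth by blast
      then show "e \<in> ?E"
      proof cases
        case 1
        then have "e = {p a1 b d, p a2 b d}" using mem unfolding e w by auto
        moreover have "b = x \<or> b = u" "d = y \<or> d = v" using mem by auto
        ultimately show ?thesis by (elim disjE) simp_all
      next
        case 2
        then have "e = {p a x d, p a u d}" using mem unfolding e w by auto
        moreover have "a = a1 \<or> a = a2" "d = y \<or> d = v" using mem by auto
        ultimately show ?thesis by (elim disjE) simp_all
      next
        case 3
        then have "e = {p a b y, p a b v}" using mem unfolding e w by auto
        moreover have "a = a1 \<or> a = a2" "b = x \<or> b = u" using mem by auto
        ultimately show ?thesis by (elim disjE) simp_all
      qed
    qed
    have "{w, w'} \<in> edges C" if "w \<in> nodes C" "w' \<in> nodes C" "\<exists>!z. w $ z \<noteq> w' $ z" for w w'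
      unfolding edges_def using that by blast
    then show "?E \<subseteq> edges C"
      unfolding nodes ex1_axes_iff[OF ax] using ne by (simp add: nth)
  qed
  moreover have "distinct [p a1 x y, p a2 x y, p a1 u y, p a2 u y, p a1 x v, p a2 x v,
    p a1 u v, p a2 u v]" using ne by (simp add: eq)
  ultimately show ?thesis unfolding box_at_edge_def using nodes by blast
qed

section \<open>Iso-paths of a single graph through an edge\<close>

lemma box_faces_at_edge:
  assumes b: "box_at_edge C P1 P2 A1 A2 B1 B2 E1 E2"
    and "f \<in> faces C" "P1 \<in> f" "P2 \<in> f"
  shows "f = {P1, P2, A1, A2} \<or> f = {P1, P2, B1, B2}"
proof -
  note ne = box_neq[OF b] box_neq[OF b, symmetric]
  show ?thesis
    using assms(2-) unfolding boxD(4)[OF b] insert_iff empty_iff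
    by (elim disjE) (simp_all add: ne)
qed

lemma edges_iff_incident: "{u, v} \<in> edges C \<longleftrightarrow> v \<in> incident_nodes C u"
  by (simp add: incident_nodes_def)

lemma iso_point_at_continuous_end:
  assumes "lab G x0 = c"
  shows "iso_point c G x0 x1 = x0"
  using assms by (simp add: iso_point_def)

text \<open>In the direction of the edge the end points already have the two coordinate values that
  a node may have, so an iso-point that is a node has parameter \<open>s = 0\<close> or
  \<open>s = 1\<close>. The latter is impossible because \<open>x1\<close> lies strictly above
  \<open>c\<close>.\<close>

lemma iso_point_eq_node:
  assumes "is_cuboid (cub G)" "(x0, x1) \<in> mixed_edges c G" "iso_point c G x0 x1 \<in> gnodes G"
  shows "iso_point c G x0 x1 = x0" and "lab G x0 = c"
proof -
  from assms(2) have e: "{x0, x1} \<in> gedges G" and le: "lab G x0 \<le> c" "c < lab G x1"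
    by (auto simp: mixed_edges_def)
  from e obtain u v i where uv: "{x0, x1} = {u, v}" "u \<in> gnodes G" "v \<in> gnodes G" "u $ i \<noteq> v $ i"
    unfolding edges_def by blast
  define s where "s = (c - lab G x0) / (lab G x1 - lab G x0)"
  have s: "s < 1" using le by (simp add: s_def)
  have x: "x0 \<in> gnodes G" "x1 \<in> gnodes G" "x0 $ i \<noteq> x1 $ i"
    using uv by (auto simp: doubleton_eq_iff)
  have p: "iso_point c G x0 x1 $ i = x0 $ i + s * (x1 $ i - x0 $ i)"
    by (simp add: iso_point_def s_def)
  have "iso_point c G x0 x1 $ i \<in> {lo (cub G) $ i, hi (cub G) $ i}"
    using assms(3) by (auto simp: nodes_def)
  moreover have "{lo (cub G) $ i, hi (cub G) $ i} = {x0 $ i, x1 $ i}"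
    using x(1,2)[unfolded nodes_def mem_Collect_eq, THEN spec, of i] x(3) by auto
  ultimately have "s * (x1 $ i - x0 $ i) = 0 \<or> (s - 1) * (x1 $ i - x0 $ i) = 0"
    unfolding p by (auto simp: algebra_simps)
  with x s have "s = 0" by auto
  then show "lab G x0 = c" using le by (simp add: s_def)
  then show "iso_point c G x0 x1 = x0" by (rule iso_point_at_continuous_end)
qed

text \<open>The faces along which iso-paths of a regular graph pass through the edge \<open>P1P2\<close>.\<close>

definition carries_iso_edge :: "real \<Rightarrow> lcgraph \<Rightarrow> point \<Rightarrow> point \<Rightarrow> point set \<Rightarrow> bool" where
  "carries_iso_edge c G P1 P2 f \<longleftrightarrow> f \<in> gfaces G \<and> P1 \<in> f \<and> P2 \<in> f \<and> lab G P1 = c \<and>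
     lab G P2 = c \<and> f - {P1, P2} \<subseteq> disperse_nodes c G"

lemma carries_iso_edge_iff:
  assumes b: "box_at_edge (cub G) P1 P2 A1 A2 B1 B2 E1 E2"
  shows "carries_iso_edge c G P1 P2 {P1, P2, A1, A2} \<longleftrightarrow>
    lab G P1 = c \<and> lab G P2 = c \<and> c < lab G A1 \<and> c < lab G A2"
proof -
  have "{P1, P2, A1, A2} \<in> gfaces G" unfolding boxD(4)[OF b] by simp
  moreover have "{P1, P2, A1, A2} - {P1, P2} = {A1, A2}" using boxD(1)[OF b] by auto
  moreover have "A1 \<in> gnodes G" "A2 \<in> gnodes G" unfolding boxD(2)[OF b] by simp_all
  ultimately show ?thesis
    unfolding carries_iso_edge_def disperse_nodes_def by simp
qed

lemma carries_iso_edge_cases: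
  assumes b: "box_at_edge (cub G) P1 P2 A1 A2 B1 B2 E1 E2" and "carries_iso_edge c G P1 P2 f"
  obtains A1' A2' B1' B2' where "box_at_edge (cub G) P1 P2 A1' A2' B1' B2' E1 E2"
    "f = {P1, P2, A1', A2'}"
proof -
  have "f = {P1, P2, A1, A2} \<or> f = {P1, P2, B1, B2}"
    by (rule box_faces_at_edge[OF b]) (use assms(2) in \<open>simp_all add: carries_iso_edge_def\<close>)
  then show ?thesis using that b box_swap_sides[OF b] by blast
qed

text \<open>A general \<open>H\<close> covers both the C-rules (all nodes) and the polygons of the
  S-rules. An end of the edge is an iso-point only if it has label \<open>c\<close> and a disperse
  neighbor within \<open>f\<close>; the other end has label \<open>c\<close> too, so this neighbor
  is the node next to it off the edge.\<close>

lemma face_iso_points_edge_iff: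
  assumes b: "box_at_edge (cub G) P1 P2 A1 A2 B1 B2 E1 E2" and C: "is_cuboid (cub G)"
    and f: "f \<in> gfaces G"
  shows "face_iso_points c G H f = {P1, P2} \<longleftrightarrow> carries_iso_edge c G P1 P2 f \<and> f \<subseteq> H"
proof
  assume eq: "face_iso_points c G H f = {P1, P2}"
  have *: "\<exists>x. lab G P = c \<and> x \<in> nbrs G P \<and> c < lab G x \<and> P \<in> H \<inter> f \<and> x \<in> H \<inter> f"
    if "P \<in> {P1, P2}" for P
  proof -
    from that eq have "P \<in> face_iso_points c G H f" by blast
    then obtain x0 x1 where m: "(x0, x1) \<in> mixed_edges c G" "{x0, x1} \<subseteq> H \<inter> f"
      and P: "P = iso_point c G x0 x1" unfolding face_iso_points_def by blast
    have "P \<in> gnodes G" using that unfolding boxD(2)[OF b] by blast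
    with iso_point_eq_node[OF C m(1)] P have "P = x0" "lab G x0 = c" by auto
    with m show ?thesis unfolding mixed_edges_def edges_iff_incident by auto
  qed
  from *[of P1] *[of P2] obtain x y where x: "lab G P1 = c" "x \<in> nbrs G P1" "c < lab G x"
    "P1 \<in> H \<inter> f" "x \<in> H \<inter> f" and y: "lab G P2 = c" "y \<in> nbrs G P2" "c < lab G y"
    "P2 \<in> H \<inter> f" "y \<in> H \<inter> f" by blast
  have "f = {P1, P2, A1, A2} \<or> f = {P1, P2, B1, B2}"
    using box_faces_at_edge[OF b f] x(4) y(4) by simp
  then obtain A1' A2' B1' B2' where b': "box_at_edge (cub G) P1 P2 A1' A2' B1' B2' E1 E2"
    and f': "f = {P1, P2, A1', A2'}" using b box_swap_sides[OF b] by blast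
  have "x = A1'" "y = A2'"
    using x y boxD(1)[OF b'] unfolding box_incident_nodes[OF b'] f' by auto
  with x y show "carries_iso_edge c G P1 P2 f \<and> f \<subseteq> H"
    unfolding f' carries_iso_edge_iff[OF b'] by auto
next
  assume car: "carries_iso_edge c G P1 P2 f \<and> f \<subseteq> H"
  then obtain A1' A2' B1' B2' where b': "box_at_edge (cub G) P1 P2 A1' A2' B1' B2' E1 E2"
    and f': "f = {P1, P2, A1', A2'}" using carries_iso_edge_cases[OF b] by blast
  have l: "lab G P1 = c" "lab G P2 = c" "c < lab G A1'" "c < lab G A2'"
    using car unfolding f' carries_iso_edge_iff[OF b'] by blast+
  have "(x0, x1) \<in> mixed_edges c G \<and> {x0, x1} \<subseteq> H \<inter> f \<longleftrightarrow> (x0, x1) \<in> {(P1, A1'), (P2, A2')}" for x0 x1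
  proof
    assume "(x0, x1) \<in> mixed_edges c G \<and> {x0, x1} \<subseteq> H \<inter> f"
    then have "x0 \<in> {P1, P2}" "x1 \<in> {A1', A2'}" "x1 \<in> nbrs G x0"
      using l unfolding f' mixed_edges_def edges_iff_incident by auto
    then show "(x0, x1) \<in> {(P1, A1'), (P2, A2')}"
      using boxD(1)[OF b'] by (auto simp: box_incident_nodes[OF b'])
  next
    assume "(x0, x1) \<in> {(P1, A1'), (P2, A2')}"
    then show "(x0, x1) \<in> mixed_edges c G \<and> {x0, x1} \<subseteq> H \<inter> f"
      using l car unfolding f' mixed_edges_def edges_iff_incident
      by (auto simp: box_incident_nodes[OF b'])
  qed
  then have "face_iso_points c G H f = {iso_point c G x0 x1 | x0 x1. (x0, x1) \<in> {(P1, A1'), (P2, A2')}}"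
    unfolding face_iso_points_def by simp
  also have "\<dots> = {iso_point c G P1 A1', iso_point c G P2 A2'}" by auto
  finally show "face_iso_points c G H f = {P1, P2}"
    using l by (simp add: iso_point_at_continuous_end)
qed

text \<open>With two disperse and two continuous nodes only an L-face has to be excluded, and the
  two disperse nodes are incident.\<close>

lemma carries_iso_edge_regular:
  assumes b: "box_at_edge (cub G) P1 P2 A1 A2 B1 B2 E1 E2" and car: "carries_iso_edge c G P1 P2 f"
  shows "regular_face c G f"
proof -
  from carries_iso_edge_cases[OF b car] obtain A1' A2' B1' B2'
    where b': "box_at_edge (cub G) P1 P2 A1' A2' B1' B2' E1 E2"
    and f': "f = {P1, P2, A1', A2'}" by blast
  have l: "lab G P1 = c" "lab G P2 = c" "c < lab G A1'" "c < lab G A2'"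
    using car unfolding f' carries_iso_edge_iff[OF b'] by blast+
  have n: "P1 \<in> gnodes G" "P2 \<in> gnodes G" "A1' \<in> gnodes G" "A2' \<in> gnodes G" "A1' \<noteq> A2'"
    using boxD(1)[OF b'] unfolding boxD(2)[OF b'] by simp_all
  have "f \<inter> disperse_nodes c G = {A1', A2'}"
    using l n unfolding f' disperse_nodes_def by auto
  moreover have "{A1', A2'} \<in> gedges G" unfolding boxD(3)[OF b'] by simp
  moreover have "f \<in> gfaces G" using car by (simp add: carries_iso_edge_def)
  moreover have "P1 \<in> f" "P1 \<notin> disperse_nodes c G" "A1' \<in> f" "A1' \<notin> continuous_nodes c G"
    using l unfolding f' by (simp_all add: disperse_nodes_def continuous_nodes_def)
  ultimately show ?thesis
    using n(5) by (auto simp: regular_face_def L_faces_def singular_face_def)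
qed

lemma C_path_passes_along_iff:
  assumes b: "box_at_edge (cub G) P1 P2 A1 A2 B1 B2 E1 E2" and C: "is_cuboid (cub G)"
  shows "passes_along P1 P2 (C_path c G) f \<longleftrightarrow> carries_iso_edge c G P1 P2 f"
proof -
  have "f \<subseteq> gnodes G" if "f \<in> gfaces G"
    using that by (auto simp: faces_def)
  then have "passes_along P1 P2 (C_path c G) f \<longleftrightarrow> regular_face c G f \<and> carries_iso_edge c G P1 P2 f"
    unfolding passes_along_def C_path_def using face_iso_points_edge_iff[OF b C, of f c "gnodes G"]
    by (auto simp: regular_face_def)
  then show ?thesis using carries_iso_edge_regular[OF b] by blast
qed

lemma S_polygon_passes_along_iff:
  assumes b: "box_at_edge (cub G) P1 P2 A1 A2 B1 B2 E1 E2" and C: "is_cuboid (cub G)"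
  shows "passes_along P1 P2 (S_polygon c G H) f \<longleftrightarrow> carries_iso_edge c G P1 P2 f \<and> f \<subseteq> H"
  unfolding passes_along_def S_polygon_def using face_iso_points_edge_iff[OF b C, of f c H]
  by (auto simp: carries_iso_edge_def)

section \<open>Effect of the S-rules on the faces that carry iso-paths\<close>

lemma lab_relabel [simp]: "lab (relabel A t G) v = (if v \<in> A then t else lab G v)"
  by (simp add: relabel_def)

lemma cub_relabel [simp]: "cub (relabel A t G) = cub G"
  by (simp add: relabel_def)

lemma cub_S_relabel [simp]: "cub (S_relabel c k G H) = cub G"
  by (cases k) simp_all

lemma carries_iso_edge_relabel_0:
  assumes "0 < c"
  shows "carries_iso_edge c (relabel A 0 G) P1 P2 f \<longleftrightarrow> carries_iso_edge c G P1 P2 f \<and> A \<inter> f = {}"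
proof -
  have R: "lab (relabel A 0 G) v = c \<longleftrightarrow> lab G v = c \<and> v \<notin> A"
    "v \<in> disperse_nodes c (relabel A 0 G) \<longleftrightarrow> v \<in> disperse_nodes c G \<and> v \<notin> A" for v
    using assms by (auto simp: disperse_nodes_def)
  show ?thesis
    unfolding carries_iso_edge_def R cub_relabel subset_iff by blast
qed

text \<open>The two disperse nodes of a carrying face are incident, and each is incident to an end
  of the edge. So the center of an S1-subgraph lies outside the face and its neighbors are not these
  two nodes; an S2-subgraph that relabels one of them contains the whole face; and the center of an
  S3-subgraph has only disperse neighbors, so it is not incident to \<open>P1\<close> or
  \<open>P2\<close>, and no carrying face is lost or created.\<close>

lemma carries_iso_edge_S_relabel_iff:
  assumes b: "box_at_edge (cub G) P1 P2 A1 A2 B1 B2 E1 E2"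
    and c: "0 < c" "c < 1" and S: "S_subgraph c k G H"
  shows "carries_iso_edge c (S_relabel c k G H) P1 P2 {P1, P2, A1, A2} \<longleftrightarrow>
    carries_iso_edge c G P1 P2 {P1, P2, A1, A2} \<and> \<not> {P1, P2, A1, A2} \<subseteq> H"
proof -
  have b': "box_at_edge (cub (S_relabel c k G H)) P1 P2 A1 A2 B1 B2 E1 E2" using b by simp
  note iff = carries_iso_edge_iff[OF b] carries_iso_edge_iff[OF b']
  note n = box_incident_nodes[OF b]
  have adj: "A2 \<in> nbrs G A1" "A1 \<in> nbrs G A2" "P1 \<in> nbrs G A1" "P2 \<in> nbrs G A2" "A1 \<noteq> A2"
    using box_neq[OF b] unfolding n by simp_all
  show ?thesis
  proof (cases k)
    case S1
    with S obtain P where P: "c < lab G P" "nbrs G P \<subseteq> continuous_nodes c G" "H = insert P (nbrs G P)"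
      "P \<in> gnodes G"
      by (auto simp: disperse_nodes_def)
    then have H: "H \<inter> disperse_nodes c G = {P}"
      by (auto simp: disperse_nodes_def continuous_nodes_def)
    have cont: "lab G v \<le> c" if "v \<in> nbrs G P" for v
      using that P(2) by (auto simp: continuous_nodes_def)
    have "P \<notin> {P1, P2, A1, A2} \<and> \<not> {A1, A2} \<subseteq> H" if "carries_iso_edge c G P1 P2 {P1, P2, A1, A2}"
    proof -
      have "P \<noteq> P1" "P \<noteq> P2" "A1 \<notin> nbrs G P" "A2 \<notin> nbrs G P"
        using that P(1) cont[of A1] cont[of A2] unfolding iff by auto
      then show ?thesis using adj P(3) by auto
    qed
    then show ?thesis
      unfolding S1 S_relabel.simps H carries_iso_edge_relabel_0[OF c(1)] by blast
  next
    case S2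
    with S obtain P Q where PQ: "c < lab G P" "c < lab G Q" "Q \<in> nbrs G P"
      "(nbrs G P \<union> nbrs G Q) - {P, Q} \<subseteq> continuous_nodes c G" "H = {P, Q} \<union> nbrs G P \<union> nbrs G Q"
      "P \<in> gnodes G" "Q \<in> gnodes G"
      by (auto simp: disperse_nodes_def edges_iff_incident)
    then have H: "H \<inter> disperse_nodes c G = {P, Q}"
      by (auto simp: disperse_nodes_def continuous_nodes_def)
    have cont: "lab G v \<le> c" if "v \<in> nbrs G P \<union> nbrs G Q" "v \<noteq> P" "v \<noteq> Q" for v
      using that PQ(4) by (auto simp: continuous_nodes_def)
    have "{P, Q} \<inter> {P1, P2, A1, A2} = {} \<longleftrightarrow> \<not> {P1, P2, A1, A2} \<subseteq> H"
      if "carries_iso_edge c G P1 P2 {P1, P2, A1, A2}"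
    proof -
      have l: "lab G P1 = c" "lab G P2 = c" "c < lab G A1" "c < lab G A2"
        using that unfolding iff by blast+
      then have P12: "P1 \<notin> {P, Q}" "P2 \<notin> {P, Q}" using PQ(1,2) by auto
      have A: "v \<in> H \<longleftrightarrow> v \<in> {P, Q}" if "v \<in> {A1, A2}" for v
      proof -
        have "c < lab G v" using l that by auto
        then have "v \<in> nbrs G P \<union> nbrs G Q \<Longrightarrow> v \<in> {P, Q}"
          using cont[of v] by fastforce
        then show ?thesis using PQ(5) by blast
      qed
      have nbr: "w \<in> H" if "v \<in> {P, Q}" "w \<in> nbrs G v" for v w
        using that PQ(5) by auto
      \<comment> \<open>As neighbors of each other they enter \<open>H\<close> together, and a
        disperse node of \<open>H\<close> is \<open>P\<close> or \<open>Q\<close>.\<close>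
      have "A1 \<in> {P, Q} \<longleftrightarrow> A2 \<in> {P, Q}"
        using A[of A1] A[of A2] nbr adj(1,2) by fast
      moreover have "P1 \<in> H \<and> P2 \<in> H" if "A1 \<in> {P, Q}" "A2 \<in> {P, Q}"
        using nbr[OF that(1) adj(3)] nbr[OF that(2) adj(4)] by fast
      moreover have "{P, Q} \<inter> {P1, P2, A1, A2} = {} \<longleftrightarrow> A1 \<notin> {P, Q} \<and> A2 \<notin> {P, Q}"
        using P12 by auto
      moreover have "A1 \<in> H \<longleftrightarrow> A1 \<in> {P, Q}" "A2 \<in> H \<longleftrightarrow> A2 \<in> {P, Q}"
        by (rule A, simp)+
      ultimately show ?thesis unfolding insert_subset using empty_subsetI[of H] by metis
    qed
    then show ?thesis
      unfolding S2 S_relabel.simps H carries_iso_edge_relabel_0[OF c(1)] by blast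
  next
    case S3
    with S obtain P where P: "lab G P < c" "nbrs G P \<subseteq> disperse_nodes c G" "H = insert P (nbrs G P)"
      "P \<in> gnodes G"
      by auto
    then have H: "H \<inter> continuous_nodes c G = {P}"
      by (auto simp: disperse_nodes_def continuous_nodes_def)
    have disp: "c < lab G v" if "v \<in> nbrs G P" for v
      using that P(2) by (auto simp: disperse_nodes_def)
    have "A1 \<noteq> P" if "lab G P1 = c" using disp[of P1] that adj by auto
    moreover have "A2 \<noteq> P" if "lab G P2 = c" using disp[of P2] that adj by auto
    moreover have "P1 \<notin> H" if "lab G P1 = c" using disp[of P1] that P by auto
    ultimately show ?thesis
      unfolding iff unfolding S3 S_relabel.simps H using P(1) c by (auto split: if_splits)
  qed
qed

lemma carries_iso_edge_S_relabel:
  assumes b: "box_at_edge (cub G) P1 P2 A1 A2 B1 B2 E1 E2"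
    and c: "0 < c" "c < 1" and S: "S_subgraph c k G H"
  shows "carries_iso_edge c (S_relabel c k G H) P1 P2 f \<longleftrightarrow>
    carries_iso_edge c G P1 P2 f \<and> \<not> f \<subseteq> H"
proof (cases "f = {P1, P2, A1, A2} \<or> f = {P1, P2, B1, B2}")
  case True
  then show ?thesis
    using carries_iso_edge_S_relabel_iff[OF b c S]
      carries_iso_edge_S_relabel_iff[OF box_swap_sides[OF b] c S] by blast
next
  case False
  then show ?thesis
    using box_faces_at_edge[OF b, of f] unfolding carries_iso_edge_def cub_S_relabel by metis
qed

text \<open>Induction over the applications treats all rows of \<open>S_table\<close> and the plain
  C-rules together. An application either hands \<open>f\<close> over to its polygon, if
  \<open>f\<close> lies in \<open>H\<close>, after which nothing else passes along \<open>f\<close>,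
  or leaves \<open>f\<close> to the remaining steps; the final \<open>C_path\<close> takes what is
  left.\<close>

lemma S_rule_passes_along:
  assumes "S_rule c k n G Ps G'" "0 < c" "c < 1"
    and "box_at_edge (cub G) P1 P2 A1 A2 B1 B2 E1 E2" "is_cuboid (cub G)"
  shows "cub G' = cub G"
    and "\<omega> \<in> insert (C_path c G') Ps \<Longrightarrow> passes_along P1 P2 \<omega> f \<Longrightarrow> carries_iso_edge c G P1 P2 f"
    and "carries_iso_edge c G P1 P2 f \<Longrightarrow>
      \<exists>!\<omega>. \<omega> \<in> insert (C_path c G') Ps \<and> passes_along P1 P2 \<omega> f"
proof -
  have "cub G' = cub G \<and>
    (\<forall>\<omega> \<in> insert (C_path c G') Ps. passes_along P1 P2 \<omega> f \<longrightarrow> carries_iso_edge c G P1 P2 f) \<and>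
    (carries_iso_edge c G P1 P2 f \<longrightarrow>
      (\<exists>!\<omega>. \<omega> \<in> insert (C_path c G') Ps \<and> passes_along P1 P2 \<omega> f))" for f
    using assms
  proof (induction rule: S_rule.induct)
    case (zero G)
    then show ?case using C_path_passes_along_iff[OF zero(3,4)] by auto
  next
    case (step G H n Ps G')
    note b = \<open>box_at_edge (cub G) P1 P2 A1 A2 B1 B2 E1 E2\<close>
    note iff = carries_iso_edge_S_relabel[OF b step.prems(1,2) step.hyps(1), of f]
    note poly = S_polygon_passes_along_iff[OF b step.prems(4), of c H f]
    from step have IH: "cub G' = cub G"
      "\<forall>\<omega> \<in> insert (C_path c G') Ps. passes_along P1 P2 \<omega> f \<longrightarrow>
         carries_iso_edge c (S_relabel c k G H) P1 P2 f"
      "carries_iso_edge c (S_relabel c k G H) P1 P2 f \<longrightarrow>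
      (\<exists>!\<omega>. \<omega> \<in> insert (C_path c G') Ps \<and> passes_along P1 P2 \<omega> f)" by simp_all
    let ?\<Omega> = "insert (C_path c G') Ps" and ?pass = "\<lambda>\<omega>. passes_along P1 P2 \<omega> f"
    have eq: "insert (C_path c G') (insert (S_polygon c G H) Ps) = insert (S_polygon c G H) ?\<Omega>"
      by (rule insert_commute)
    show ?case
    proof (cases "f \<subseteq> H")
      case True
      then have "\<not> ?pass \<omega>" if "\<omega> \<in> ?\<Omega>" for \<omega>
        using IH(2) iff that by blast
      then have *: "\<omega> \<in> insert (S_polygon c G H) ?\<Omega> \<and> ?pass \<omega> \<longleftrightarrow>
          \<omega> = S_polygon c G H \<and> carries_iso_edge c G P1 P2 f" for \<omega>
        using poly True by blast
      from * have "\<forall>\<omega> \<in> insert (S_polygon c G H) ?\<Omega>. ?pass \<omega> \<longrightarrow> carries_iso_edge c G P1 P2 f"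
        by blast
      with IH(1) show ?thesis unfolding eq * by simp
    next
      case False
      then have "\<omega> \<in> insert (S_polygon c G H) ?\<Omega> \<and> ?pass \<omega> \<longleftrightarrow> \<omega> \<in> ?\<Omega> \<and> ?pass \<omega>" for \<omega>
        using poly by blast
      moreover have "carries_iso_edge c (S_relabel c k G H) P1 P2 f \<longleftrightarrow> carries_iso_edge c G P1 P2 f"
        "\<not> ?pass (S_polygon c G H)"
        using iff poly False by simp_all
      ultimately show ?thesis using IH unfolding eq by simp
    qed
  qed
  note key = this[of f]
  show "cub G' = cub G" by (rule key[THEN conjunct1])
  show "\<omega> \<in> insert (C_path c G') Ps \<Longrightarrow> passes_along P1 P2 \<omega> f \<Longrightarrow> carries_iso_edge c G P1 P2 f"
    using key[THEN conjunct2, THEN conjunct1] by blast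
  show "carries_iso_edge c G P1 P2 f \<Longrightarrow>
      \<exists>!\<omega>. \<omega> \<in> insert (C_path c G') Ps \<and> passes_along P1 P2 \<omega> f"
    using key[THEN conjunct2, THEN conjunct2] by (rule mp)
qed

text \<open>The disperse nodes are exactly the \<open>A\<close> and \<open>B\<close> nodes, and the
  only edges between them are \<open>A1A2\<close> and \<open>B1B2\<close>. Every disperse node thus
  has a disperse neighbor, which excludes S1; a node with label below \<open>c\<close> is
  \<open>E1\<close> or \<open>E2\<close>, which are incident to each other, and this excludes S3; an
  S2-subgraph is built on one of the two pairs.\<close>

lemma S_subgraph_two_carrying_faces:
  assumes b: "box_at_edge (cub G) P1 P2 A1 A2 B1 B2 E1 E2"
    and A: "carries_iso_edge c G P1 P2 {P1, P2, A1, A2}"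
    and B: "carries_iso_edge c G P1 P2 {P1, P2, B1, B2}"
    and E: "lab G E1 \<le> c" "lab G E2 \<le> c" and S: "S_subgraph c k G H"
  shows "({P1, P2, A1, A2} \<subseteq> H) \<noteq> ({P1, P2, B1, B2} \<subseteq> H)"
proof -
  note ne = box_neq[OF b] box_neq[OF b, symmetric]
  note n = box_incident_nodes[OF b]
  have l: "lab G P1 = c" "lab G P2 = c" "c < lab G A1" "c < lab G A2" "c < lab G B1" "c < lab G B2"
    using A B unfolding carries_iso_edge_iff[OF b] carries_iso_edge_iff[OF box_swap_sides[OF b]]
    by blast+
  have disp: "v \<in> disperse_nodes c G \<longleftrightarrow> v \<in> {A1, A2, B1, B2}" for v
    using l E unfolding disperse_nodes_def boxD(2)[OF b] by auto
  have cont: "v \<in> continuous_nodes c G \<longleftrightarrow> v \<in> {P1, P2, E1, E2}" for v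
    using l E unfolding continuous_nodes_def boxD(2)[OF b] by auto
  show ?thesis
  proof (cases k)
    case S1
    with S obtain P where "P \<in> {A1, A2, B1, B2}" "nbrs G P \<subseteq> {P1, P2, E1, E2}"
      by (auto simp: disp cont subset_iff)
    then show ?thesis by (auto simp: n ne)
  next
    case S2
    with S obtain P Q where PQ: "P \<in> {A1, A2, B1, B2}" "Q \<in> {A1, A2, B1, B2}" "Q \<in> nbrs G P"
      "H = {P, Q} \<union> nbrs G P \<union> nbrs G Q"
      by (auto simp: disp edges_iff_incident)
    then have "P = A1 \<and> Q = A2 \<or> P = A2 \<and> Q = A1 \<or> P = B1 \<and> Q = B2 \<or> P = B2 \<and> Q = B1"
      by (auto simp: n ne)
    then show ?thesis
      unfolding PQ(4) by (elim disjE) (simp_all add: n ne)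
  next
    case S3
    with S obtain P where "P \<in> gnodes G" "lab G P < c" "nbrs G P \<subseteq> {A1, A2, B1, B2}"
      by (auto simp: disp subset_iff)
    then show ?thesis using l unfolding boxD(2)[OF b] by (auto simp: n ne)
  qed
qed

text \<open>Otherwise \<open>P1\<close>, \<open>P2\<close>, their four further neighbors and
  \<open>E1\<close> would form a T2-subgraph.\<close>

lemma singular_free_opposite_continuous:
  assumes b: "box_at_edge (cub G) P1 P2 A1 A2 B1 B2 E1 E2"
    and A: "carries_iso_edge c G P1 P2 {P1, P2, A1, A2}"
    and B: "carries_iso_edge c G P1 P2 {P1, P2, B1, B2}"
    and free: "singular_free c G"
  shows "lab G E1 \<le> c"
proof (rule ccontr)
  assume E: "\<not> lab G E1 \<le> c"
  note ne = box_neq[OF b] box_neq[OF b, symmetric]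
  have l: "lab G P1 = c" "lab G P2 = c" "c < lab G A1" "c < lab G A2" "c < lab G B1" "c < lab G B2"
    using A B unfolding carries_iso_edge_iff[OF b] carries_iso_edge_iff[OF box_swap_sides[OF b]]
    by blast+
  have "{P1, P2} \<in> gedges G" unfolding boxD(3)[OF b] by simp
  moreover have "card {P1, P2, A1, A2, B1, B2, E1} = 7" by (simp add: ne)
  moreover have "{P1, P2, A1, A2, B1, B2, E1} - {P1, P2} \<subseteq> disperse_nodes c G"
    using l E unfolding disperse_nodes_def boxD(2)[OF b] by (auto simp: ne)
  ultimately have "T2_subgraph c G {P1, P2, A1, A2, B1, B2, E1} P1 P2"
    using l unfolding T2_subgraph_def boxD(2)[OF b] box_incident_nodes[OF b] by auto
  with free show False unfolding singular_free_def by blast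
qed

text \<open>The end face at \<open>P1\<close> is an L-face, its disperse nodes \<open>A1\<close> and
  \<open>B1\<close> being diagonally opposite.\<close>

lemma L_face_of_two_carrying_faces:
  assumes b: "box_at_edge (cub G) P1 P2 A1 A2 B1 B2 E1 E2"
    and A: "carries_iso_edge c G P1 P2 {P1, P2, A1, A2}"
    and B: "carries_iso_edge c G P1 P2 {P1, P2, B1, B2}"
    and E: "lab G E1 \<le> c"
  shows "L_faces c G \<noteq> {}"
proof -
  note ne = box_neq[OF b] box_neq[OF b, symmetric]
  have l: "lab G P1 = c" "lab G P2 = c" "c < lab G A1" "c < lab G A2" "c < lab G B1" "c < lab G B2"
    using A B unfolding carries_iso_edge_iff[OF b] carries_iso_edge_iff[OF box_swap_sides[OF b]]
    by blast+
  let ?f = "{P1, A1, B1, E1}"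
  have "?f \<inter> disperse_nodes c G = {A1, B1}" "?f \<inter> continuous_nodes c G = {P1, E1}"
    using l E unfolding disperse_nodes_def continuous_nodes_def boxD(2)[OF b] by auto
  moreover have "{A1, B1} \<notin> gedges G"
    unfolding edges_iff_incident box_incident_nodes[OF b] by (simp add: ne)
  moreover have "?f \<in> gfaces G" unfolding boxD(4)[OF b] by simp
  ultimately have "?f \<in> L_faces c G" by (simp add: L_faces_def ne)
  then show ?thesis by blast
qed

text \<open>The plain C-rules are read as zero applications of an S-rule, which gives all branches
  for regular graphs one form. Every row of \<open>S_table\<close> prescribes at least one
  application, whence \<open>0 < n\<close> in the presence of L-faces.\<close>

lemma inner_iso_paths_imp_S_then_C:
  assumes "inner_iso_paths c M G Q" "Q \<noteq> {} \<or> regular_graph c M G"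
  obtains k n Ps G' where "S_rule c k n G Ps G'" "Q = insert (C_path c G') Ps"
    "L_faces c G \<noteq> {} \<Longrightarrow> 0 < n"
proof -
  have reg: "regular_graph c M G"
  proof (rule ccontr)
    assume "\<not> regular_graph c M G"
    with assms show False by (simp add: inner_iso_paths_def)
  qed
  show ?thesis
  proof (cases "L_faces c G \<noteq> {}")
    case True
    with reg assms(1) obtain k n where "S_table c G k n" "S_then_C c k n G Q"
      by (auto simp: inner_iso_paths_def)
    moreover from this(1) have "0 < n" by (auto simp: S_table_def Let_def)
    ultimately show ?thesis using that by (auto simp: S_then_C_def)
  next
    case False
    with reg assms(1) have "(\<exists>k n. S_then_C c k n G Q) \<or> Q = {C_path c G}"
      by (auto simp: inner_iso_paths_def split: if_splits)
    then show ?thesis using that False S_rule.zero by (fastforce simp: S_then_C_def)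
  qed
qed

context
  fixes c :: real and M G Q P1 P2 A1 A2 B1 B2 E1 E2
  assumes c: "0 < c" "c < 1"
    and b: "box_at_edge (cub G) P1 P2 A1 A2 B1 B2 E1 E2" and C: "is_cuboid (cub G)"
    and free: "singular_free c G" "isolated_free c M G"
    and inner: "inner_iso_paths c M G Q"
begin

lemma inner_iso_path_passes_along_imp_carries:
  assumes "\<omega> \<in> Q" "passes_along P1 P2 \<omega> f"
  shows "carries_iso_edge c G P1 P2 f"
proof -
  from assms(1) have "Q \<noteq> {} \<or> regular_graph c M G" by blast
  from inner_iso_paths_imp_S_then_C[OF inner this] obtain k n Ps G'
    where S: "S_rule c k n G Ps G'" and Q: "Q = insert (C_path c G') Ps" by metis
  show ?thesis using S_rule_passes_along(2)[OF S c b C] assms unfolding Q .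
qed

lemma carries_imp_unique_inner_iso_path:
  assumes car: "carries_iso_edge c G P1 P2 f"
  shows "\<exists>!\<omega>. \<omega> \<in> Q \<and> passes_along P1 P2 \<omega> f"
proof -
  have "regular_graph c M G"
  proof -
    from carries_iso_edge_cases[OF b car] obtain A1' A2' B1' B2'
      where b': "box_at_edge (cub G) P1 P2 A1' A2' B1' B2' E1 E2"
      and f': "f = {P1, P2, A1', A2'}" by blast
    have l: "lab G P1 = c" "c < lab G A1'"
      using car unfolding f' carries_iso_edge_iff[OF b'] by blast+
    have "P1 \<in> gnodes G" "A1' \<in> gnodes G" unfolding boxD(2)[OF b'] by simp_all
    with l free show ?thesis
      unfolding regular_graph_def disperse_nodes_def continuous_nodes_def by auto
  qed
  then have "Q \<noteq> {} \<or> regular_graph c M G" by blast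
  from inner_iso_paths_imp_S_then_C[OF inner this] obtain k n Ps G'
    where S: "S_rule c k n G Ps G'" and Q: "Q = insert (C_path c G') Ps" by metis
  show ?thesis unfolding Q by (rule S_rule_passes_along(3)[OF S c b C car])
qed

text \<open>If both faces at the edge carry an iso-path, the graph has \<open>L\<close>-faces, and the S-rule
  that is then mandatory cuts off exactly one of the two sides.\<close>

lemma inner_iso_path_passes_along_unique:
  assumes "\<omega> \<in> Q" "passes_along P1 P2 \<omega> f" "passes_along P1 P2 \<omega> f'"
  shows "f = f'"
proof (rule ccontr)
  assume "f \<noteq> f'"
  have car: "carries_iso_edge c G P1 P2 f" "carries_iso_edge c G P1 P2 f'"
    using inner_iso_path_passes_along_imp_carries assms by blast+
  then have "f = {P1, P2, A1, A2} \<or> f = {P1, P2, B1, B2}"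
    "f' = {P1, P2, A1, A2} \<or> f' = {P1, P2, B1, B2}"
    using box_faces_at_edge[OF b] unfolding carries_iso_edge_def by metis+
  with \<open>f \<noteq> f'\<close> have ff': "f = {P1, P2, A1, A2} \<and> f' = {P1, P2, B1, B2} \<or>
    f = {P1, P2, B1, B2} \<and> f' = {P1, P2, A1, A2}" by metis
  with car have A: "carries_iso_edge c G P1 P2 {P1, P2, A1, A2}"
    and B: "carries_iso_edge c G P1 P2 {P1, P2, B1, B2}" by metis+
  \<comment> \<open>Exchanging the ends of the edge turns \<open>E1\<close> into
    \<open>E2\<close>.\<close>
  from A B have A': "carries_iso_edge c G P2 P1 {P2, P1, A2, A1}"
    and B': "carries_iso_edge c G P2 P1 {P2, P1, B2, B1}"
    by (simp_all add: carries_iso_edge_def insert_commute)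
  have E: "lab G E1 \<le> c" "lab G E2 \<le> c"
    using singular_free_opposite_continuous[OF b A B free(1)]
      singular_free_opposite_continuous[OF box_swap_ends[OF b] A' B' free(1)] by blast+
  from assms(1) have "Q \<noteq> {} \<or> regular_graph c M G" by blast
  from inner_iso_paths_imp_S_then_C[OF inner this] L_face_of_two_carrying_faces[OF b A B E(1)]
  obtain k n Ps G' where S: "S_rule c k n G Ps G'" and Q: "Q = insert (C_path c G') Ps" and "0 < n"
    by metis
  \<comment> \<open>The first application separates the two sides: its polygon passes only along the
    face inside \<open>H\<close>, and what is recorded afterwards can pass only along the other
    face.\<close>
  from S \<open>0 < n\<close> obtain H n' Ps' where H: "S_subgraph c k G H"
    and S': "S_rule c k n' (S_relabel c k G H) Ps' G'" and Ps: "Ps = insert (S_polygon c G H) Ps'"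
    by cases auto
  have b': "box_at_edge (cub (S_relabel c k G H)) P1 P2 A1 A2 B1 B2 E1 E2"
    and C': "is_cuboid (cub (S_relabel c k G H))" using b C by simp_all
  note two = S_subgraph_two_carrying_faces[OF b A B E H]
  have "\<not> (f \<subseteq> H \<and> f' \<subseteq> H)" "f \<subseteq> H \<or> f' \<subseteq> H"
    using two ff' by metis+
  then show False
    using assms Q Ps S_rule_passes_along(2)[OF S' c b' C', of \<omega>]
      carries_iso_edge_S_relabel[OF b c H] S_polygon_passes_along_iff[OF b C, of c H] by blast
qed

end

lemma outer_iso_path_not_passes_through:
  assumes "outer_iso_paths c M G Q" "\<omega> \<in> Q" "{P1, P2} \<in> gedges G"
  shows "\<not> passes_through P1 P2 \<omega>"
  using assms unfolding outer_iso_paths_def passes_through_def passes_along_def by fastforce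

section \<open>The removal step at an edge\<close>

lemma face_neighbors_commute: "face_neighbors C C' \<longleftrightarrow> face_neighbors C' C"
  by (simp add: face_neighbors_def Int_commute)

lemma incident_nodes_sym: "u \<in> incident_nodes C v \<longleftrightarrow> v \<in> incident_nodes C u"
  by (simp add: incident_nodes_def insert_commute)

lemma incident_nodes_subset: "incident_nodes C v \<subseteq> nodes C"
  by (auto simp: incident_nodes_def edges_def doubleton_eq_iff)

text \<open>For cuboids with one common labeling the condition behind \<open>F2_graph\<close> is
  symmetric in the two of them. So the partner of an F2-graph is an F2-graph too and is relabeled as
  well.\<close>

definition F2_pair :: "real \<Rightarrow> (point \<Rightarrow> real) \<Rightarrow> cuboid \<Rightarrow> cuboid \<Rightarrow> bool" where
  "F2_pair c F C C' \<longleftrightarrow> face_neighbors C C' \<and> (\<forall>P \<in> nodes C \<inter> nodes C'. F P = c) \<and>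
     (\<forall>P \<in> nodes C - nodes C'. c < F P) \<and> (\<forall>P \<in> nodes C' - nodes C. c < F P)"

lemma F2_pair_commute: "F2_pair c F C C' \<longleftrightarrow> F2_pair c F C' C"
  unfolding F2_pair_def by (subst face_neighbors_commute) blast

lemma F2_graph_iff_F2_pair:
  "F2_graph c ((\<lambda>j. \<lparr>cub = C j, lab = F\<rparr>) ` I) \<lparr>cub = C', lab = F\<rparr> \<longleftrightarrow>
     (\<exists>j \<in> I. F2_pair c F C' (C j))"
  by (simp add: F2_graph_def F2_pair_def)

lemma removal_cases:
  assumes "removal c M G G'"
  obtains (all) "F1_graph c G \<or> F2_graph c M G" "G' = relabel {P \<in> gnodes G. lab G P = c} 1 G"
  | (T1) "G' = relabel {P. T1_subgraph c G P} 1 G"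
  | (T2) H P Q where "T2_subgraph c (relabel {P. T1_subgraph c G P} 1 G) H P Q"
      "G' = relabel {P, Q} 1 (relabel {P. T1_subgraph c G P} 1 G)"
  using assms unfolding removal_def Let_def by (auto split: if_splits)

lemma T2_subgraph_pair_label:
  assumes "T2_subgraph c G H P Q" "v \<in> {P, Q}"
  shows "lab G v = c"
  using assms by (auto simp: T2_subgraph_def)

lemma lab_removal:
  assumes "removal c M G G'" "v \<in> gnodes G"
  shows "lab G' v = lab G v \<or> lab G v = c \<and> lab G' v = 1"
  using assms(1)
proof (cases rule: removal_cases)
  case (T2 H P Q)
  then show ?thesis
    using T2_subgraph_pair_label[OF T2(1), of v] by (auto simp: T1_subgraph_def split: if_splits)
qed (auto simp: T1_subgraph_def)

text \<open>Otherwise \<open>u\<close> had label \<open>c\<close> and was relabeled. It is no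
  T1-node because of its neighbor \<open>v\<close>; a removal in an F1- or F2-graph would have
  relabeled \<open>v\<close> as well; and if \<open>u\<close> belongs to a T2-pair, all its
  neighbors lie in \<open>H\<close>, so \<open>v\<close> would be the other node of the pair or
  disperse.\<close>

lemma removal_disperse_next_to_continuous:
  assumes rem: "removal c M G G'" and c: "c < 1"
    and v: "v \<in> gnodes G" "u \<in> nbrs G v" "lab G' v = c" "c < lab G' u"
  shows "c < lab G u"
proof (rule ccontr)
  assume "\<not> c < lab G u"
  have Gv: "lab G v = c" using lab_removal[OF rem v(1)] v(3) c by auto
  have u: "u \<in> gnodes G" using v(2) incident_nodes_subset by blast
  with lab_removal[OF rem u] \<open>\<not> c < lab G u\<close> v(4) have Gu: "lab G u = c" by auto
  have vu: "v \<in> nbrs G u" using v(2) by (subst incident_nodes_sym)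
  have "\<not> T1_subgraph c G u" using vu Gv by (auto simp: T1_subgraph_def disperse_nodes_def)
  from rem show False
  proof (cases rule: removal_cases)
    case all
    then show False using v Gv c by simp
  next
    case T1
    then show False using \<open>\<not> T1_subgraph c G u\<close> Gu v(4) by simp
  next
    case (T2 H P Q)
    then have uPQ: "u \<in> {P, Q}" using \<open>\<not> T1_subgraph c G u\<close> Gu v(4) by (auto split: if_splits)
    have vPQ: "v \<notin> {P, Q}" using T2(2) v(3) c by (auto split: if_splits)
    with T2 v(3) have "lab (relabel {P. T1_subgraph c G P} 1 G) v = c" by simp
    moreover have "v \<in> H - {P, Q}"
      using T2(1) vu uPQ vPQ unfolding T2_subgraph_def by auto
    ultimately show False
      using T2(1) unfolding T2_subgraph_def disperse_nodes_def by auto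
  qed
qed

lemma box_card_nodes:
  assumes b: "box_at_edge C P1 P2 A1 A2 B1 B2 E1 E2"
  shows "finite (nodes C)" "card (nodes C) = 8"
  unfolding boxD(2)[OF b] using box_neq[OF b] by simp_all

lemma D_eq_8_if_all_disperse:
  assumes b: "box_at_edge (cub G) P1 P2 A1 A2 B1 B2 E1 E2" and "\<And>v. v \<in> gnodes G \<Longrightarrow> c < lab G v"
  shows "D c G = 8"
proof -
  have "disperse_nodes c G = gnodes G" using assms(2) by (auto simp: disperse_nodes_def)
  then show ?thesis using box_card_nodes[OF b] by simp
qed

text \<open>The set \<open>W\<close> consists of all nodes with label \<open>c\<close>. Exactly two
  of the three neighbors of \<open>P1\<close> lie outside \<open>W\<close>, and \<open>P2\<close> is
  not one of them.\<close>

lemma F1_graph_opposite_disperse: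
  assumes b: "box_at_edge (cub G) P1 P2 A1 A2 B1 B2 E1 E2"
    and P: "lab G P1 = c" "lab G P2 = c" and A: "c < lab G A1" and "F1_graph c G"
  shows "c < lab G B1"
proof -
  from \<open>F1_graph c G\<close> obtain W where W: "W \<subseteq> gnodes G"
    "\<And>P. P \<in> W \<Longrightarrow> card (nbrs G P \<inter> (gnodes G - W)) = 2" "\<And>P. P \<in> W \<Longrightarrow> lab G P = c"
    "\<And>P. P \<in> gnodes G - W \<Longrightarrow> c < lab G P"
    unfolding F1_graph_def by blast
  have nodes: "P1 \<in> gnodes G" "P2 \<in> gnodes G" "A1 \<in> gnodes G" "B1 \<in> gnodes G"
    unfolding boxD(2)[OF b] by simp_all
  have mem: "v \<in> W \<longleftrightarrow> lab G v = c" if "v \<in> gnodes G" for v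
    using W(3)[of v] W(4)[of v] that by (cases "v \<in> W") auto
  have "P1 \<in> W" "P2 \<in> W" "A1 \<notin> W" using mem nodes P A by simp_all
  have "B1 \<notin> W"
  proof
    assume "B1 \<in> W"
    then have "nbrs G P1 \<inter> (gnodes G - W) \<subseteq> {A1}"
      using \<open>P2 \<in> W\<close> unfolding box_incident_nodes[OF b] by blast
    from card_mono[OF _ this] show False using W(2)[OF \<open>P1 \<in> W\<close>] by simp
  qed
  then show ?thesis using W(4) nodes by blast
qed

text \<open>Incident nodes of label \<open>c\<close> are no T1-nodes. So the edge loses a label
  either in an F1- or F2-graph, which becomes disperse altogether, or as the pair of a T2-subgraph,
  which contains \<open>B1\<close> and \<open>B2\<close> and whose seven nodes are disperse
  afterwards. An F2-graph is the exception in the second claim: there the face with the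
  \<open>B\<close> nodes is the common one, with label \<open>c\<close> throughout.\<close>

lemma removal_at_edge:
  assumes rem: "removal c M G G'" and c: "c < 1"
    and b: "box_at_edge (cub G) P1 P2 A1 A2 B1 B2 E1 E2"
    and P: "lab G P1 = c" "lab G P2 = c" and A: "c < lab G A1" "c < lab G A2"
    and K: "lab G' P1 \<noteq> c \<or> lab G' P2 \<noteq> c"
  shows "7 \<le> D c G'" and "c < lab G B1 \<and> c < lab G B2 \<or> F2_graph c M G"
proof -
  have nodes: "P1 \<in> gnodes G" "P2 \<in> gnodes G" "B1 \<in> gnodes G" "B2 \<in> gnodes G"
    unfolding boxD(2)[OF b] by simp_all
  have adj: "P2 \<in> nbrs G P1" "P1 \<in> nbrs G P2" "P1 \<in> nbrs G B1" "P2 \<in> nbrs G B2"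
      "B1 \<in> nbrs G P1" "B2 \<in> nbrs G P2"
    unfolding box_incident_nodes[OF b] by simp_all
  \<comment> \<open>Each of these nodes has a neighbor of label \<open>c\<close>. Hence the
    T1-relabeling leaves the edge and \<open>B1\<close>, \<open>B2\<close> untouched, and what a
    T2-subgraph of the relabeled graph says about them holds for \<open>G\<close>.\<close>
  have noT1: "\<not> T1_subgraph c G P1" "\<not> T1_subgraph c G P2" "\<not> T1_subgraph c G B1"
      "\<not> T1_subgraph c G B2"
    using adj P by (auto simp: T1_subgraph_def disperse_nodes_def)
  have "7 \<le> D c G' \<and> (c < lab G B1 \<and> c < lab G B2 \<or> F2_graph c M G)"
    using rem
  proof (cases rule: removal_cases)
    case all
    have "c < lab G' v" if "v \<in> gnodes G" for v
    proof -
      have "lab G v \<ge> c"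
        using all(1)
      proof
        assume "F1_graph c G"
        then obtain W where "\<forall>P \<in> W. lab G P = c" "\<forall>P \<in> gnodes G - W. c < lab G P"
          unfolding F1_graph_def by blast
        then show ?thesis using that by (metis DiffI less_imp_le order.refl)
      next
        assume "F2_graph c M G"
        then obtain G2 where "\<forall>P \<in> gnodes G \<inter> gnodes G2. lab G P = c \<and> lab G2 P = c"
          "\<forall>P \<in> gnodes G - gnodes G2. c < lab G P"
          unfolding F2_graph_def by blast
        then show ?thesis using that by (metis DiffI IntI less_imp_le order.refl)
      qed
      then show ?thesis using all(2) that c by auto
    qed
    moreover have "cub G' = cub G" using all by simp
    ultimately have "D c G' = 8" using D_eq_8_if_all_disperse[of G'] b by metis
    moreover have "c < lab G B1 \<and> c < lab G B2" if "F1_graph c G"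
      using F1_graph_opposite_disperse[OF b P A(1) that]
        F1_graph_opposite_disperse[OF box_swap_ends[OF b] P(2,1) A(2) that] by blast
    ultimately show ?thesis using all(1) by auto
  next
    case T1
    then show ?thesis using K P noT1 by simp
  next
    case (T2 H P Q)
    let ?G1 = "relabel {P. T1_subgraph c G P} 1 G"
    have G1: "lab ?G1 P1 = c" "lab ?G1 P2 = c" "lab ?G1 B1 = lab G B1" "lab ?G1 B2 = lab G B2"
      using P noT1 by simp_all
    have H: "H \<subseteq> gnodes G" "card H = 7" "nbrs G P \<subseteq> H" "nbrs G Q \<subseteq> H"
      "\<And>v. v \<in> H \<Longrightarrow> v \<notin> {P, Q} \<Longrightarrow> c < lab ?G1 v"
      using T2(1) unfolding T2_subgraph_def disperse_nodes_def by auto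
    have sub: "nbrs G v \<subseteq> H" if "v \<in> {P, Q}" for v using that H by blast
    have "lab G' v = (if v \<in> {P, Q} then 1 else lab ?G1 v)" for v
      unfolding T2(2) by (rule lab_relabel)
    then have "P1 \<in> {P, Q} \<or> P2 \<in> {P, Q}" using K G1(1,2) by metis
    \<comment> \<open>All neighbors of a T2-pair lie in \<open>H\<close>, so a neighbor with label
      \<open>c\<close> must be the other node of the pair.\<close>
    moreover have "P2 \<in> {P, Q}" if "P1 \<in> {P, Q}"
      using H(5)[of P2] sub[OF that] adj G1 by auto
    moreover have "P1 \<in> {P, Q}" if "P2 \<in> {P, Q}"
      using H(5)[of P1] sub[OF that] adj G1 by auto
    ultimately have PQ: "P1 \<in> {P, Q}" "P2 \<in> {P, Q}" by blast+
    then have "{P, Q} = {P1, P2}" using box_neq(1)[OF b] by auto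
    then have "B1 \<notin> {P, Q}" "B2 \<notin> {P, Q}" using box_neq[OF b] by auto
    then have "c < lab G B1" "c < lab G B2"
      using H(5)[of B1] H(5)[of B2] sub[OF PQ(1)] sub[OF PQ(2)] adj G1 by auto
    moreover have "7 \<le> D c G'"
    proof -
      have "cub G' = cub G" using T2(2) by simp
      have "c < lab G' v" if "v \<in> H" for v
        using H(5)[OF that] c unfolding T2(2) by auto
      then have "H \<subseteq> disperse_nodes c G'"
        using H(1) \<open>cub G' = cub G\<close> unfolding disperse_nodes_def by auto
      moreover have "finite (disperse_nodes c G')"
        using box_card_nodes(1)[OF b] \<open>cub G' = cub G\<close> by (simp add: disperse_nodes_def)
      ultimately show ?thesis using card_mono H(2) by metis
    qed
    ultimately show ?thesis by blast
  qed
  then show "7 \<le> D c G'" and "c < lab G B1 \<and> c < lab G B2 \<or> F2_graph c M G" by blast+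
qed

lemma D_le_6_if_edge_continuous:
  assumes b: "box_at_edge (cub G) P1 P2 A1 A2 B1 B2 E1 E2" and "lab G P1 = c" "lab G P2 = c"
  shows "D c G \<le> 6"
proof -
  have "disperse_nodes c G \<subseteq> {A1, A2, B1, B2, E1, E2}"
    using assms(2,3) unfolding disperse_nodes_def boxD(2)[OF b] by auto
  then have "D c G \<le> card {A1, A2, B1, B2, E1, E2}" by (intro card_mono) simp_all
  also have "\<dots> = 6" using box_neq[OF b] by simp
  finally show ?thesis .
qed

section \<open>The cyclic order of the cuboids around an edge\<close>

text \<open>A cuboid seen from an edge in direction \<open>i\<close> with transversal coordinates \<open>(x, y)\<close>; the
  position of \<open>(u, v)\<close> relative to \<open>(x, y)\<close> is the quadrant that the cuboid occupies.\<close>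

definition occupies ::
    "cuboid \<Rightarrow> 3 \<Rightarrow> 3 \<Rightarrow> 3 \<Rightarrow> real \<Rightarrow> real \<Rightarrow> real \<Rightarrow> real \<Rightarrow> real \<Rightarrow> real \<Rightarrow> bool" where
  "occupies C i j k a1 a2 x y u v \<longleftrightarrow> distinct [i, j, k] \<and> is_cuboid C \<and>
     {lo C $ i, hi C $ i} = {a1, a2} \<and> {lo C $ j, hi C $ j} = {x, u} \<and> {lo C $ k, hi C $ k} = {y, v}"

lemma occupiesD:
  assumes "occupies C i j k a1 a2 x y u v"
  shows "distinct [i, j, k]" "is_cuboid C" "{lo C $ i, hi C $ i} = {a1, a2}"
    "{lo C $ j, hi C $ j} = {x, u}" "{lo C $ k, hi C $ k} = {y, v}"
proof -
  note o = assms[unfolded occupies_def]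
  show "distinct [i, j, k]" using o by (elim conjE)
  show "is_cuboid C" using o by (elim conjE)
  show "{lo C $ i, hi C $ i} = {a1, a2}" using o by (elim conjE)
  show "{lo C $ j, hi C $ j} = {x, u}" using o by (elim conjE)
  show "{lo C $ k, hi C $ k} = {y, v}" using o by (elim conjE)
qed

text \<open>Exchanges the two transversal axes, so that results on cuboids separated in coordinate
  \<open>j\<close> also serve for those separated in coordinate \<open>k\<close>.\<close>

lemma occupies_swap:
  "occupies C i j k a1 a2 x y u v \<Longrightarrow> occupies C i k j a1 a2 y x v u"
  by (auto simp: occupies_def)

lemma axis_point_swap:
  assumes "distinct [i, j, k]"
  shows "axis_point i k a d b = axis_point i j a b d"
  by (rule axis_point_eqI[OF assms]) (use assms in \<open>auto simp: axis_point_def\<close>)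

lemma occupies_box:
  assumes "occupies C i j k a1 a2 x y u v"
  defines "p \<equiv> axis_point i j"
  shows "box_at_edge C (p a1 x y) (p a2 x y) (p a1 u y) (p a2 u y) (p a1 x v) (p a2 x v)
    (p a1 u v) (p a2 u v)"
  unfolding p_def by (rule box_axis_points[OF occupiesD[OF assms(1)]])

lemma occupies_coordinates:
  assumes "occupies C i j k a1 a2 x y u v"
  shows "lo C $ i = min a1 a2" "hi C $ i = max a1 a2"
    "lo C $ j = min x u" "hi C $ j = max x u" "lo C $ k = min y v" "hi C $ k = max y v"
    "a1 \<noteq> a2" "x \<noteq> u" "y \<noteq> v" "distinct [i, j, k]"
proof -
  have *: "l = min a b \<and> h = max a b \<and> a \<noteq> b" if "l < h" "{l, h} = {a, b}" for l h a b :: real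
    using that by (auto simp: doubleton_eq_iff)
  have lt: "lo C $ z < hi C $ z" for z using assms by (simp add: occupies_def is_cuboid_def)
  show "distinct [i, j, k]" using assms by (simp add: occupies_def)
  have i: "lo C $ i = min a1 a2 \<and> hi C $ i = max a1 a2 \<and> a1 \<noteq> a2"
    and j: "lo C $ j = min x u \<and> hi C $ j = max x u \<and> x \<noteq> u"
    and k: "lo C $ k = min y v \<and> hi C $ k = max y v \<and> y \<noteq> v"
    by (rule *[OF lt], use assms in \<open>simp add: occupies_def\<close>)+
  then show "lo C $ i = min a1 a2" "hi C $ i = max a1 a2"
    "lo C $ j = min x u" "hi C $ j = max x u" "lo C $ k = min y v" "hi C $ k = max y v"
    "a1 \<noteq> a2" "x \<noteq> u" "y \<noteq> v" by simp_all
qed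

lemma in_cuboid_set_iff:
  assumes "occupies C i j k a1 a2 x y u v"
  shows "q \<in> cuboid_set C \<longleftrightarrow> min a1 a2 \<le> q $ i \<and> q $ i \<le> max a1 a2 \<and>
    min x u \<le> q $ j \<and> q $ j \<le> max x u \<and> min y v \<le> q $ k \<and> q $ k \<le> max y v"
  unfolding cuboid_set_def mem_box_cart all_axes_iff[OF occupies_coordinates(10)[OF assms]]
    occupies_coordinates(1-6)[OF assms] by blast

lemma face_in_coordinate_plane:
  assumes occ: "occupies C i j k a1 a2 x y u v" and f: "f \<in> faces C" and x: "\<forall>w \<in> f. w $ j = x"
  defines "p \<equiv> axis_point i j"
  shows "f = {p a1 x y, p a2 x y, p a1 x v, p a2 x v}"
proof -
  note ne = occupies_coordinates(8,10)[OF occ]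
  have "p a u d \<notin> f" for a d
    using x[rule_format, of "p a u d"] ne by (auto simp: p_def)
  then show ?thesis
    using f unfolding boxD(4)[OF occupies_box[OF occ], folded p_def] insert_iff by auto
qed

lemma closed_segment_nth:
  fixes P1 P2 :: point
  assumes "q \<in> closed_segment P1 P2" "P1 $ z = t" "P2 $ z = t"
  shows "q $ z = t"
proof -
  from assms(1) obtain s where "q = (1 - s) *\<^sub>R P1 + s *\<^sub>R P2"
    unfolding in_segment by blast
  then have "q $ z = (1 - s) * P1 $ z + s * P2 $ z" by simp
  then show ?thesis unfolding assms(2,3) by (simp add: algebra_simps)
qed

lemma convex_hull_nth:
  fixes f :: "point set"
  assumes "q \<in> convex hull f" "\<And>w. w \<in> f \<Longrightarrow> w $ z = t"
  shows "q $ z = t"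
proof -
  have "{q. axis z 1 \<bullet> q = t} = {q :: point. q $ z = t}"
    by (simp add: inner_axis')
  then have "convex {q :: point. q $ z = t}"
    by (metis convex_hyperplane)
  then have "convex hull f \<subseteq> {q. q $ z = t}"
    by (rule hull_minimal[rotated]) (use assms(2) in auto)
  with assms(1) show ?thesis by blast
qed

text \<open>Two intervals that extend from \<open>x\<close> to the same side overlap beyond
  \<open>x\<close>.\<close>

lemma common_interior_coordinate:
  fixes x u u' :: real
  assumes "x \<noteq> u" "x \<noteq> u'" "x < u \<longleftrightarrow> x < u'"
  obtains s where "min x u < s" "s < max x u" "min x u' < s" "s < max x u'"
proof -
  have "min (max x u) (max x u') > max (min x u) (min x u')"
    using assms by (auto simp: min_def max_def)
  then obtain s where "max (min x u) (min x u') < s" "s < min (max x u) (max x u')"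
    using dense by blast
  then show ?thesis using that by auto
qed

text \<open>A point interior to both cuboids lies in no boundary plane, whereas the hull of a face
  lies in one. The same point is off the edge, so the mesh condition would demand a common face: two
  cuboids of a system never share a quadrant.\<close>

lemma not_face_neighbors_same_quadrant:
  assumes occ: "occupies C i j k a1 a2 x y u v" and occ': "occupies C' i j k a1 a2 x y u' v'"
    and same: "x < u \<longleftrightarrow> x < u'" "y < v \<longleftrightarrow> y < v'"
  shows "\<not> face_neighbors C C'"
    and "P1 $ j = x \<Longrightarrow> P2 $ j = x \<Longrightarrow> \<not> cuboid_set C \<inter> cuboid_set C' \<subseteq> closed_segment P1 P2"
proof -
  note co = occupies_coordinates[OF occ] and co' = occupies_coordinates[OF occ']
  obtain r where r: "min a1 a2 < r" "r < max a1 a2"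
    using co(7) common_interior_coordinate[of a1 a2 a2] by blast
  obtain s where s: "min x u < s" "s < max x u" "min x u' < s" "s < max x u'"
    using common_interior_coordinate[OF co(8) co'(8) same(1)] .
  obtain t where t: "min y v < t" "t < max y v" "min y v' < t" "t < max y v'"
    using common_interior_coordinate[OF co(9) co'(9) same(2)] .
  define q where "q = axis_point i j r s t"
  have q: "q $ i = r" "q $ j = s" "q $ k = t" using co(10) by (auto simp: q_def)
  have mem: "q \<in> cuboid_set C \<inter> cuboid_set C'"
    unfolding Int_iff in_cuboid_set_iff[OF occ] in_cuboid_set_iff[OF occ'] q
    by (intro conjI less_imp_le r s t)
  show "\<not> cuboid_set C \<inter> cuboid_set C' \<subseteq> closed_segment P1 P2" if "P1 $ j = x" "P2 $ j = x"
    using closed_segment_nth[OF _ that, of q] mem q s by auto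
  show "\<not> face_neighbors C C'"
  proof
    assume "face_neighbors C C'"
    then obtain f where f: "f \<in> faces C" "q \<in> convex hull f"
      using mem unfolding face_neighbors_def by blast
    then obtain z b where z: "f = {w \<in> nodes C. w $ z = b}" "b = lo C $ z \<or> b = hi C $ z"
      unfolding faces_def by blast
    have "q $ z = b" by (rule convex_hull_nth[OF f(2)]) (simp add: z)
    moreover have "lo C $ z < q $ z \<and> q $ z < hi C $ z"
      using axes_exhaust[OF co(10), of z] by (elim disjE) (simp_all only: q co(1-6) r s t simp_thms)
    ultimately show False using z(2) by auto
  qed
qed

text \<open>Cuboids on different sides of the plane where coordinate \<open>j\<close> equals
  \<open>x\<close> meet only inside this plane.\<close>

lemma common_face_in_plane:
  assumes occ: "occupies C i j k a1 a2 x y u v" and occ': "occupies C' i j k a1 a2 x y u' v'"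
    and diff: "x < u \<longleftrightarrow> \<not> x < u'" and "face_neighbors C C'"
  obtains f where "f \<in> faces C" "f \<in> faces C'" "\<forall>w \<in> f. w $ j = x"
    "f \<subseteq> cuboid_set C \<inter> cuboid_set C'"
proof -
  from assms(4) obtain f where f: "f \<in> faces C" "f \<in> faces C'"
    "cuboid_set C \<inter> cuboid_set C' = convex hull f"
    unfolding face_neighbors_def by blast
  have sub: "f \<subseteq> cuboid_set C \<inter> cuboid_set C'" unfolding f(3) by (rule hull_subset)
  have "w $ j = x" if "w \<in> f" for w
  proof -
    have "w \<in> cuboid_set C" "w \<in> cuboid_set C'" using that sub by blast+
    then have "min x u \<le> w $ j" "w $ j \<le> max x u" "min x u' \<le> w $ j" "w $ j \<le> max x u'"
      unfolding in_cuboid_set_iff[OF occ] in_cuboid_set_iff[OF occ'] by blast+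
    then show ?thesis using diff by (cases "x < u") auto
  qed
  then show ?thesis using that f sub by blast
qed

text \<open>The separating half-plane contains a common point off the edge, so the mesh condition
  yields a common face. Describing this face from both cuboids gives \<open>v = v'\<close>, that is,
  there are no hanging nodes.\<close>

lemma adjacent_quadrants:
  assumes occ: "occupies C i j k a1 a2 x y u v" and occ': "occupies C' i j k a1 a2 x y u' v'"
    and quad: "x < u \<longleftrightarrow> \<not> x < u'" "y < v \<longleftrightarrow> y < v'"
    and P: "P1 = axis_point i j a1 x y" "P2 = axis_point i j a2 x y"
    and mesh: "\<not> cuboid_set C \<inter> cuboid_set C' \<subseteq> closed_segment P1 P2 \<Longrightarrow> face_neighbors C C'"
  shows "face_neighbors C C'" and "v = v'"
    and "nodes C \<inter> nodes C' = {P1, P2, axis_point i j a1 x v, axis_point i j a2 x v}"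
proof -
  note co = occupies_coordinates[OF occ] and co' = occupies_coordinates[OF occ']
  obtain r where r: "min a1 a2 < r" "r < max a1 a2"
    using co(7) common_interior_coordinate[of a1 a2 a2] by blast
  obtain t where t: "min y v < t" "t < max y v" "min y v' < t" "t < max y v'"
    using common_interior_coordinate[OF co(9) co'(9) quad(2)] .
  define q where "q = axis_point i j r x t"
  have q: "q $ i = r" "q $ j = x" "q $ k = t" using co(10) by (auto simp: q_def)
  have mem: "q \<in> cuboid_set C \<inter> cuboid_set C'"
    unfolding Int_iff in_cuboid_set_iff[OF occ] in_cuboid_set_iff[OF occ'] q
    by (intro conjI less_imp_le[OF r(1)] less_imp_le[OF r(2)] less_imp_le[OF t(1)]
      less_imp_le[OF t(2)] less_imp_le[OF t(3)] less_imp_le[OF t(4)] min.cobounded1 max.cobounded1)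
  have "P1 $ k = y" "P2 $ k = y" using P co(10) by auto
  from closed_segment_nth[OF _ this, of q] have "q \<notin> closed_segment P1 P2"
    using q t by auto
  with mem mesh show fn: "face_neighbors C C'" by blast
  obtain f where f: "f \<in> faces C" "f \<in> faces C'" "\<forall>w \<in> f. w $ j = x"
    by (rule common_face_in_plane[OF occ occ' quad(1) fn]) (rule that)
  have "axis_point i j a1 x v \<in> f"
    using face_in_coordinate_plane[OF occ f(1,3)] by simp
  then show v: "v = v'"
    unfolding face_in_coordinate_plane[OF occ' f(2,3)] using co(9)
    by (auto simp: axis_point_eq_iff[OF co(10)])
  have "u \<noteq> u'" using quad(1) by auto
  then show "nodes C \<inter> nodes C' = {P1, P2, axis_point i j a1 x v, axis_point i j a2 x v}"
    unfolding boxD(2)[OF occupies_box[OF occ]] boxD(2)[OF occupies_box[OF occ']] P v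
    using co(8) co'(8) by (auto simp: axis_point_eq_iff[OF co(10)])
qed

text \<open>A common face would lie in the plane of coordinate \<open>j\<close> and contain a node
  whose coordinate \<open>k\<close> is \<open>v\<close>, on the wrong side of \<open>y\<close> for
  \<open>C'\<close>.\<close>

lemma not_face_neighbors_opposite:
  assumes occ: "occupies C i j k a1 a2 x y u v" and occ': "occupies C' i j k a1 a2 x y u' v'"
    and quad: "x < u \<longleftrightarrow> \<not> x < u'" "y < v \<longleftrightarrow> \<not> y < v'"
  shows "\<not> face_neighbors C C'"
proof
  assume fn: "face_neighbors C C'"
  note co = occupies_coordinates[OF occ] and co' = occupies_coordinates[OF occ']
  obtain f where f: "f \<in> faces C" "f \<in> faces C'" "\<forall>w \<in> f. w $ j = x"
    "f \<subseteq> cuboid_set C \<inter> cuboid_set C'"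
    using common_face_in_plane[OF occ occ' quad(1) fn] by blast
  have "axis_point i j a1 x v \<in> f"
    using face_in_coordinate_plane[OF occ f(1,3)] by simp
  then have "axis_point i j a1 x v \<in> cuboid_set C'" using f(4) by blast
  then have "min y v' \<le> v \<and> v \<le> max y v'"
    using in_cuboid_set_iff[OF occ', of "axis_point i j a1 x v"] co(10) by auto
  then show False using quad(2) co(9) co'(9) by (auto simp: min_def max_def split: if_splits)
qed

text \<open>The cuboids \<open>C i0\<close>, \<open>C i1\<close>, \<open>C i2\<close>, \<open>C i3\<close> surround the edge in this cyclic order; \<open>R0\<close>, \<dots>,
  \<open>R3\<close> are the pairs of further nodes of the four faces between consecutive cuboids.\<close>

definition side_box :: "cuboid \<Rightarrow> point \<Rightarrow> point \<Rightarrow> point \<times> point \<Rightarrow> point \<times> point \<Rightarrow> bool" where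
  "side_box C P1 P2 A B \<longleftrightarrow> (\<exists>E1 E2. box_at_edge C P1 P2 (fst A) (snd A) (fst B) (snd B) E1 E2)"

definition side_face :: "point \<Rightarrow> point \<Rightarrow> point \<times> point \<Rightarrow> point set" where
  "side_face P1 P2 A = {P1, P2, fst A, snd A}"

definition cyclic_system ::
    "(nat \<Rightarrow> cuboid) \<Rightarrow> point \<Rightarrow> point \<Rightarrow> nat \<Rightarrow> nat \<Rightarrow> nat \<Rightarrow> nat \<Rightarrow>
     point \<times> point \<Rightarrow> point \<times> point \<Rightarrow> point \<times> point \<Rightarrow> point \<times> point \<Rightarrow> bool" where
  "cyclic_system C P1 P2 i0 i1 i2 i3 R0 R1 R2 R3 \<longleftrightarrow>
     {i0, i1, i2, i3} = {1..4} \<and> distinct [i0, i1, i2, i3] \<and>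
     side_box (C i0) P1 P2 R3 R0 \<and> side_box (C i1) P1 P2 R0 R1 \<and>
     side_box (C i2) P1 P2 R1 R2 \<and> side_box (C i3) P1 P2 R2 R3 \<and>
     nodes (C i0) \<inter> nodes (C i1) = side_face P1 P2 R0 \<and>
     nodes (C i1) \<inter> nodes (C i2) = side_face P1 P2 R1 \<and>
     nodes (C i2) \<inter> nodes (C i3) = side_face P1 P2 R2 \<and>
     nodes (C i3) \<inter> nodes (C i0) = side_face P1 P2 R3 \<and>
     face_neighbors (C i0) (C i1) \<and> face_neighbors (C i1) (C i2) \<and>
     face_neighbors (C i2) (C i3) \<and> face_neighbors (C i3) (C i0) \<and>
     \<not> face_neighbors (C i0) (C i2) \<and> \<not> face_neighbors (C i1) (C i3) \<and>
     (\<forall>i \<in> {1..4}. \<not> face_neighbors (C i) (C i))"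

lemma side_box_swap: "side_box C P1 P2 A B \<longleftrightarrow> side_box C P1 P2 B A"
  unfolding side_box_def using box_swap_sides by blast

text \<open>Together with \<open>cyclic_system_reflect\<close>, which fixes \<open>i0\<close> and
  exchanges \<open>R0\<close> with \<open>R3\<close>, this allows all later claims to be stated for
  the graph \<open>i0\<close> and the face \<open>R0\<close> only.\<close>

lemma cyclic_system_rotate:
  "cyclic_system C P1 P2 i0 i1 i2 i3 R0 R1 R2 R3 \<Longrightarrow> cyclic_system C P1 P2 i1 i2 i3 i0 R1 R2 R3 R0"
  unfolding cyclic_system_def by (auto simp: face_neighbors_commute)

lemma cyclic_system_reflect:
  "cyclic_system C P1 P2 i0 i1 i2 i3 R0 R1 R2 R3 \<Longrightarrow> cyclic_system C P1 P2 i0 i3 i2 i1 R3 R2 R1 R0"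
  unfolding cyclic_system_def
  using side_box_swap face_neighbors_commute by (auto simp: Int_commute insert_commute)

lemma ex_distinct_axes: "\<exists>j k. distinct [i, j, k :: 3]"
proof -
  have "distinct [1, 2, 3 :: 3]" "distinct [2, 3, 1 :: 3]" "distinct [3, 1, 2 :: 3]" by simp_all
  then show ?thesis using exhaust_3[of i] by blast
qed

lemma ex_cyclic_system:
  assumes sys: "system_of_cuboids C P1 P2"
  shows "\<exists>i0 i1 i2 i3 R0 R1 R2 R3. cyclic_system C P1 P2 i0 i1 i2 i3 R0 R1 R2 R3"
proof -
  have edge: "is_cuboid (C n)" "{P1, P2} \<in> edges (C n)" if "n \<in> {1..4}" for n
    using sys that by (auto simp: system_of_cuboids_def)
  have mesh: "face_neighbors (C m) (C n)" if "m \<in> {1..4}" "n \<in> {1..4}" "m \<noteq> n"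
    "\<not> cuboid_set (C m) \<inter> cuboid_set (C n) \<subseteq> closed_segment P1 P2" for m n
    using sys that unfolding system_of_cuboids_def by blast
  have P: "P1 \<in> nodes (C n) \<and> P2 \<in> nodes (C n) \<and> (\<exists>!z. P1 $ z \<noteq> P2 $ z)" if n: "n \<in> {1..4}" for n
  proof -
    from edge(2)[OF n] obtain w w' where "{P1, P2} = {w, w'}" "w \<in> nodes (C n)" "w' \<in> nodes (C n)"
      "\<exists>!z. w $ z \<noteq> w' $ z" unfolding edges_def by blast
    moreover from this(1) have "P1 = w \<and> P2 = w' \<or> P1 = w' \<and> P2 = w"
      by (simp add: doubleton_eq_iff)
    ultimately show ?thesis by metis
  qed
  have "\<exists>!z. P1 $ z \<noteq> P2 $ z" using P[of 1] by simp
  then obtain i where i: "P1 $ i \<noteq> P2 $ i" "\<And>z. z \<noteq> i \<Longrightarrow> P1 $ z = P2 $ z" by metis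
  obtain j k where ax: "distinct [i, j, k]" using ex_distinct_axes by blast
  define a1 a2 x y where "a1 = P1 $ i" "a2 = P2 $ i" "x = P1 $ j" "y = P1 $ k"
  note defs = this
  \<comment> \<open>The sum of both ends minus the end at the edge is the far end, on whichever side
    of the edge the cuboid lies.\<close>
  define u v where "u n = lo (C n) $ j + hi (C n) $ j - x" "v n = lo (C n) $ k + hi (C n) $ k - y" for n
  note uv = this
  let ?p = "axis_point i j"
  have P12: "P1 = ?p a1 x y" "P2 = ?p a2 x y"
    using ax i(2)[of j] i(2)[of k] by (auto intro!: axis_point_eqI simp: defs)
  have occ: "occupies (C n) i j k a1 a2 x y (u n) (v n)" if n: "n \<in> {1..4}" for n
  proof -
    have "P1 $ z \<in> {lo (C n) $ z, hi (C n) $ z}" "P2 $ z \<in> {lo (C n) $ z, hi (C n) $ z}" for z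
      using P[OF n] unfolding nodes_def by auto
    note * = this[of i] this[of j] this[of k]
    have "{lo (C n) $ i, hi (C n) $ i} = {a1, a2}" using *(1,2) i(1) by (auto simp: defs)
    moreover have "{lo (C n) $ j, hi (C n) $ j} = {x, u n}" using *(3) by (auto simp: defs uv)
    moreover have "{lo (C n) $ k, hi (C n) $ k} = {y, v n}" using *(5) by (auto simp: defs uv)
    ultimately show ?thesis using ax edge(1)[OF n] by (simp add: occupies_def)
  qed
  have Pj: "P1 $ j = x" "P2 $ j = x" using P12 ax by auto
  define quad where "quad n = (x < u n, y < v n)" for n
  \<comment> \<open>Four cuboids in distinct quadrants fill all four of them; \<open>q\<close> below
    picks the cuboid of a given quadrant.\<close>
  have "inj_on quad {1..4}"
  proof (rule inj_onI, rule ccontr)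
    fix m n assume mn: "m \<in> {1..4}" "n \<in> {1..4}" "quad m = quad n" "m \<noteq> n"
    note * = not_face_neighbors_same_quadrant[OF occ[OF mn(1)] occ[OF mn(2)]]
    from mn(3) have "x < u m \<longleftrightarrow> x < u n" "y < v m \<longleftrightarrow> y < v n" by (auto simp: quad_def)
    from *(1)[OF this] *(2)[OF this Pj] mesh[OF mn(1,2,4)] show False by blast
  qed
  then have "card (quad ` {1..4}) = card (UNIV :: (bool \<times> bool) set)"
    by (simp add: card_image)
  then have "quad ` {1..4} = UNIV" by (intro card_subset_eq) auto
  then have "\<exists>n \<in> {1..4}. quad n = (s, t)" for s t by (metis UNIV_I imageE)
  then obtain q where q: "\<And>s t. q s t \<in> {1..4}" "\<And>s t. quad (q s t) = (s, t)"
    by metis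
  have qu: "x < u (q s t) \<longleftrightarrow> s" "y < v (q s t) \<longleftrightarrow> t" for s t
    using q(2)[of s t] by (auto simp: quad_def)
  have qne: "q s t = q s' t' \<longleftrightarrow> s = s' \<and> t = t'" for s t s' t'
  proof
    assume eq: "q s t = q s' t'"
    show "s = s' \<and> t = t'" using q(2)[of s t] unfolding eq q(2) prod.inject by metis
  next
    assume "s = s' \<and> t = t'"
    then show "q s t = q s' t'" by (elim conjE) (simp only:)
  qed
  have occq: "occupies (C (q s t)) i j k a1 a2 x y (u (q s t)) (v (q s t))" for s t
    by (rule occ[OF q(1)])
  have ax': "distinct [i, k, j]" using ax by auto
  have Pk: "P1 = axis_point i k a1 y x" "P2 = axis_point i k a2 y x"
    unfolding axis_point_swap[OF ax] P12 by simp_all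
  define A B where "A n = (?p a1 (u n) y, ?p a2 (u n) y)" "B n = (?p a1 x (v n), ?p a2 x (v n))" for n
  note AB = this
  \<comment> \<open>Cuboids on different sides in coordinate \<open>j\<close> share the face with
    the nodes \<open>B\<close>; \<open>ver\<close> is the same with the axes exchanged, the common
    nodes being \<open>A\<close>.\<close>
  have hor: "face_neighbors (C (q s t)) (C (q (\<not> s) t))" "B (q s t) = B (q (\<not> s) t)"
    "nodes (C (q s t)) \<inter> nodes (C (q (\<not> s) t)) = side_face P1 P2 (B (q s t))" for s t
  proof -
    note * = adjacent_quadrants[OF occq[of s t] occq[of "\<not> s" t] _ _ P12 mesh[OF q(1) q(1)]]
    show "face_neighbors (C (q s t)) (C (q (\<not> s) t))" by (rule *(1)) (simp_all add: qu qne)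
    have "v (q s t) = v (q (\<not> s) t)" by (rule *(2)) (simp_all add: qu qne)
    then show "B (q s t) = B (q (\<not> s) t)" by (simp add: AB)
    have "nodes (C (q s t)) \<inter> nodes (C (q (\<not> s) t)) = {P1, P2, ?p a1 x (v (q s t)), ?p a2 x (v (q s t))}"
      by (rule *(3)) (simp_all add: qu qne)
    then show "nodes (C (q s t)) \<inter> nodes (C (q (\<not> s) t)) = side_face P1 P2 (B (q s t))"
      by (simp add: AB side_face_def)
  qed
  have ver: "face_neighbors (C (q s t)) (C (q s (\<not> t)))" "A (q s t) = A (q s (\<not> t))"
    "nodes (C (q s t)) \<inter> nodes (C (q s (\<not> t))) = side_face P1 P2 (A (q s t))" for s t
  proof -
    note * = adjacent_quadrants[OF occupies_swap[OF occq[of s t]] occupies_swap[OF occq[of s "\<not> t"]]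
        _ _ Pk mesh[OF q(1) q(1)], unfolded axis_point_swap[OF ax]]
    show "face_neighbors (C (q s t)) (C (q s (\<not> t)))" by (rule *(1)) (simp_all add: qu qne)
    have "u (q s t) = u (q s (\<not> t))" by (rule *(2)) (simp_all add: qu qne)
    then show "A (q s t) = A (q s (\<not> t))" by (simp add: AB)
    have "nodes (C (q s t)) \<inter> nodes (C (q s (\<not> t))) = {P1, P2, ?p a1 (u (q s t)) y, ?p a2 (u (q s t)) y}"
      by (rule *(3)) (simp_all add: qu qne)
    then show "nodes (C (q s t)) \<inter> nodes (C (q s (\<not> t))) = side_face P1 P2 (A (q s t))"
      by (simp add: AB side_face_def)
  qed
  have opp: "\<not> face_neighbors (C (q s t)) (C (q (\<not> s) (\<not> t)))" for s t
    by (rule not_face_neighbors_opposite[OF occq occq]) (simp_all add: qu)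
  have self: "\<not> face_neighbors (C n) (C n)" if "n \<in> {1..4}" for n
    by (rule not_face_neighbors_same_quadrant(1)[OF occ[OF that] occ[OF that]]) simp_all
  have box: "side_box (C (q s t)) P1 P2 (A (q s t)) (B (q s t))" for s t
    unfolding side_box_def AB P12 fst_conv snd_conv using occupies_box[OF occq] by blast
  have dist: "distinct [q True True, q False True, q False False, q True False]"
    by (simp add: qne)
  have "{q True True, q False True, q False False, q True False} = {1..4}"
  proof (rule card_subset_eq)
    show "card {q True True, q False True, q False False, q True False} = card {1..4 :: nat}"
      by (simp add: qne)
  qed (use q(1) in auto)
  then have "cyclic_system C P1 P2 (q True True) (q False True) (q False False) (q True False)
      (B (q True True)) (A (q False True)) (B (q False False)) (A (q True False))"
    unfolding cyclic_system_def
    using dist box[of True True] box[of False True] box[of False False] box[of True False] self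
      opp[of True True] opp[of False True] hor[of True True] hor[of False False]
      ver[of False True] ver[of True False] side_box_swap
    by simp
  then show ?thesis by blast
qed

section \<open>Disperse connection\<close>

lemma chain_connected_sym:
  assumes "chain_connected c G P1 P2 \<Omega> w w' l" "1 \<le> l"
  shows "chain_connected c G P1 P2 \<Omega> w' w l"
proof -
  from assms(1) obtain r where r: "\<forall>k \<in> {1..l}. r k \<in> {1..4}"
    "face_nbrs (G (fst w)) (G (r 1))" "face_nbrs (G (r l)) (G (fst w'))"
    "\<forall>k \<in> {1..<l}. face_nbrs (G (r k)) (G (r (k + 1)))"
    "crosses G P1 P2 w (r 1)" "crosses G P1 P2 w' (r l)"
    "\<forall>k \<in> {1..l}. 7 \<le> D c (G (r k)) \<and> (\<forall>\<omega>. (r k, \<omega>) \<notin> \<Omega>)"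
    unfolding chain_connected_def by blast
  define s where "s k = r (l + 1 - k)" for k
  have ends: "s 1 = r l" "s l = r 1" using assms(2) by (simp_all add: s_def)
  have mem: "l + 1 - k \<in> {1..l}" if "k \<in> {1..l}" for k using that by auto
  have "face_nbrs (G (s k)) (G (s (k + 1)))" if k: "k \<in> {1..<l}" for k
  proof -
    have "l - k \<in> {1..<l}" "l - k + 1 = l + 1 - k" "l + 1 - (k + 1) = l - k" using k by auto
    then show ?thesis using r(4) unfolding s_def by (metis face_neighbors_commute)
  qed
  moreover have "\<forall>k \<in> {1..l}. s k \<in> {1..4}" "\<forall>k \<in> {1..l}. 7 \<le> D c (G (s k)) \<and> (\<forall>\<omega>. (s k, \<omega>) \<notin> \<Omega>)"
    unfolding s_def using r(1,7) mem by blast+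
  ultimately show ?thesis
    unfolding chain_connected_def
    by (intro exI[of _ s]) (use r(2,3,5,6) ends face_neighbors_commute in auto)
qed

lemma directly_connected_sym:
  "directly_connected c G P1 P2 w w' \<longleftrightarrow> directly_connected c G P1 P2 w' w"
  unfolding directly_connected_def using face_neighbors_commute by (auto simp: Int_commute)

lemma disperse_connected_sym:
  "disperse_connected c G P1 P2 \<Omega> m w w' \<longleftrightarrow> disperse_connected c G P1 P2 \<Omega> m w' w"
proof -
  have "l \<in> {1..4 - m} \<and> chain_connected c G P1 P2 \<Omega> w w' l \<longleftrightarrow>
      l \<in> {1..4 - m} \<and> chain_connected c G P1 P2 \<Omega> w' w l" for l
    using chain_connected_sym[of c G P1 P2 \<Omega> w w' l] chain_connected_sym[of c G P1 P2 \<Omega> w' w l] by auto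
  then show ?thesis
    unfolding disperse_connected_def using directly_connected_sym[of c G P1 P2 w w'] by simp
qed

lemma card_eq_of_bool_if_Uniq:
  assumes "P \<Longrightarrow> \<exists>!x. x \<in> X" "\<not> P \<Longrightarrow> X = {}"
  shows "finite X \<and> card X = of_bool P"
proof (cases P)
  case True
  with assms obtain x where "X = {x}" by blast
  with True show ?thesis by simp
qed (use assms in simp)

text \<open>Here \<open>k0\<close>, ..., \<open>k3\<close> stand for \<open>keeps\<close> and
  \<open>d0\<close>, ..., \<open>d3\<close> for \<open>disperse_pair\<close>; graph 0 lies between
  faces 3 and 0, graph 1 between faces 0 and 1, and so on. By the hypotheses, a disperse face at one
  end of a maximal run of graphs that lost the edge labels forces one at its other end, so the terms
  pair up. The proof checks all 256 cases.\<close>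

lemma even_crossing_number:
  fixes k0 k1 k2 k3 d0 d1 d2 d3 :: bool
  assumes "\<not> k1 \<Longrightarrow> d0 \<Longrightarrow> d1 \<or> \<not> k2 \<and> d2" "\<not> k2 \<Longrightarrow> d1 \<Longrightarrow> d2 \<or> \<not> k3 \<and> d3"
    "\<not> k3 \<Longrightarrow> d2 \<Longrightarrow> d3 \<or> \<not> k0 \<and> d0" "\<not> k0 \<Longrightarrow> d3 \<Longrightarrow> d0 \<or> \<not> k1 \<and> d1"
    "d0 \<Longrightarrow> \<not> k0 \<Longrightarrow> d3 \<or> \<not> k3 \<and> d2" "d3 \<Longrightarrow> \<not> k3 \<Longrightarrow> d2 \<or> \<not> k2 \<and> d1"
    "d2 \<Longrightarrow> \<not> k2 \<Longrightarrow> d1 \<or> \<not> k1 \<and> d0" "d1 \<Longrightarrow> \<not> k1 \<Longrightarrow> d0 \<or> \<not> k0 \<and> d3"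
  shows "even (of_bool (k0 \<and> d0) + of_bool (k0 \<and> d3) + of_bool (k1 \<and> d1) + of_bool (k1 \<and> d0) +
    of_bool (k2 \<and> d2) + of_bool (k2 \<and> d1) + of_bool (k3 \<and> d3) + of_bool (k3 \<and> d2) :: nat)"
  using assms
  by (cases k0; cases k1; cases k2; cases k3; cases d0; cases d1; cases d2; cases d3) simp_all

text \<open>The hypothesis on the first graph enters as label \<open>c\<close> of \<open>F\<close>
  at both ends of the edge. In this form it is symmetric in the four graphs, which makes rotation
  and reflection of the cycle available.\<close>

locale edge_system =
  fixes c :: real and C :: "nat \<Rightarrow> cuboid" and G :: "nat \<Rightarrow> lcgraph" and P1 P2 :: point
    and F :: "point \<Rightarrow> real" and inner outer :: "nat \<Rightarrow> iso_path set"
  assumes c: "0 < c" "c < 1"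
    and sys: "system_of_cuboids C P1 P2"
    and cub_G: "\<And>i. i \<in> {1..4} \<Longrightarrow> cub (G i) = C i"
    and free: "\<And>i. i \<in> {1..4} \<Longrightarrow> singular_free c (G i)"
      "\<And>i. i \<in> {1..4} \<Longrightarrow> isolated_free c (G ` {1..4}) (G i)"
    and removal: "\<And>i. i \<in> {1..4} \<Longrightarrow>
      \<exists>G'. removal c ((\<lambda>j. \<lparr>cub = C j, lab = F\<rparr>) ` {1..4}) \<lparr>cub = C i, lab = F\<rparr> G' \<and>
        (\<forall>v \<in> nodes (C i). lab (G i) v = lab G' v)"
    and F: "F P1 = c" "F P2 = c"
    and inner: "\<And>i. i \<in> {1..4} \<Longrightarrow> inner_iso_paths c (G ` {1..4}) (G i) (inner i)"
    and outer: "\<And>i. i \<in> {1..4} \<Longrightarrow> outer_iso_paths c (G ` {1..4}) (G i) (outer i)"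
begin

abbreviation cyclic where
  "cyclic \<equiv> cyclic_system (\<lambda>i. cub (G i)) P1 P2"

abbreviation keeps :: "nat \<Rightarrow> bool" where
  "keeps i \<equiv> lab (G i) P1 = c \<and> lab (G i) P2 = c"

abbreviation disperse_pair :: "point \<times> point \<Rightarrow> bool" where
  "disperse_pair R \<equiv> c < F (fst R) \<and> c < F (snd R)"

abbreviation \<Omega> :: "(nat \<times> iso_path) set" where
  "\<Omega> \<equiv> paths_through P1 P2 (\<lambda>i. inner i \<union> outer i)"

abbreviation passes :: "nat \<times> iso_path \<Rightarrow> point \<times> point \<Rightarrow> bool" where
  "passes w R \<equiv> passes_along P1 P2 (snd w) (side_face P1 P2 R)"

section \<open>Iso-paths through the edge in terms of \<open>keeps\<close> and
  \<open>disperse_pair\<close>\<close>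

lemma is_cuboid_G: "i \<in> {1..4} \<Longrightarrow> is_cuboid (cub (G i))"
  using sys cub_G by (auto simp: system_of_cuboids_def)

lemma edge_G: "i \<in> {1..4} \<Longrightarrow> {P1, P2} \<in> gedges (G i)"
  using sys cub_G by (auto simp: system_of_cuboids_def)

lemma ex_cyclic: "\<exists>i0 i1 i2 i3 R0 R1 R2 R3. cyclic i0 i1 i2 i3 R0 R1 R2 R3"
proof -
  from ex_cyclic_system[OF sys] obtain i0 i1 i2 i3 R0 R1 R2 R3
    where cyc: "cyclic_system C P1 P2 i0 i1 i2 i3 R0 R1 R2 R3" by blast
  then have "{i0, i1, i2, i3} = {1..4}" by (simp add: cyclic_system_def)
  then have "i0 \<in> {1..4}" "i1 \<in> {1..4}" "i2 \<in> {1..4}" "i3 \<in> {1..4}" by blast+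
  with cyc have "cyclic i0 i1 i2 i3 R0 R1 R2 R3"
    by (simp add: cyclic_system_def cub_G)
  then show ?thesis by blast
qed

lemma cyclicD:
  assumes "cyclic i0 i1 i2 i3 R0 R1 R2 R3"
  shows "i0 \<in> {1..4}" "i1 \<in> {1..4}" "i2 \<in> {1..4}" "i3 \<in> {1..4}"
    and "{i0, i1, i2, i3} = {1..4}" "distinct [i0, i1, i2, i3]"
    and "side_box (cub (G i0)) P1 P2 R0 R3"
    and "gnodes (G i0) \<inter> gnodes (G i1) = side_face P1 P2 R0"
    and "face_nbrs (G i0) (G i1)" "\<not> face_nbrs (G i0) (G i2)" "\<not> face_nbrs (G i0) (G i0)"
proof -
  note cyc = assms[unfolded cyclic_system_def]
  show eq: "{i0, i1, i2, i3} = {1..4}" using cyc by (elim conjE)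
  then show i: "i0 \<in> {1..4}" "i1 \<in> {1..4}" "i2 \<in> {1..4}" "i3 \<in> {1..4}" by blast+
  show "distinct [i0, i1, i2, i3]" using cyc by (elim conjE)
  show "side_box (cub (G i0)) P1 P2 R0 R3" using cyc side_box_swap by (elim conjE) blast
  show "gnodes (G i0) \<inter> gnodes (G i1) = side_face P1 P2 R0" using cyc by (elim conjE)
  show "face_nbrs (G i0) (G i1)" using cyc by (elim conjE)
  show "\<not> face_nbrs (G i0) (G i2)" using cyc by (elim conjE)
  have "\<forall>i \<in> {1..4}. \<not> face_nbrs (G i) (G i)" using cyc by (elim conjE)
  with i(1) show "\<not> face_nbrs (G i0) (G i0)" by blast
qed

lemma ex_box:
  assumes "i \<in> {1..4}"
  obtains A1 A2 B1 B2 E1 E2 where "box_at_edge (cub (G i)) P1 P2 A1 A2 B1 B2 E1 E2"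
proof -
  from ex_cyclic obtain i0 i1 i2 i3 R0 R1 R2 R3 where cyc: "cyclic i0 i1 i2 i3 R0 R1 R2 R3" by blast
  note rot = cyclic_system_rotate
  have "i \<in> {i0, i1, i2, i3}" using assms cyclicD(5)[OF cyc] by blast
  then have "\<exists>A B. side_box (cub (G i)) P1 P2 A B"
    using cyclicD(7)[OF cyc] cyclicD(7)[OF rot[OF cyc]] cyclicD(7)[OF rot[OF rot[OF cyc]]]
      cyclicD(7)[OF rot[OF rot[OF rot[OF cyc]]]] by blast
  then show ?thesis using that unfolding side_box_def by blast
qed

lemma neighbor_cases:
  assumes "cyclic i0 i1 i2 i3 R0 R1 R2 R3" "j \<in> {1..4}" "face_nbrs (G i0) (G j)"
  shows "j = i1 \<or> j = i3"
proof -
  have "j \<in> {i0, i1, i2, i3}" using cyclicD(5)[OF assms(1)] assms(2) by simp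
  then show ?thesis using cyclicD(10,11)[OF assms(1)] assms(3) by auto
qed

lemma cyclic_box:
  assumes "cyclic i0 i1 i2 i3 R0 R1 R2 R3"
  obtains E1 E2 where
    "box_at_edge (cub (G i0)) P1 P2 (fst R0) (snd R0) (fst R3) (snd R3) E1 E2"
  using cyclicD(7)[OF assms] unfolding side_box_def by blast

lemma removal_G:
  assumes "i \<in> {1..4}"
  obtains G' where "removal c ((\<lambda>j. \<lparr>cub = C j, lab = F\<rparr>) ` {1..4}) \<lparr>cub = cub (G i), lab = F\<rparr> G'"
    "\<forall>v \<in> gnodes (G i). lab G' v = lab (G i) v"
  using removal[OF assms] cub_G[OF assms] by auto

text \<open>Moves the condition from the labels after the removal to \<open>F\<close>: next to a
  node that still has label \<open>c\<close>, a disperse node was disperse before, and conversely a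
  disperse node is never relabeled.\<close>

lemma carries_iff:
  assumes cyc: "cyclic i0 i1 i2 i3 R0 R1 R2 R3"
  shows "carries_iso_edge c (G i0) P1 P2 (side_face P1 P2 R0) \<longleftrightarrow> keeps i0 \<and> disperse_pair R0"
proof -
  obtain E1 E2 where b: "box_at_edge (cub (G i0)) P1 P2 (fst R0) (snd R0) (fst R3) (snd R3) E1 E2"
    using cyclic_box[OF cyc] .
  obtain G' where rem: "removal c ((\<lambda>j. \<lparr>cub = C j, lab = F\<rparr>) ` {1..4}) \<lparr>cub = cub (G i0), lab = F\<rparr> G'"
    and G': "\<forall>v \<in> gnodes (G i0). lab G' v = lab (G i0) v"
    using removal_G[OF cyclicD(1)[OF cyc]] .
  have n: "P1 \<in> gnodes (G i0)" "P2 \<in> gnodes (G i0)" "fst R0 \<in> gnodes (G i0)" "snd R0 \<in> gnodes (G i0)"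
    "fst R0 \<in> nbrs (G i0) P1" "snd R0 \<in> nbrs (G i0) P2"
    unfolding boxD(2)[OF b] box_incident_nodes[OF b] by simp_all
  have up: "c < lab (G i0) v \<Longrightarrow> c < F v" if "v \<in> nbrs (G i0) u" "u \<in> gnodes (G i0)" "lab (G i0) u = c" for u v
  proof -
    have "v \<in> gnodes (G i0)" using that(1) incident_nodes_subset by blast
    with G' that(2) have "lab G' v = lab (G i0) v" "lab G' u = lab (G i0) u" by blast+
    then show "c < lab (G i0) v \<Longrightarrow> c < F v"
      using removal_disperse_next_to_continuous[OF rem c(2), of u v] that by simp
  qed
  have down: "c < lab (G i0) v" if "v \<in> gnodes (G i0)" "c < F v" for v
    using lab_removal[OF rem, of v] G' that by auto
  show ?thesis
    unfolding side_face_def carries_iso_edge_iff[OF b]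
    using up[OF n(5,1)] up[OF n(6,2)] down[OF n(3)] down[OF n(4)] by blast
qed

lemma \<Omega>_iff: "(i, \<omega>) \<in> \<Omega> \<longleftrightarrow> i \<in> {1..4} \<and> \<omega> \<in> inner i \<and> (\<exists>f. passes_along P1 P2 \<omega> f)"
  using outer_iso_path_not_passes_through[OF outer _ edge_G]
  by (auto simp: paths_through_def passes_through_def)

lemma \<Omega>_passes_along:
  assumes "(i, \<omega>) \<in> \<Omega>" "passes_along P1 P2 \<omega> f"
  shows "carries_iso_edge c (G i) P1 P2 f" "keeps i"
    and "(i, \<omega>') \<in> \<Omega> \<Longrightarrow> passes_along P1 P2 \<omega>' f \<Longrightarrow> \<omega>' = \<omega>"
    and "passes_along P1 P2 \<omega> f' \<Longrightarrow> f' = f"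
proof -
  from assms(1) have i: "i \<in> {1..4}" and \<omega>: "\<omega> \<in> inner i" by (auto simp: \<Omega>_iff)
  obtain A1 A2 B1 B2 E1 E2 where b: "box_at_edge (cub (G i)) P1 P2 A1 A2 B1 B2 E1 E2"
    using ex_box[OF i] .
  note ctxt = c b is_cuboid_G[OF i] free(1)[OF i] free(2)[OF i] inner[OF i]
  show car: "carries_iso_edge c (G i) P1 P2 f"
    by (rule inner_iso_path_passes_along_imp_carries[OF ctxt \<omega> assms(2)])
  then show "keeps i" by (simp add: carries_iso_edge_def)
  show "\<omega>' = \<omega>" if "(i, \<omega>') \<in> \<Omega>" "passes_along P1 P2 \<omega>' f"
  proof -
    have "\<omega>' \<in> inner i" using that(1) by (simp add: \<Omega>_iff)
    then show ?thesis
      using carries_imp_unique_inner_iso_path[OF ctxt car] \<omega> assms(2) that(2) by blast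
  qed
  show "f' = f" if "passes_along P1 P2 \<omega> f'"
    by (rule inner_iso_path_passes_along_unique[OF ctxt \<omega> that assms(2)])
qed

lemma not_in_\<Omega>_if_not_keeps: "\<not> keeps i \<Longrightarrow> (i, \<omega>) \<notin> \<Omega>"
  using \<Omega>_passes_along(2) \<Omega>_iff by blast

lemma ex_path:
  assumes cyc: "cyclic i0 i1 i2 i3 R0 R1 R2 R3" and "keeps i0" "disperse_pair R0"
  obtains w where "w \<in> \<Omega>" "fst w = i0" "passes w R0"
proof -
  obtain E1 E2 where b: "box_at_edge (cub (G i0)) P1 P2 (fst R0) (snd R0) (fst R3) (snd R3) E1 E2"
    using cyclic_box[OF cyc] .
  note i = cyclicD(1)[OF cyc]
  have "carries_iso_edge c (G i0) P1 P2 (side_face P1 P2 R0)"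
    using carries_iff[OF cyc] assms(2,3) by blast
  from carries_imp_unique_inner_iso_path[OF c b is_cuboid_G[OF i] free(1)[OF i] free(2)[OF i] inner[OF i] this]
  obtain \<omega> where "\<omega> \<in> inner i0" "passes_along P1 P2 \<omega> (side_face P1 P2 R0)" by blast
  then have "(i0, \<omega>) \<in> \<Omega>" using i by (auto simp: \<Omega>_iff)
  then show ?thesis using that[of "(i0, \<omega>)"] \<open>passes_along P1 P2 \<omega> _\<close> by simp
qed

lemma passes_cases:
  assumes cyc: "cyclic i0 i1 i2 i3 R0 R1 R2 R3" and "w \<in> \<Omega>" "fst w = i0"
  shows "passes w R0 \<or> passes w R3" "\<not> (passes w R0 \<and> passes w R3)"
proof -
  obtain E1 E2 where b: "box_at_edge (cub (G i0)) P1 P2 (fst R0) (snd R0) (fst R3) (snd R3) E1 E2"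
    using cyclic_box[OF cyc] .
  obtain \<omega> where w: "w = (i0, \<omega>)" using assms(3) by (cases w) auto
  with assms(2) obtain f where f: "passes_along P1 P2 \<omega> f" using \<Omega>_iff by blast
  have "carries_iso_edge c (G i0) P1 P2 f" using \<Omega>_passes_along(1)[of i0 \<omega> f] assms(2) w f by blast
  then have "f = side_face P1 P2 R0 \<or> f = side_face P1 P2 R3"
    using box_faces_at_edge[OF b, of f] unfolding carries_iso_edge_def side_face_def by simp
  then show "passes w R0 \<or> passes w R3" using f w by auto
  have "fst R0 \<notin> side_face P1 P2 R3" "fst R0 \<in> side_face P1 P2 R0"
    unfolding side_face_def using box_neq[OF b] box_neq[OF b, symmetric] by simp_all
  then have "side_face P1 P2 R0 \<noteq> side_face P1 P2 R3" by metis
  then show "\<not> (passes w R0 \<and> passes w R3)"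
    using \<Omega>_passes_along(4)[of i0 \<omega>] assms(2) unfolding w snd_conv by metis
qed

lemma passes_imp:
  assumes "cyclic i0 i1 i2 i3 R0 R1 R2 R3" "w \<in> \<Omega>" "fst w = i0" "passes w R0"
  shows "keeps i0" "disperse_pair R0"
proof -
  obtain \<omega> where w: "w = (i0, \<omega>)" using assms(3) by (cases w) auto
  have "carries_iso_edge c (G i0) P1 P2 (side_face P1 P2 R0)"
    using \<Omega>_passes_along(1)[of i0 \<omega>] assms(2,4) unfolding w by simp
  then show "keeps i0" "disperse_pair R0" using carries_iff[OF assms(1)] by blast+
qed

lemma crosses_iff:
  assumes cyc: "cyclic i0 i1 i2 i3 R0 R1 R2 R3" and w: "w \<in> \<Omega>" "fst w = i0" "passes w R0"
    and j: "j \<in> {1..4}"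
  shows "crosses G P1 P2 w j \<longleftrightarrow> j = i1"
proof
  assume cr: "crosses G P1 P2 w j"
  then have "j = i1 \<or> j = i3"
    using neighbor_cases[OF cyc j] w(2) by (simp add: crosses_def)
  moreover have "passes w R3" if "j = i3"
    using cr cyclicD(8)[OF cyclic_system_reflect[OF cyc]] w(2) that by (simp add: crosses_def)
  ultimately show "j = i1" using passes_cases(2)[OF cyc w(1,2)] w(3) by blast
next
  assume "j = i1"
  then show "crosses G P1 P2 w j"
    using w cyclicD(8,9)[OF cyc] by (simp add: crosses_def)
qed

text \<open>Each face carries at most one iso-path of a graph, so the direction of leaving tells
  apart two iso-paths of the same graph.\<close>

lemma crosses_inj:
  assumes "w \<in> \<Omega>" "w' \<in> \<Omega>" "fst w = fst w'" "crosses G P1 P2 w j" "crosses G P1 P2 w' j"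
  shows "w' = w"
proof -
  obtain i \<omega> \<omega>' where w: "w = (i, \<omega>)" "w' = (i, \<omega>')" using assms(3) by (cases w; cases w') auto
  show ?thesis
    using \<Omega>_passes_along(3)[of i \<omega> "gnodes (G i) \<inter> gnodes (G j)" \<omega>'] assms unfolding w crosses_def
    by simp
qed

lemma not_keeps_if_D_ge_7:
  assumes "i \<in> {1..4}" "7 \<le> D c (G i)"
  shows "\<not> keeps i"
proof
  assume k: "keeps i"
  obtain A1 A2 B1 B2 E1 E2 where "box_at_edge (cub (G i)) P1 P2 A1 A2 B1 B2 E1 E2"
    using ex_box[OF assms(1)] .
  from D_le_6_if_edge_continuous[OF this] k assms(2) show False by simp
qed

text \<open>In the F2 case the partner cannot be \<open>i1\<close>, since the common face with it
  contains the disperse nodes of \<open>R0\<close>; so it is \<open>i3\<close>. By symmetry of the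
  F2-condition \<open>i3\<close> is relabeled too, and the nodes of \<open>R2\<close> lie off the
  common face, hence are disperse.\<close>

lemma entered_not_keeping:
  assumes cyc: "cyclic i0 i1 i2 i3 R0 R1 R2 R3" and R0: "disperse_pair R0" and K: "\<not> keeps i0"
  shows "7 \<le> D c (G i0)" "disperse_pair R3 \<or> \<not> keeps i3 \<and> disperse_pair R2"
proof -
  let ?M = "(\<lambda>j. \<lparr>cub = C j, lab = F\<rparr>) ` {1..4}"
  obtain E1 E2 where b: "box_at_edge (cub (G i0)) P1 P2 (fst R0) (snd R0) (fst R3) (snd R3) E1 E2"
    using cyclic_box[OF cyc] .
  obtain G' where rem: "removal c ?M \<lparr>cub = cub (G i0), lab = F\<rparr> G'"
    and G': "\<forall>v \<in> gnodes (G i0). lab G' v = lab (G i0) v"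
    using removal_G[OF cyclicD(1)[OF cyc]] .
  have P: "P1 \<in> gnodes (G i0)" "P2 \<in> gnodes (G i0)" unfolding boxD(2)[OF b] by simp_all
  have K': "lab G' P1 \<noteq> c \<or> lab G' P2 \<noteq> c" using K bspec[OF G' P(1)] bspec[OF G' P(2)] by simp
  have b': "box_at_edge (cub \<lparr>cub = cub (G i0), lab = F\<rparr>) P1 P2 (fst R0) (snd R0) (fst R3) (snd R3) E1 E2"
    using b by simp
  have l: "lab \<lparr>cub = cub (G i0), lab = F\<rparr> = F" by simp
  note rem_edge = removal_at_edge[OF rem c(2) b', unfolded l, OF F R0[THEN conjunct1]
      R0[THEN conjunct2] K']
  have "cub G' = cub (G i0)"
    using rem by (cases rule: removal_cases) simp_all
  then have "disperse_nodes c G' = disperse_nodes c (G i0)"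
    using G' by (auto simp: disperse_nodes_def)
  with rem_edge(1) show "7 \<le> D c (G i0)" by simp
  show "disperse_pair R3 \<or> \<not> keeps i3 \<and> disperse_pair R2"
    using rem_edge(2)
  proof
    assume "F2_graph c ?M \<lparr>cub = cub (G i0), lab = F\<rparr>"
    then obtain j where j: "j \<in> {1..4}" and pair: "F2_pair c F (cub (G i0)) (cub (G j))"
      unfolding F2_graph_iff_F2_pair using cub_G by auto
    have "j \<noteq> i1"
    proof
      assume "j = i1"
      then have "fst R0 \<in> gnodes (G i0) \<inter> gnodes (G j)"
        using cyclicD(8)[OF cyc] by (simp add: side_face_def)
      then show False using pair R0 unfolding F2_pair_def by fastforce
    qed
    then have "j = i3"
      using neighbor_cases[OF cyc j] pair by (simp add: F2_pair_def)
    with pair have pair: "F2_pair c F (cub (G i3)) (cub (G i0))" by (simp add: F2_pair_commute)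
    note rot = cyclic_system_rotate
    have cyc3: "cyclic i3 i0 i1 i2 R3 R0 R1 R2" by (rule rot[OF rot[OF rot[OF cyc]]])
    obtain E1' E2' where b3: "box_at_edge (cub (G i3)) P1 P2 (fst R3) (snd R3) (fst R2) (snd R2) E1' E2'"
      using cyclic_box[OF cyc3] .
    have "fst R2 \<in> gnodes (G i3) - gnodes (G i0)" "snd R2 \<in> gnodes (G i3) - gnodes (G i0)"
      using cyclicD(8)[OF cyc3] box_neq[OF b3] box_neq[OF b3, symmetric]
      unfolding side_face_def boxD(2)[OF b3] by auto
    then have "disperse_pair R2" using pair unfolding F2_pair_def by blast
    moreover have "\<not> keeps i3"
    proof -
      have "F2_graph c ?M \<lparr>cub = cub (G i3), lab = F\<rparr>"
        unfolding F2_graph_iff_F2_pair using pair cyclicD(1)[OF cyc] cub_G by metis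
      moreover obtain G3 where "removal c ?M \<lparr>cub = cub (G i3), lab = F\<rparr> G3"
        and G3: "\<forall>v \<in> gnodes (G i3). lab G3 v = lab (G i3) v"
        using removal_G[OF cyclicD(1)[OF cyc3]] .
      ultimately have "G3 = relabel {P \<in> gnodes (G i3). F P = c} 1 \<lparr>cub = cub (G i3), lab = F\<rparr>"
        by (simp add: removal_def)
      moreover have "P1 \<in> gnodes (G i3)" unfolding boxD(2)[OF b3] by simp
      ultimately have "lab (G i3) P1 = 1" using bspec[OF G3, of P1] F by simp
      with c show ?thesis by simp
    qed
    ultimately show ?thesis by blast
  qed blast
qed

lemma entered_next:
  assumes cyc: "cyclic i0 i1 i2 i3 R0 R1 R2 R3" and K: "\<not> keeps i1"
  shows "disperse_pair R0 \<or> disperse_pair R1 \<Longrightarrow> 7 \<le> D c (G i1)"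
    and "disperse_pair R0 \<Longrightarrow> disperse_pair R1 \<or> \<not> keeps i2 \<and> disperse_pair R2"
proof -
  note rot = cyclic_system_rotate[OF cyc]
  note refl = cyclic_system_reflect[OF rot]
  show "7 \<le> D c (G i1)" if "disperse_pair R0 \<or> disperse_pair R1"
    using that entered_not_keeping(1)[OF rot _ K] entered_not_keeping(1)[OF refl _ K] by blast
  show "disperse_pair R1 \<or> \<not> keeps i2 \<and> disperse_pair R2" if "disperse_pair R0"
    by (rule entered_not_keeping(2)[OF refl that K])
qed

section \<open>Counting the iso-paths through the edge\<close>

lemma card_paths_at:
  assumes cyc: "cyclic i0 i1 i2 i3 R0 R1 R2 R3"
  shows "finite {w \<in> \<Omega>. fst w = i0}"
    and "card {w \<in> \<Omega>. fst w = i0} = of_bool (keeps i0 \<and> disperse_pair R0) + of_bool (keeps i0 \<and> disperse_pair R3)"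
proof -
  have one: "finite {w \<in> \<Omega>. fst w = i0 \<and> passes w R} \<and>
      card {w \<in> \<Omega>. fst w = i0 \<and> passes w R} = of_bool (keeps i0 \<and> disperse_pair R)"
    if cyc: "cyclic i0 i i2' i3' R R' R'' R'''" for i i2' i3' R R' R'' R'''
  proof (rule card_eq_of_bool_if_Uniq)
    assume "keeps i0 \<and> disperse_pair R"
    then have kd: "keeps i0" "disperse_pair R" by simp_all
    obtain w where w: "w \<in> \<Omega>" "fst w = i0" "passes w R"
      by (rule ex_path[OF cyc kd]) (rule that)
    have cr: "crosses G P1 P2 w' i" if "w' \<in> \<Omega>" "fst w' = i0" "passes w' R" for w'
      using crosses_iff[OF cyc that cyclicD(2)[OF cyc]] by simp
    have "w' = w" if "w' \<in> \<Omega>" "fst w' = i0" "passes w' R" for w'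
      using crosses_inj[OF w(1) that(1) _ cr[OF w] cr[OF that]] w(2) that(2) by simp
    with w show "\<exists>!w. w \<in> {w \<in> \<Omega>. fst w = i0 \<and> passes w R}" by blast
  next
    assume "\<not> (keeps i0 \<and> disperse_pair R)"
    then show "{w \<in> \<Omega>. fst w = i0 \<and> passes w R} = {}" using passes_imp[OF cyc] by blast
  qed
  note one0 = one[OF cyc] and one3 = one[OF cyclic_system_reflect[OF cyc]]
  have eq: "{w \<in> \<Omega>. fst w = i0} =
      {w \<in> \<Omega>. fst w = i0 \<and> passes w R0} \<union> {w \<in> \<Omega>. fst w = i0 \<and> passes w R3}"
    using passes_cases(1)[OF cyc] by blast
  have "{w \<in> \<Omega>. fst w = i0 \<and> passes w R0} \<inter> {w \<in> \<Omega>. fst w = i0 \<and> passes w R3} = {}"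
    using passes_cases(2)[OF cyc] by blast
  with one0 one3 show "card {w \<in> \<Omega>. fst w = i0} =
      of_bool (keeps i0 \<and> disperse_pair R0) + of_bool (keeps i0 \<and> disperse_pair R3)"
    unfolding eq by (simp add: card_Un_disjoint)
  show "finite {w \<in> \<Omega>. fst w = i0}" unfolding eq using one0 one3 by simp
qed

lemma card_\<Omega>:
  assumes cyc: "cyclic i0 i1 i2 i3 R0 R1 R2 R3"
  shows "finite \<Omega>" and "card \<Omega> =
    of_bool (keeps i0 \<and> disperse_pair R0) + of_bool (keeps i0 \<and> disperse_pair R3) +
    of_bool (keeps i1 \<and> disperse_pair R1) + of_bool (keeps i1 \<and> disperse_pair R0) +
    of_bool (keeps i2 \<and> disperse_pair R2) + of_bool (keeps i2 \<and> disperse_pair R1) +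
    of_bool (keeps i3 \<and> disperse_pair R3) + of_bool (keeps i3 \<and> disperse_pair R2)"
proof -
  note rot = cyclic_system_rotate
  note cards = card_paths_at[OF cyc] card_paths_at[OF rot[OF cyc]] card_paths_at[OF rot[OF rot[OF cyc]]]
    card_paths_at[OF rot[OF rot[OF rot[OF cyc]]]]
  let ?at = "\<lambda>i. {w \<in> \<Omega>. fst w = i}"
  have "fst w \<in> {i0, i1, i2, i3}" if "w \<in> \<Omega>" for w
    using that cyclicD(5)[OF cyc] by (cases w) (simp add: \<Omega>_iff)
  then have eq: "\<Omega> = ?at i0 \<union> (?at i1 \<union> (?at i2 \<union> ?at i3))" by blast
  show "finite \<Omega>" by (subst eq) (simp add: cards)
  have d: "i0 \<noteq> i1" "i0 \<noteq> i2" "i0 \<noteq> i3" "i1 \<noteq> i2" "i1 \<noteq> i3" "i2 \<noteq> i3"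
    using cyclicD(6)[OF cyc] by simp_all
  have "card (?at i2 \<union> ?at i3) = card (?at i2) + card (?at i3)"
    by (rule card_Un_disjoint) (use cards d in auto)
  moreover have "card (?at i1 \<union> (?at i2 \<union> ?at i3)) = card (?at i1) + card (?at i2 \<union> ?at i3)"
    by (rule card_Un_disjoint) (use cards d in auto)
  moreover have "card (?at i0 \<union> (?at i1 \<union> (?at i2 \<union> ?at i3))) =
      card (?at i0) + card (?at i1 \<union> (?at i2 \<union> ?at i3))"
    by (rule card_Un_disjoint) (use cards d in auto)
  ultimately have "card \<Omega> = card (?at i0) + (card (?at i1) + (card (?at i2) + card (?at i3)))"
    using eq by simp
  then show "card \<Omega> =
    of_bool (keeps i0 \<and> disperse_pair R0) + of_bool (keeps i0 \<and> disperse_pair R3) +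
    of_bool (keeps i1 \<and> disperse_pair R1) + of_bool (keeps i1 \<and> disperse_pair R0) +
    of_bool (keeps i2 \<and> disperse_pair R2) + of_bool (keeps i2 \<and> disperse_pair R1) +
    of_bool (keeps i3 \<and> disperse_pair R3) + of_bool (keeps i3 \<and> disperse_pair R2)"
    unfolding cards by simp
qed

lemma even_card_\<Omega>: "even (card \<Omega>)"
proof -
  from ex_cyclic obtain i0 i1 i2 i3 R0 R1 R2 R3 where cyc: "cyclic i0 i1 i2 i3 R0 R1 R2 R3" by blast
  note rot = cyclic_system_rotate
  note cyc1 = rot[OF cyc]
  note cyc2 = rot[OF cyc1]
  note cyc3 = rot[OF cyc2]
  show ?thesis
    unfolding card_\<Omega>(2)[OF cyc]
    by (rule even_crossing_number[OF entered_next(2)[OF cyc] entered_next(2)[OF cyc1] entered_next(2)[OF cyc2]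
      entered_next(2)[OF cyc3] entered_not_keeping(2)[OF cyc] entered_not_keeping(2)[OF cyc3]
      entered_not_keeping(2)[OF cyc2] entered_not_keeping(2)[OF cyc1]])
qed

lemma card_\<Omega>_le:
  assumes cyc: "cyclic i0 i1 i2 i3 R0 R1 R2 R3"
  shows "card \<Omega> \<le> 2 * of_bool (keeps i0) + 2 * of_bool (keeps i1) + 2 * of_bool (keeps i2) +
    2 * of_bool (keeps i3)"
proof -
  have "of_bool (keeps i \<and> X) \<le> (of_bool (keeps i) :: nat)" for i X by simp
  note le = this
  show ?thesis
    unfolding card_\<Omega>(2)[OF cyc]
    using le[of i0 "disperse_pair R0"] le[of i0 "disperse_pair R3"] le[of i1 "disperse_pair R1"]
      le[of i1 "disperse_pair R0"] le[of i2 "disperse_pair R2"] le[of i2 "disperse_pair R1"]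
      le[of i3 "disperse_pair R3"] le[of i3 "disperse_pair R2"]
    by linarith
qed

abbreviation connected :: "nat \<times> iso_path \<Rightarrow> nat \<times> iso_path \<Rightarrow> bool" where
  "connected \<equiv> disperse_connected c G P1 P2 \<Omega> (card \<Omega> div 2)"

abbreviation chain :: "nat \<times> iso_path \<Rightarrow> nat \<times> iso_path \<Rightarrow> nat \<Rightarrow> bool" where
  "chain \<equiv> chain_connected c G P1 P2 \<Omega>"

section \<open>The unique partner of an iso-path\<close>

lemma crosses_face_nbrs: "crosses G P1 P2 w j \<Longrightarrow> face_nbrs (G (fst w)) (G j)"
  by (simp add: crosses_def)

lemma fst_in_\<Omega>:
  assumes "w \<in> \<Omega>"
  shows "fst w \<in> {1..4}" "keeps (fst w)"
proof -
  obtain i \<omega> where w: "w = (i, \<omega>)" by (cases w)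
  show "fst w \<in> {1..4}" using assms unfolding w \<Omega>_iff by simp
  show "keeps (fst w)" using assms not_in_\<Omega>_if_not_keeps[of i \<omega>] unfolding w fst_conv by blast
qed

text \<open>Common disperse nodes lie on the common face, and of its four nodes \<open>P1\<close>
  and \<open>P2\<close> have label \<open>c\<close>.\<close>

lemma directly_connected_if_common_face:
  assumes cyc: "cyclic i0 i1 i2 i3 R0 R1 R2 R3"
    and w: "w \<in> \<Omega>" "fst w = i0" "passes w R0" and w': "w' \<in> \<Omega>" "fst w' = i1" "passes w' R0"
  shows "directly_connected c G P1 P2 w w'"
proof -
  have cyc': "cyclic i1 i0 i3 i2 R0 R3 R2 R1"
    by (rule cyclic_system_reflect[OF cyclic_system_rotate[OF cyc]])
  obtain E1 E2 where b: "box_at_edge (cub (G i0)) P1 P2 (fst R0) (snd R0) (fst R3) (snd R3) E1 E2"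
    using cyclic_box[OF cyc] .
  have "carries_iso_edge c (G i0) P1 P2 (side_face P1 P2 R0)"
    "carries_iso_edge c (G i1) P1 P2 (side_face P1 P2 R0)"
    using carries_iff[OF cyc] carries_iff[OF cyc'] passes_imp[OF cyc w] passes_imp[OF cyc' w'] by blast+
  then have car: "side_face P1 P2 R0 - {P1, P2} \<subseteq> disperse_nodes c (G i0)"
    "side_face P1 P2 R0 - {P1, P2} \<subseteq> disperse_nodes c (G i1)" "lab (G i0) P1 = c" "lab (G i0) P2 = c"
    unfolding carries_iso_edge_def by blast+
  have "disperse_nodes c (G i0) \<inter> disperse_nodes c (G i1) \<subseteq> gnodes (G i0) \<inter> gnodes (G i1)"
    "P1 \<notin> disperse_nodes c (G i0)" "P2 \<notin> disperse_nodes c (G i0)"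
    using car(3,4) by (auto simp: disperse_nodes_def)
  then have "disperse_nodes c (G i0) \<inter> disperse_nodes c (G i1) = side_face P1 P2 R0 - {P1, P2}"
    using car(1,2) unfolding cyclicD(8)[OF cyc] by blast
  also have "\<dots> = {fst R0, snd R0}"
    using box_neq[OF b] box_neq[OF b, symmetric] unfolding side_face_def by blast
  finally have "card (disperse_nodes c (G i0) \<inter> disperse_nodes c (G i1)) = 2"
    using box_neq[OF b] by simp
  moreover have "crosses G P1 P2 w i1" "crosses G P1 P2 w' i0"
    using crosses_iff[OF cyc w cyclicD(2)[OF cyc]] crosses_iff[OF cyc' w' cyclicD(1)[OF cyc]] by simp_all
  ultimately show ?thesis
    using cyclicD(9)[OF cyc] w(2) w'(2) by (simp add: directly_connected_def)
qed

text \<open>The side on which \<open>w\<close> leaves its graph fixes the first graph of the walk;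
  seven disperse nodes keep the walk away from all graphs with label \<open>c\<close> at both
  ends.\<close>

lemma chain_connectedE:
  assumes cyc: "cyclic i0 i1 i2 i3 R0 R1 R2 R3"
    and w: "w \<in> \<Omega>" "fst w = i0" "passes w R0" and chain: "chain w w' l" and l: "1 \<le> l"
  obtains r where "r 1 = i1" "\<forall>k \<in> {1..l}. r k \<in> {1..4} \<and> \<not> keeps (r k)"
    "\<forall>k \<in> {1..<l}. face_nbrs (G (r k)) (G (r (k + 1)))" "crosses G P1 P2 w' (r l)"
proof -
  from chain obtain r where r: "\<forall>k \<in> {1..l}. r k \<in> {1..4}"
    "\<forall>k \<in> {1..<l}. face_nbrs (G (r k)) (G (r (k + 1)))"
    "crosses G P1 P2 w (r 1)" "crosses G P1 P2 w' (r l)"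
    "\<forall>k \<in> {1..l}. 7 \<le> D c (G (r k)) \<and> (\<forall>\<omega>. (r k, \<omega>) \<notin> \<Omega>)"
    unfolding chain_connected_def by blast
  have "r 1 \<in> {1..4}" using r(1) l by simp
  then have "r 1 = i1" using crosses_iff[OF cyc w] r(3) by blast
  moreover have "\<forall>k \<in> {1..l}. r k \<in> {1..4} \<and> \<not> keeps (r k)"
    using r(1,5) not_keeps_if_D_ge_7 by blast
  ultimately show ?thesis using that r(2,4) by blast
qed

text \<open>Uniqueness is required jointly for length and end point: the former yields the unique
  \<open>l\<close> in \<open>disperse_connected\<close>, the latter the uniqueness of the
  partner.\<close>

lemma connected_if_unique_chain:
  assumes w: "w \<in> \<Omega>" "w' \<in> \<Omega>" "w' \<noteq> w" and chain: "chain w w' l" "l \<in> {1..4 - card \<Omega> div 2}"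
    and direct: "\<And>v. v \<in> \<Omega> \<Longrightarrow> \<not> directly_connected c G P1 P2 w v"
    and unique: "\<And>v k. v \<in> \<Omega> \<Longrightarrow> v \<noteq> w \<Longrightarrow> k \<in> {1..4 - card \<Omega> div 2} \<Longrightarrow> chain w v k \<Longrightarrow>
      k = l \<and> v = w'"
  shows "\<exists>w' \<in> \<Omega>. w' \<noteq> w \<and> connected w w' \<and> (\<forall>v \<in> \<Omega>. v \<noteq> w \<longrightarrow> connected w v \<longrightarrow> v = w')"
proof (intro bexI[OF _ w(2)] conjI ballI impI)
  show "w' \<noteq> w" by (rule w(3))
  have "\<exists>!k. k \<in> {1..4 - card \<Omega> div 2} \<and> chain w w' k"
    using chain unique[OF w(2,3)] by blast
  moreover have "card \<Omega> div 2 \<le> 3" using chain(2) unfolding atLeastAtMost_iff by arith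
  ultimately show "connected w w'"
    using direct[OF w(2)] unfolding disperse_connected_def by blast
  fix v
  assume v: "v \<in> \<Omega>" "v \<noteq> w" "connected w v"
  then obtain k where "k \<in> {1..4 - card \<Omega> div 2}" "chain w v k"
    using direct[OF v(1)] unfolding disperse_connected_def by blast
  then show "v = w'" using unique[OF v(1,2)] by blast
qed

text \<open>The partner belongs to the first of the graphs \<open>i1\<close>, \<open>i2\<close>,
  \<open>i3\<close>, \<open>i0\<close> that keeps the edge labels, which gives a direct connection
  or a chain of length 1, 2 or 3. In the last case it is the second iso-path of \<open>i0\<close>
  itself, along its other face.\<close>

lemma partner:
  assumes cyc: "cyclic i0 i1 i2 i3 R0 R1 R2 R3" and w: "w \<in> \<Omega>" "fst w = i0" "passes w R0"
  shows "\<exists>w' \<in> \<Omega>. w' \<noteq> w \<and> connected w w' \<and> (\<forall>v \<in> \<Omega>. v \<noteq> w \<longrightarrow> connected w v \<longrightarrow> v = w')"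
proof -
  note rot = cyclic_system_rotate
  note cyc1 = rot[OF cyc]
  note cyc2 = rot[OF cyc1]
  note cyc3 = rot[OF cyc2]
  note back1 = cyclic_system_reflect[OF cyc1] and back2 = cyclic_system_reflect[OF cyc2]
    and back3 = cyclic_system_reflect[OF cyc3]
  note ids = cyclicD(1-4)[OF cyc]
  have d: "i0 \<noteq> i1" "i0 \<noteq> i2" "i0 \<noteq> i3" "i1 \<noteq> i2" "i1 \<noteq> i3" "i2 \<noteq> i3"
    using cyclicD(6)[OF cyc] by simp_all
  note K0 = passes_imp(1)[OF cyc w] and R0 = passes_imp(2)[OF cyc w]
  note cross = crosses_iff[OF cyc w]
  have fn: "face_nbrs (G i0) (G i1)" "face_nbrs (G i1) (G i2)" "face_nbrs (G i2) (G i3)"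
    "face_nbrs (G i3) (G i0)"
    using cyclicD(9) cyc cyc1 cyc2 cyc3 by blast+
  have n1: "j = i0 \<or> j = i2" if "face_nbrs (G i1) (G j)" "j \<in> {1..4}" for j
    using neighbor_cases[OF cyc1 that(2,1)] by blast
  have n2: "j = i1 \<or> j = i3" if "face_nbrs (G i2) (G j)" "j \<in> {1..4}" for j
    using neighbor_cases[OF cyc2 that(2,1)] by blast
  have at: "fst v \<in> {1..4}" "keeps (fst v)" "face_nbrs (G j) (G (fst v))"
    if "v \<in> \<Omega>" "crosses G P1 P2 v j" for v j
    using fst_in_\<Omega>[OF that(1)] crosses_face_nbrs[OF that(2)] face_neighbors_commute by blast+
  have le: "of_bool P \<le> (1 :: nat)" and zero: "\<not> P \<Longrightarrow> of_bool P = (0 :: nat)" for P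
    by simp_all
  have card_pos: "1 \<le> card \<Omega> div 2"
  proof -
    have "0 < card \<Omega>" using w(1) card_\<Omega>(1)[OF cyc] card_gt_0_iff by blast
    then show ?thesis using even_card_\<Omega> by (auto elim: evenE)
  qed
  \<comment> \<open>This excludes walks that turn back and end at \<open>i1\<close> as seen from
    \<open>i0\<close>.\<close>
  have self: "v = w" if "v \<in> \<Omega>" "fst v = i0" "crosses G P1 P2 v i1" for v
    using crosses_inj[OF w(1) that(1), of i1] that w(2) cross[OF ids(2)] by simp
  show ?thesis
  proof (cases "keeps i1")
    case True
    obtain w' where w': "w' \<in> \<Omega>" "fst w' = i1" "passes w' R0"
      by (rule ex_path[OF back1 True R0]) (rule that)
    have direct: "directly_connected c G P1 P2 w w'"
      by (rule directly_connected_if_common_face[OF cyc w w'])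
    have "v = w'" if v: "v \<in> \<Omega>" "connected w v" for v
      using v(2) unfolding disperse_connected_def
    proof
      assume "directly_connected c G P1 P2 w v"
      then have "crosses G P1 P2 w (fst v)" "crosses G P1 P2 v i0"
        using w(2) by (simp_all add: directly_connected_def)
      then have "fst v = i1" "crosses G P1 P2 v i0" using cross fst_in_\<Omega>(1)[OF v(1)] by blast+
      moreover have "crosses G P1 P2 w' i0" using crosses_iff[OF back1 w' ids(1)] by simp
      ultimately show "v = w'" using crosses_inj[OF w'(1) v(1)] w'(2) by simp
    next
      assume "\<not> directly_connected c G P1 P2 w v \<and> card \<Omega> div 2 \<le> 3 \<and>
        (\<exists>!l. l \<in> {1..4 - card \<Omega> div 2} \<and> chain w v l)"
      then obtain l where l: "1 \<le> l" "chain w v l" by auto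
      obtain r where "r 1 = i1" "\<forall>k \<in> {1..l}. r k \<in> {1..4} \<and> \<not> keeps (r k)"
        by (rule chain_connectedE[OF cyc w l(2,1)]) (rule that)
      then show "v = w'" using True l(1) by fastforce
    qed
    moreover have "connected w w'" using direct unfolding disperse_connected_def by blast
    moreover have "w' \<noteq> w" using w(2) w'(2) d(1) by metis
    ultimately show ?thesis using w'(1) by blast
  next
    case K1: False
    have direct: "\<not> directly_connected c G P1 P2 w v" if "v \<in> \<Omega>" for v
      using cross[OF fst_in_\<Omega>(1)[OF that]] fst_in_\<Omega>(2)[OF that] K1
      unfolding directly_connected_def by metis
    note D1 = entered_next(1)[OF cyc K1 disjI1[OF R0]]
    note no1 = not_in_\<Omega>_if_not_keeps[OF K1]
    have R12: "disperse_pair R1 \<or> \<not> keeps i2 \<and> disperse_pair R2"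
      by (rule entered_next(2)[OF cyc K1 R0])
    have cross1: "crosses G P1 P2 w i1" using cross[OF ids(2)] by simp
    show ?thesis
    proof (cases "keeps i2")
      case K2: True
      with R12 have R1: "disperse_pair R1" by blast
      obtain w' where w': "w' \<in> \<Omega>" "fst w' = i2" "passes w' R1"
        by (rule ex_path[OF back2 K2 R1]) (rule that)
      have cross': "crosses G P1 P2 w' i1" using crosses_iff[OF back2 w' ids(2)] by simp
      have "chain w w' 1"
        unfolding chain_connected_def
        by (rule exI[of _ "\<lambda>_. i1"]) (use ids fn w(2) w'(2) cross1 cross' D1 no1 in simp)
      moreover have "1 \<in> {1..4 - card \<Omega> div 2}"
      proof -
        have "card \<Omega> \<le> 6"
          using card_\<Omega>_le[OF cyc] zero[OF K1] le[of "keeps i0"] le[of "keeps i2"] le[of "keeps i3"]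
          by linarith
        then show ?thesis unfolding atLeastAtMost_iff by arith
      qed
      moreover have "k = 1 \<and> v = w'"
        if v: "v \<in> \<Omega>" "v \<noteq> w" "k \<in> {1..4 - card \<Omega> div 2}" "chain w v k" for v k
      proof -
        have "1 \<le> k" using v(3) by simp
        obtain r where r: "r 1 = i1" "\<forall>l \<in> {1..k}. r l \<in> {1..4} \<and> \<not> keeps (r l)"
          "\<forall>l \<in> {1..<k}. face_nbrs (G (r l)) (G (r (l + 1)))" "crosses G P1 P2 v (r k)"
          by (rule chain_connectedE[OF cyc w v(4) \<open>1 \<le> k\<close>]) (rule that)
        \<comment> \<open>From \<open>i1\<close> the walk could continue only to \<open>i0\<close>
          or \<open>i2\<close>, and both keep the edge labels.\<close>
        have "k = 1"
        proof (rule ccontr)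
          assume "k \<noteq> 1"
          with \<open>1 \<le> k\<close> have "1 \<in> {1..<k}" "2 \<in> {1..k}" by auto
          then have "r 2 = i0 \<or> r 2 = i2" "\<not> keeps (r 2)"
            using n1[of "r 2"] bspec[OF r(3), of 1] bspec[OF r(2), of 2] r(1) by (auto simp: numeral_2_eq_2)
          then show False using K0 K2 by metis
        qed
        with r(1,4) have cr: "crosses G P1 P2 v i1" by simp
        have "fst v = i0 \<or> fst v = i2" using n1 at[OF v(1) cr] by blast
        then have "fst v = i2" using self[OF v(1) _ cr] v(2) by blast
        then show ?thesis
          using crosses_inj[OF w'(1) v(1) _ cross' cr] w'(2) \<open>k = 1\<close> by simp
      qed
      moreover have "w' \<noteq> w" using w(2) w'(2) d(2) by metis
      ultimately show ?thesis
        using connected_if_unique_chain[OF w(1) w'(1)] direct by blast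
    next
      case K2: False
      have D2: "7 \<le> D c (G i2)" using entered_next(1)[OF cyc1 K2] R12 by blast
      note no2 = not_in_\<Omega>_if_not_keeps[OF K2]
      show ?thesis
      proof (cases "keeps i3")
        case K3: True
        have R2: "disperse_pair R2" using R12 entered_next(2)[OF cyc1 K2] K3 by blast
        obtain w' where w': "w' \<in> \<Omega>" "fst w' = i3" "passes w' R2"
          by (rule ex_path[OF back3 K3 R2]) (rule that)
        have cross': "crosses G P1 P2 w' i2" using crosses_iff[OF back3 w' ids(3)] by simp
        have "chain w w' 2"
          unfolding chain_connected_def
          by (rule exI[of _ "\<lambda>k. if k = 1 then i1 else i2"])
            (use ids fn w(2) w'(2) cross1 cross' D1 D2 no1 no2 face_neighbors_commute in auto)
        moreover have "2 \<in> {1..4 - card \<Omega> div 2}"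
        proof -
          have "card \<Omega> \<le> 4"
            using card_\<Omega>_le[OF cyc] zero[OF K1] zero[OF K2] le[of "keeps i0"] le[of "keeps i3"]
            by linarith
          then show ?thesis unfolding atLeastAtMost_iff by arith
        qed
        moreover have "k = 2 \<and> v = w'"
          if v: "v \<in> \<Omega>" "v \<noteq> w" "k \<in> {1..4 - card \<Omega> div 2}" "chain w v k" for v k
        proof -
          \<comment> \<open>The length stays below 4 because \<open>m\<close> is positive. A walk
            \<open>i1\<close>, \<open>i2\<close>, \<open>i1\<close>, \<open>i2\<close> would reach
            \<open>w'\<close> a second time.\<close>
          have k: "1 \<le> k" "k = 1 \<or> k = 2 \<or> k = 3" using v(3) card_pos by auto
          obtain r where r: "r 1 = i1" "\<forall>l \<in> {1..k}. r l \<in> {1..4} \<and> \<not> keeps (r l)"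
            "\<forall>l \<in> {1..<k}. face_nbrs (G (r l)) (G (r (l + 1)))" "crosses G P1 P2 v (r k)"
            by (rule chain_connectedE[OF cyc w v(4) k(1)]) (rule that)
          have r2: "r 2 = i2" if "2 \<le> k"
          proof -
            have "1 \<in> {1..<k}" "2 \<in> {1..k}" using that by auto
            then have "r 2 = i0 \<or> r 2 = i2" "\<not> keeps (r 2)"
              using n1[of "r 2"] bspec[OF r(3), of 1] bspec[OF r(2), of 2] r(1) by (auto simp: numeral_2_eq_2)
            then show ?thesis using K0 by metis
          qed
          \<comment> \<open>A third graph means turning back to \<open>i1\<close>, and
            \<open>not_i1\<close> below shows that no iso-path other than \<open>w\<close> is met
            from there.\<close>
          have r3: "r 3 = i1" if "k = 3"
          proof -
            have "2 \<in> {1..<k}" "3 \<in> {1..k}" using that by auto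
            then have "r 3 = i1 \<or> r 3 = i3" "\<not> keeps (r 3)"
              using n2[of "r 3"] bspec[OF r(3), of 2] bspec[OF r(2), of 3] r2 that by auto
            then show ?thesis using K3 by metis
          qed
          have not_i1: "\<not> crosses G P1 P2 v i1"
          proof
            assume cr: "crosses G P1 P2 v i1"
            have "fst v = i0 \<or> fst v = i2" using n1 at[OF v(1) cr] by blast
            then show False using self[OF v(1) _ cr] v(2) at(2)[OF v(1) cr] K2 by metis
          qed
          have "k = 2" using k(2) r(1,4) r3 not_i1 by auto
          with r(4) r2 have cr: "crosses G P1 P2 v i2" by simp
          have "fst v = i1 \<or> fst v = i3" using n2 at[OF v(1) cr] by blast
          then have "fst v = i3" using at(2)[OF v(1) cr] K1 by metis
          then show ?thesis
            using crosses_inj[OF w'(1) v(1) _ cross' cr] w'(2) \<open>k = 2\<close> by simp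
        qed
        moreover have "w' \<noteq> w" using w(2) w'(2) d(3) by metis
        ultimately show ?thesis
          using connected_if_unique_chain[OF w(1) w'(1)] direct by blast
      next
        case K3: False
        have R3: "disperse_pair R3"
          using R12 entered_next(2)[OF cyc1 K2] entered_next(2)[OF cyc2 K3] K0 by blast
        have D3: "7 \<le> D c (G i3)" using entered_next(1)[OF cyc2 K3] R3 by blast
        note no3 = not_in_\<Omega>_if_not_keeps[OF K3]
        note back0 = cyclic_system_reflect[OF cyc]
        obtain w' where w': "w' \<in> \<Omega>" "fst w' = i0" "passes w' R3"
          by (rule ex_path[OF back0 K0 R3]) (rule that)
        have cross': "crosses G P1 P2 w' i3" using crosses_iff[OF back0 w' ids(4)] by simp
        have "chain w w' 3"
          unfolding chain_connected_def
          by (rule exI[of _ "\<lambda>k. if k = 1 then i1 else if k = 2 then i2 else i3"])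
            (use ids fn w(2) w'(2) cross1 cross' D1 D2 D3 no1 no2 no3 in \<open>auto simp: le_Suc_eq\<close>)
        moreover have "3 \<in> {1..4 - card \<Omega> div 2}"
        proof -
          have "card \<Omega> \<le> 2"
            using card_\<Omega>_le[OF cyc] zero[OF K1] zero[OF K2] zero[OF K3] le[of "keeps i0"]
            by linarith
          then show ?thesis unfolding atLeastAtMost_iff by arith
        qed
        moreover have "k = 3 \<and> v = w'"
          if v: "v \<in> \<Omega>" "v \<noteq> w" "k \<in> {1..4 - card \<Omega> div 2}" "chain w v k" for v k
        proof -
          have k: "1 \<le> k" "k = 1 \<or> k = 2 \<or> k = 3" using v(3) card_pos by auto
          obtain r where r: "r 1 = i1" "\<forall>l \<in> {1..k}. r l \<in> {1..4} \<and> \<not> keeps (r l)"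
            "\<forall>l \<in> {1..<k}. face_nbrs (G (r l)) (G (r (l + 1)))" "crosses G P1 P2 v (r k)"
            by (rule chain_connectedE[OF cyc w v(4) k(1)]) (rule that)
          have v0: "fst v = i0"
          proof -
            have "fst v \<in> {i0, i1, i2, i3}" using at(1)[OF v(1) r(4)] cyclicD(5)[OF cyc] by simp
            then show ?thesis using at(2)[OF v(1) r(4)] K1 K2 K3 by blast
          qed
          have "r k = i1 \<or> r k = i3"
            using neighbor_cases[OF cyc] crosses_face_nbrs[OF r(4)] r(2) k(1) v0 by simp
          then have "r k = i3" using self[OF v(1) v0] v(2) r(4) by metis
          have "k = 3"
          proof (rule ccontr)
            assume "k \<noteq> 3"
            moreover have "k \<noteq> 1" using \<open>r k = i3\<close> r(1) d by metis
            ultimately have "k = 2" using k(2) by blast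
            then have "face_nbrs (G i1) (G i3)"
              using bspec[OF r(3), of 1] r(1) \<open>r k = i3\<close> by (simp add: numeral_2_eq_2)
            then show False using n1[of i3] ids d by metis
          qed
          have "crosses G P1 P2 v i3" using r(4) \<open>r k = i3\<close> by simp
          then show ?thesis
            using crosses_inj[OF w'(1) v(1) _ cross'] w'(2) v0 \<open>k = 3\<close> by simp
        qed
        moreover have "w' \<noteq> w" using passes_cases(2)[OF cyc w(1,2)] w(3) w'(3) by metis
        ultimately show ?thesis
          using connected_if_unique_chain[OF w(1) w'(1)] direct by blast
      qed
    qed
  qed
qed

lemma ex_cyclic_at_path:
  assumes "w \<in> \<Omega>"
  obtains i1 i2 i3 R0 R1 R2 R3 where "cyclic (fst w) i1 i2 i3 R0 R1 R2 R3" "passes w R0"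
proof -
  from ex_cyclic obtain i0 i1 i2 i3 R0 R1 R2 R3 where cyc: "cyclic i0 i1 i2 i3 R0 R1 R2 R3" by blast
  note rot = cyclic_system_rotate
  have "fst w \<in> {i0, i1, i2, i3}" using fst_in_\<Omega>(1)[OF assms] cyclicD(5)[OF cyc] by simp
  then have "\<exists>j1 j2 j3 S0 S1 S2 S3. cyclic (fst w) j1 j2 j3 S0 S1 S2 S3"
    using cyc rot[OF cyc] rot[OF rot[OF cyc]] rot[OF rot[OF rot[OF cyc]]] by blast
  then obtain j1 j2 j3 S0 S1 S2 S3 where cyc': "cyclic (fst w) j1 j2 j3 S0 S1 S2 S3" by blast
  from passes_cases(1)[OF cyc' assms refl] show ?thesis
    using that cyc' cyclic_system_reflect[OF cyc'] by blast
qed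

lemma card_\<Omega>_le_8: "card \<Omega> \<le> 8"
proof -
  from ex_cyclic obtain i0 i1 i2 i3 R0 R1 R2 R3 where cyc: "cyclic i0 i1 i2 i3 R0 R1 R2 R3" by blast
  have "of_bool P \<le> (1 :: nat)" for P by simp
  from card_\<Omega>_le[OF cyc] this[of "keeps i0"] this[of "keeps i1"] this[of "keeps i2"] this[of "keeps i3"]
  show ?thesis by linarith
qed

lemma disperse_pairing:
  "finite \<Omega> \<and> (\<exists>m \<le> 4. card \<Omega> = 2 * m \<and>
    (\<forall>w \<in> \<Omega>. \<exists>w' \<in> \<Omega>. w' \<noteq> w \<and> disperse_connected c G P1 P2 \<Omega> m w w' \<and>
       (\<forall>w'' \<in> \<Omega>. w'' \<noteq> w \<and> w'' \<noteq> w' \<longrightarrow>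
          \<not> disperse_connected c G P1 P2 \<Omega> m w w'' \<and>
          \<not> disperse_connected c G P1 P2 \<Omega> m w' w'')))"
proof (intro conjI exI[of _ "card \<Omega> div 2"] ballI)
  show "finite \<Omega>" using ex_cyclic card_\<Omega>(1) by blast
  show "card \<Omega> div 2 \<le> 4" using card_\<Omega>_le_8 by simp
  show "card \<Omega> = 2 * (card \<Omega> div 2)" using even_card_\<Omega> by simp
  have ex: "\<exists>w' \<in> \<Omega>. w' \<noteq> w \<and> connected w w' \<and> (\<forall>v \<in> \<Omega>. v \<noteq> w \<longrightarrow> connected w v \<longrightarrow> v = w')"
    if w: "w \<in> \<Omega>" for w
  proof -
    obtain i1 i2 i3 R0 R1 R2 R3 where "cyclic (fst w) i1 i2 i3 R0 R1 R2 R3" "passes w R0"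
      by (rule ex_cyclic_at_path[OF w]) (rule that)
    from partner[OF this(1) w refl this(2)] show ?thesis .
  qed
  fix w assume w: "w \<in> \<Omega>"
  from ex[OF w] obtain w' where w': "w' \<in> \<Omega>" "w' \<noteq> w" "connected w w'"
    "\<forall>v \<in> \<Omega>. v \<noteq> w \<longrightarrow> connected w v \<longrightarrow> v = w'" by blast
  \<comment> \<open>The path \<open>w'\<close> has a unique partner as well, which by symmetry must
    be \<open>w\<close>; this gives uniqueness on the side of \<open>w'\<close>.\<close>
  from ex[OF w'(1)] obtain u where u: "\<forall>v \<in> \<Omega>. v \<noteq> w' \<longrightarrow> connected w' v \<longrightarrow> v = u" by blast
  have cw: "connected w' w" using w'(3) by (subst disperse_connected_sym)
  have "u = w" by (rule sym) (rule u[rule_format, OF w w'(2)[symmetric] cw])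
  show "\<exists>w' \<in> \<Omega>. w' \<noteq> w \<and> connected w w' \<and> (\<forall>w'' \<in> \<Omega>. w'' \<noteq> w \<and> w'' \<noteq> w' \<longrightarrow>
      \<not> connected w w'' \<and> \<not> connected w' w'')"
  proof (intro bexI[OF _ w'(1)] conjI ballI impI)
    show "w' \<noteq> w" "connected w w'" by (fact w')+
    fix v assume v: "v \<in> \<Omega>" "v \<noteq> w \<and> v \<noteq> w'"
    show "\<not> connected w v" using bspec[OF w'(4) v(1)] v(2) by blast
    show "\<not> connected w' v" using bspec[OF u v(1)] v(2) \<open>u = w\<close> by blast
  qed
qed

end

lemma lab_iso_node:
  assumes "is_cuboid (cub G)" "iso_node c G v"
  shows "lab G v = c"
proof -
  from assms(2) obtain x0 x1 where "(x0, x1) \<in> mixed_edges c G" "v = iso_point c G x0 x1" "v \<in> gnodes G"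
    unfolding iso_node_def iso_points_def by blast
  then show ?thesis using iso_point_eq_node[OF assms(1), of x0 x1 c] by simp
qed

theorem theorem6p8:
  fixes c :: real and C :: "nat \<Rightarrow> cuboid" and G :: "nat \<Rightarrow> lcgraph" and P1 P2 :: point
    and inner outer :: "nat \<Rightarrow> iso_path set"
  assumes "0 < c" and "c < 1"
    and "system_of_cuboids C P1 P2"
    and "system_of_graphs c C G P1 P2"
    and "iso_node c (G 1) P1" and "iso_node c (G 1) P2"
    and "\<And>i. i \<in> {1..4} \<Longrightarrow> inner_iso_paths c (G ` {1..4}) (G i) (inner i)"
    and "\<And>i. i \<in> {1..4} \<Longrightarrow> outer_iso_paths c (G ` {1..4}) (G i) (outer i)"
  defines "\<Omega> \<equiv> paths_through P1 P2 (\<lambda>i. inner i \<union> outer i)"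
  shows "finite \<Omega> \<and> (\<exists>m \<le> 4. card \<Omega> = 2 * m \<and>
    (\<forall>w \<in> \<Omega>. \<exists>w' \<in> \<Omega>. w' \<noteq> w \<and> disperse_connected c G P1 P2 \<Omega> m w w' \<and>
       (\<forall>w'' \<in> \<Omega>. w'' \<noteq> w \<and> w'' \<noteq> w' \<longrightarrow>
          \<not> disperse_connected c G P1 P2 \<Omega> m w w'' \<and>
          \<not> disperse_connected c G P1 P2 \<Omega> m w' w'')))"
proof -
  from assms(4) obtain F where G: "\<forall>i \<in> {1..4}. cub (G i) = C i \<and> labeled_cuboid_graph (G i) \<and>
        singular_free c (G i) \<and> isolated_free c (G ` {1..4}) (G i)"
    and F: "\<forall>i \<in> {1..4}. \<exists>G'. removal c ((\<lambda>j. \<lparr>cub = C j, lab = F\<rparr>) ` {1..4}) \<lparr>cub = C i, lab = F\<rparr> G' \<and>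
        (\<forall>v \<in> nodes (C i). lab (G i) v = lab G' v)"
    unfolding system_of_graphs_def by blast
  have one: "1 \<in> {1..4 :: nat}" by simp
  \<comment> \<open>The removal relabels only nodes of label \<open>c\<close>, so a node with label
    \<open>c\<close> after it had this label before.\<close>
  have label: "F v = c" if v: "iso_node c (G 1) v" for v
  proof -
    have "lab (G 1) v = c"
    proof (rule lab_iso_node[OF _ v])
      show "is_cuboid (cub (G 1))"
        using bspec[OF G one] unfolding labeled_cuboid_graph_def by blast
    qed
    moreover have "v \<in> nodes (C 1)" using v bspec[OF G one] by (simp add: iso_node_def)
    moreover from bspec[OF F one] obtain G'
      where G': "removal c ((\<lambda>j. \<lparr>cub = C j, lab = F\<rparr>) ` {1..4}) \<lparr>cub = C 1, lab = F\<rparr> G'"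
        "\<forall>v \<in> nodes (C 1). lab (G 1) v = lab G' v" by blast
    ultimately show ?thesis using lab_removal[OF G'(1), of v] assms(2) by auto
  qed
  interpret edge_system c C G P1 P2 F inner outer
  proof
    show "0 < c" "c < 1" "system_of_cuboids C P1 P2" by (fact assms)+
    show "F P1 = c" "F P2 = c" by (rule label, fact assms)+
    fix i :: nat assume i: "i \<in> {1..4}"
    show "cub (G i) = C i" "singular_free c (G i)" "isolated_free c (G ` {1..4}) (G i)"
      using bspec[OF G i] by blast+
    show "inner_iso_paths c (G ` {1..4}) (G i) (inner i)" "outer_iso_paths c (G ` {1..4}) (G i) (outer i)"
      by (fact assms(7)[OF i] assms(8)[OF i])+
    show "\<exists>G'. removal c ((\<lambda>j. \<lparr>cub = C j, lab = F\<rparr>) ` {1..4}) \<lparr>cub = C i, lab = F\<rparr> G' \<and>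
        (\<forall>v \<in> nodes (C i). lab (G i) v = lab G' v)"
      by (rule bspec[OF F i])
  qed
  show ?thesis unfolding \<Omega>_def by (rule disperse_pairing)
qed

end
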